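(* Let $\left(\{\mathcal H_{X,x}\}_{x\in X},\ i_{a,X}:a\to\prod_{x\in X}\mathcal H_{X,x}\right)$ and $\left(\{\mathcal H_{Y,y}\}_{y\in Y},\ i_{b,Y}:b\to\prod_{y\in Y}\mathcal H_{Y,y}\right)$ be two networks of hybrid open systems. A morphism of networks of hybrid open systems $((\varphi,\Phi),z):(\mathcal H_X,i_{a,X})\to(\mathcal H_Y,i_{b,Y})$ induces a 1-morphism $$\begin{array}{ccc}\prod_{y\in Y}\mathrm{Crl}_{\mathbb U}(\mathcal H_{Y,y})&\xrightarrow{\ \mathrm{Crl}_{\mathbb U}(\Phi)\ }&\prod_{x\in X}\mathrm{Crl}_{\mathbb U}(\mathcal H_{X,x})\\ {\scriptstyle \mathrm{Crl}_{\mathbb U}(i_{b,Y})\circ\mathscr P_Y}\downarrow&\Downarrow&\downarrow{\scriptstyle \mathrm{Crl}_{\mathbb U}(i_{a,X})\circ\mathscr P_X}\\ \mathrm{Crl}_{\mathbb U}(b)&\xrightarrow{\ \mathrm{Crl}_{\mathbb U}(z)\ }&\mathrm{Crl}_{\mathbb U}(a)\end{array}$$ in $\mathsf{Set}^\square$ (horizontal arrows are relations, vertical arrows are functions), where $\mathrm{Crl}_{\mathbb U}(a)=\{X:\mathbb U a_{tot}\to T\mathbb U a_{st}\text{ smooth}:\ \mathbb U p_a=\tau_{\mathbb U a_{st}}\circ X\}$ and $\mathrm{Crl}_{\mathbb U}(\Phi)$ is the set of pairs $\big((w_y)_{y\in Y},(v_x)_{x\in X}\big)\in\prod_y\mathrm{Crl}_{\mathbb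 U}(\mathcal H_{Y,y})\times\prod_x\mathrm{Crl}_{\mathbb U}(\mathcal H_{X,x})$ such that $(w_{\varphi(x)},v_x)\in\mathrm{Crl}_{\mathbb U}(\Phi_x)$ for all $x\in X$.
   Context: $\mathsf{Man}$ is the category of smooth manifolds with corners and smooth maps; $T$ is the tangent functor and $\tau_M:TM\to M$ the projection. A hybrid phase space $a$ is a functor of double categories from a small category $\mathbb S^a$ (viewed as a discrete double category) to the double category of manifolds, smooth maps and relations. Concretely: $a$ assigns a manifold $a(s)$ to each object (node) $s$ of $\mathbb S^a$ and a relation $a(\gamma)\subseteq a(s)\times a(s')$ to each morphism (edge) $\gamma:s\to s'$, with $a(\mathrm{id}_s)$ the diagonal and $a(\gamma'\circ\gamma)=a(\gamma')\circ a(\gamma)$. A morphism $f=(\varphi,\mathfrak f):a\to b$ is a functor $\varphi:\mathbb S^a\to\mathbb S^b$ with smooth maps $\mathfrak f_s:a(s)\to b(\varphi(s))$ such that $(\mathfrak f_s\times\mathfrak f_{s'})(a(\gamma))\subseteq b(\varphi(\gamma))$ for every edge $\gamma:s\to s'$. This is the category $\mathsf{HyPh}$. The functor $\mathbb U:\mathsf{HyPh}\to\mathsf{Man}$ sends $a$ to $\bigsqcup_{s}a(s)$ (taken to be an object of $\mathsf{Man}$), with $\mathbb U f$ given by $\mathfrak f_s$ on the $s$-component. Products: $\mathbb S^{a\times b}=\mathbb S^a\times\mathbb S^b$, $(a\times b)(s,s')=a(s)\times b(s')$, and $(a\times b)(\gamma,\gamma')$ is $a(\gamma)\times b(\gamma')$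 after reordering factors; similarly for finite products. A hybrid surjective submersion $a$ is a morphism $p_a:a_{tot}\to a_{st}$ in $\mathsf{HyPh}$ such that $\mathbb U p_a$ is a surjective submersion. A morphism $f:a\to b$ is a pair $f_{tot}:a_{tot}\to b_{tot}$, $f_{st}:a_{st}\to b_{st}$ in $\mathsf{HyPh}$ with $p_b\circ f_{tot}=f_{st}\circ p_a$. This is the category $\mathsf{HySSub}$; finite products are componentwise. A morphism is an interconnection if $f_{st}$ is an isomorphism in $\mathsf{HyPh}$. For $f:a\to b$ in $\mathsf{HySSub}$, $\mathrm{Crl}_{\mathbb U}(f)\subseteq\mathrm{Crl}_{\mathbb U}(a)\times\mathrm{Crl}_{\mathbb U}(b)$ is the relation of $f$-related pairs $(X,Y)$, i.e. $T\mathbb U f_{st}\circ X=Y\circ\mathbb U f_{tot}$. If $i:a\to b$ is an interconnection, $\mathrm{Crl}_{\mathbb U}(i)$ also denotes the function $\mathrm{Crl}_{\mathbb U}(b)\to\mathrm{Crl}_{\mathbb U}(a)$, $Y\mapsto T(\mathbb U i_{st})^{-1}\circ Y\circ\mathbb U i_{tot}$ (used for the vertical arrows). For a finite family $(a_x)_{x\in X}$, with $\gamma_\bullet:\mathbb U(\prod_x a_{x,\bullet})\cong\prod_x\mathbb U a_{x,\bullet}$ the canonical isomorphisms ($\bullet=tot,st$), $\mathscr P_X:\prod_x\mathrm{Crl}_{\mathbb U}(a_x)\to\mathrm{Crl}_{\mathbb U}(\prod_x a_x)$ sends $(v_x)_x$ to $T\gamma_{st}^{-1}\circ(\prod_x v_x)\circ\gamma_{tot}$,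 identifying $T$ of a product with the product of tangent bundles. A network of hybrid open systems is a pair consisting of a family $\{\mathcal H_{X,x}\}_{x\in X}$ in $\mathsf{HySSub}$ indexed by a finite set $X$ and an interconnection $i_{a,X}:a\to\prod_{x\in X}\mathcal H_{X,x}$. A morphism $((\varphi,\Phi),z):(\mathcal H_X,i_{a,X})\to(\mathcal H_Y,i_{b,Y})$ consists of a map of sets $\varphi:X\to Y$, morphisms $\Phi_x:\mathcal H_{Y,\varphi(x)}\to\mathcal H_{X,x}$ in $\mathsf{HySSub}$ for $x\in X$, and a morphism $z:b\to a$ in $\mathsf{HySSub}$ with $i_{a,X}\circ z=\Pi(\varphi,\Phi)\circ i_{b,Y}$, where $\Pi(\varphi,\Phi):\prod_{y}\mathcal H_{Y,y}\to\prod_x\mathcal H_{X,x}$ is the unique morphism with $\mathrm{pr}_x\circ\Pi(\varphi,\Phi)=\Phi_x\circ\mathrm{pr}_{\varphi(x)}$. $\mathsf{Set}^\square$ is the double category of sets, with functions as vertical arrows and relations as horizontal arrows; a 1-morphism from $R\subseteq A\times B$ to $R'\subseteq A'\times B'$ along functions $g:A\to A'$, $h:B\to B'$ is the inclusion $(g\times h)(R)\subseteq R'$. *)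

theory Defs
  imports "HOL-Analysis.Analysis"
begin

section \<open>Smooth functions on subsets of finite-dimensional coordinate spaces\<close>

text \<open>
  Manifolds here may have components of different dimensions, and products and tangent bundles
  change the dimension.  The coordinate space \<open>\<real>\<^sup>I\<close>, for a finite set \<open>I :: 'i set\<close>, is therefore
  the topological space \<^term>\<open>powertop_real I\<close>, whose points are the extensional functions
  \<^term>\<open>I \<rightarrow>\<^sub>E UNIV\<close>.  Since \<open>I\<close> is any finite subset of an arbitrary type (for instance \<open>nat\<close>),
  all finite dimensions occur at once.
\<close>

text \<open>
  The \<open>i\<close>-th partial derivative at \<open>x\<close> of a function on \<open>A\<close>.  It is the usual one for open \<open>A\<close>,
  and a one-sided one at boundary points of a relatively open subset of a sector.
\<close>
definition pdv :: "('i \<Rightarrow> real) set \<Rightarrow> 'i \<Rightarrow> (('i \<Rightarrow> real) \<Rightarrow> real) \<Rightarrow> ('i \<Rightarrow> real) \<Rightarrow> real" where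
  "pdv A i f x = vector_derivative (\<lambda>t. f (x(i := t))) (at (x i) within {t. x(i := t) \<in> A})"

primrec Ck_on_open :: "nat \<Rightarrow> 'i set \<Rightarrow> ('i \<Rightarrow> real) set \<Rightarrow> (('i \<Rightarrow> real) \<Rightarrow> real) \<Rightarrow> bool" where
  "Ck_on_open 0 I W f \<longleftrightarrow> continuous_map (subtopology (powertop_real I) W) euclideanreal f"
| "Ck_on_open (Suc k) I W f \<longleftrightarrow>
     continuous_map (subtopology (powertop_real I) W) euclideanreal f \<and>
     (\<forall>i\<in>I. (\<forall>x\<in>W. (\<lambda>t. f (x(i := t))) differentiable (at (x i))) \<and>
            Ck_on_open k I W (pdv W i f))"

definition smooth_on_open :: "'i set \<Rightarrow> ('i \<Rightarrow> real) set \<Rightarrow> (('i \<Rightarrow> real) \<Rightarrow> real) \<Rightarrow> bool" where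
  "smooth_on_open I W f \<longleftrightarrow> (\<forall>k. Ck_on_open k I W f)"

text \<open>A function on an arbitrary subset is smooth if it extends locally to a smooth function.\<close>
definition smooth_on_subset ::
  "'i set \<Rightarrow> ('i \<Rightarrow> real) set \<Rightarrow> (('i \<Rightarrow> real) \<Rightarrow> real) \<Rightarrow> bool" where
  "smooth_on_subset I A f \<longleftrightarrow>
     (\<forall>x\<in>A. \<exists>W g. openin (powertop_real I) W \<and> x \<in> W \<and> smooth_on_open I W g \<and>
                 (\<forall>y\<in>A \<inter> W. f y = g y))"

definition smooth_vec_on ::
  "'i set \<Rightarrow> 'j set \<Rightarrow> ('i \<Rightarrow> real) set \<Rightarrow> (('i \<Rightarrow> real) \<Rightarrow> ('j \<Rightarrow> real)) \<Rightarrow> bool" where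
  "smooth_vec_on I J A f \<longleftrightarrow>
     f \<in> A \<rightarrow> (J \<rightarrow>\<^sub>E UNIV) \<and> (\<forall>j\<in>J. smooth_on_subset I A (\<lambda>x. f x j))"

definition jacobian_apply ::
  "'i set \<Rightarrow> 'j set \<Rightarrow> ('i \<Rightarrow> real) set \<Rightarrow> (('i \<Rightarrow> real) \<Rightarrow> ('j \<Rightarrow> real)) \<Rightarrow>
   ('i \<Rightarrow> real) \<Rightarrow> ('i \<Rightarrow> real) \<Rightarrow> ('j \<Rightarrow> real)" where
  "jacobian_apply I J A f x v = (\<lambda>j\<in>J. \<Sum>i\<in>I. pdv A i (\<lambda>y. f y j) x * v i)"

text \<open>
  The local models of manifolds with corners: for a \<open>k\<close>-element \<open>K \<subseteq> I\<close> and \<open>card I = n\<close> this is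
  \<open>[0,\<infinity>)\<^sup>k \<times> \<real>\<^sup>n\<^sup>-\<^sup>k\<close> with its factors permuted.
\<close>
definition sector :: "'i set \<Rightarrow> 'i set \<Rightarrow> ('i \<Rightarrow> real) set" where
  "sector I K = {x \<in> I \<rightarrow>\<^sub>E UNIV. \<forall>i\<in>K. 0 \<le> x i}"


section \<open>Manifolds with corners and smooth maps\<close>

record ('p, 'i) chart =
  cdom :: "'p set"
  cind :: "'i set"
  cmap :: "'p \<Rightarrow> 'i \<Rightarrow> real"

record ('p, 'i) mfd =
  mtop :: "'p topology"
  atlas :: "('p, 'i) chart set"

abbreviation points :: "('p, 'i) mfd \<Rightarrow> 'p set" where
  "points M \<equiv> topspace (mtop M)"

definition is_chart :: "'p topology \<Rightarrow> ('p, 'i) chart \<Rightarrow> bool" where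
  "is_chart T c \<longleftrightarrow>
     finite (cind c) \<and> openin T (cdom c) \<and>
     (\<exists>K\<subseteq>cind c. openin (subtopology (powertop_real (cind c)) (sector (cind c) K))
                        (cmap c ` cdom c)) \<and>
     homeomorphic_map (subtopology T (cdom c))
       (subtopology (powertop_real (cind c)) (cmap c ` cdom c)) (cmap c)"

text \<open>The coordinate expression \<open>d \<circ> f \<circ> c\<^sup>-\<^sup>1\<close> of \<open>f\<close> and its domain.\<close>
definition local_rep ::
  "('p, 'i) chart \<Rightarrow> ('q, 'j) chart \<Rightarrow> ('p \<Rightarrow> 'q) \<Rightarrow> ('i \<Rightarrow> real) \<Rightarrow> ('j \<Rightarrow> real)" where
  "local_rep c d f = (\<lambda>x. cmap d (f (inv_into (cdom c) (cmap c) x)))"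

definition local_dom ::
  "('p, 'i) chart \<Rightarrow> ('q, 'j) chart \<Rightarrow> ('p \<Rightarrow> 'q) \<Rightarrow> ('i \<Rightarrow> real) set" where
  "local_dom c d f = cmap c ` {p \<in> cdom c. f p \<in> cdom d}"

definition local_smooth :: "('p, 'i) chart \<Rightarrow> ('q, 'j) chart \<Rightarrow> ('p \<Rightarrow> 'q) \<Rightarrow> bool" where
  "local_smooth c d f \<longleftrightarrow>
     smooth_vec_on (cind c) (cind d) (local_dom c d f) (local_rep c d f)"

definition local_deriv ::
  "('p, 'i) chart \<Rightarrow> ('q, 'j) chart \<Rightarrow> ('p \<Rightarrow> 'q) \<Rightarrow> 'p \<Rightarrow> ('i \<Rightarrow> real) \<Rightarrow> ('j \<Rightarrow> real)" where
  "local_deriv c d f p v =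
     jacobian_apply (cind c) (cind d) (local_dom c d f) (local_rep c d f) (cmap c p) v"

definition paracompact_space :: "'p topology \<Rightarrow> bool" where
  "paracompact_space T \<longleftrightarrow>
     (\<forall>\<U>. (\<forall>U\<in>\<U>. openin T U) \<and> \<Union>\<U> = topspace T \<longrightarrow>
        (\<exists>\<V>. (\<forall>V\<in>\<V>. openin T V \<and> (\<exists>U\<in>\<U>. V \<subseteq> U)) \<and> \<Union>\<V> = topspace T \<and>
             locally_finite_in T \<V>))"

text \<open>
  Atlases are not required to be maximal.  Paracompactness replaces second countability so that
  arbitrary disjoint unions of manifolds are again manifolds; components may have different
  dimensions.
\<close>
definition manifold :: "('p, 'i) mfd \<Rightarrow> bool" where
  "manifold M \<longleftrightarrow>
     Hausdorff_space (mtop M) \<and> paracompact_space (mtop M) \<and>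
     (\<forall>c\<in>atlas M. is_chart (mtop M) c) \<and>
     (\<Union>c\<in>atlas M. cdom c) = points M \<and>
     (\<forall>c\<in>atlas M. \<forall>d\<in>atlas M. local_smooth c d (\<lambda>p. p))"

text \<open>
  Maps are extensional functions on the set of points, so that equality of functions is equality of
  maps; composition is \<^const>\<open>compose\<close>.
\<close>
definition smooth_maps :: "('p, 'i) mfd \<Rightarrow> ('q, 'j) mfd \<Rightarrow> ('p \<Rightarrow> 'q) set" where
  "smooth_maps M N =
     {f \<in> points M \<rightarrow>\<^sub>E points N. continuous_map (mtop M) (mtop N) f \<and>
        (\<forall>c\<in>atlas M. \<forall>d\<in>atlas N. local_smooth c d f)}"

definition inverse_map :: "('p, 'i) mfd \<Rightarrow> ('q, 'j) mfd \<Rightarrow> ('p \<Rightarrow> 'q) \<Rightarrow> ('q \<Rightarrow> 'p)" where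
  "inverse_map M N f = (\<lambda>y\<in>points N. inv_into (points M) f y)"


section \<open>Tangent functor, products and disjoint unions\<close>

text \<open>
  A tangent vector at \<open>p\<close> is a family of coordinate vectors, one for each chart around \<open>p\<close>, which
  transforms by the Jacobians of the coordinate changes.
\<close>
definition tangent_space ::
  "('p, 'i) mfd \<Rightarrow> 'p \<Rightarrow> (('p, 'i) chart \<Rightarrow> 'i \<Rightarrow> real) set" where
  "tangent_space M p =
     {v \<in> (\<Pi>\<^sub>E c\<in>{c \<in> atlas M. p \<in> cdom c}. cind c \<rightarrow>\<^sub>E UNIV).
        \<forall>c\<in>atlas M. \<forall>d\<in>atlas M. p \<in> cdom c \<and> p \<in> cdom d \<longrightarrow>
          v d = local_deriv c d (\<lambda>q. q) p (v c)}"

type_synonym ('p, 'i) tvec = "'p \<times> (('p, 'i) chart \<Rightarrow> 'i \<Rightarrow> real)"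

definition tangent_chart ::
  "('p, 'i) mfd \<Rightarrow> ('p, 'i) chart \<Rightarrow> (('p, 'i) tvec, 'i + 'i) chart" where
  "tangent_chart M c =
     \<lparr>cdom = Sigma (points M \<inter> cdom c) (tangent_space M),
      cind = cind c <+> cind c,
      cmap = (\<lambda>(p, v). \<lambda>k\<in>cind c <+> cind c. case_sum (cmap c p) (v c) k)\<rparr>"

definition tangent_bundle :: "('p, 'i) mfd \<Rightarrow> (('p, 'i) tvec, 'i + 'i) mfd" where
  "tangent_bundle M =
     \<lparr>mtop = topology_generated_by
        {{w \<in> cdom (tangent_chart M c). cmap (tangent_chart M c) w \<in> W} | c W.
           c \<in> atlas M \<and> openin (powertop_real (cind c <+> cind c)) W},
      atlas = tangent_chart M ` atlas M\<rparr>"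

definition tangent_proj :: "('p, 'i) mfd \<Rightarrow> ('p, 'i) tvec \<Rightarrow> 'p" where
  "tangent_proj M = (\<lambda>w\<in>points (tangent_bundle M). fst w)"

text \<open>The result does not depend on the chart \<open>c\<close> in which the derivative is computed.\<close>
definition tangent_map ::
  "('p, 'i) mfd \<Rightarrow> ('q, 'j) mfd \<Rightarrow> ('p \<Rightarrow> 'q) \<Rightarrow> ('p, 'i) tvec \<Rightarrow> ('q, 'j) tvec" where
  "tangent_map M N f =
     (\<lambda>w\<in>points (tangent_bundle M).
        let p = fst w; v = snd w; c = (SOME c. c \<in> atlas M \<and> p \<in> cdom c)
        in (f p, \<lambda>d\<in>{d \<in> atlas N. f p \<in> cdom d}. local_deriv c d f p (v c)))"

definition surjective_submersion :: "('p, 'i) mfd \<Rightarrow> ('q, 'j) mfd \<Rightarrow> ('p \<Rightarrow> 'q) \<Rightarrow> bool" where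
  "surjective_submersion M N f \<longleftrightarrow>
     f \<in> smooth_maps M N \<and> f ` points M = points N \<and>
     (\<forall>q\<in>points M. tangent_map M N f ` {w \<in> points (tangent_bundle M). tangent_proj M w = q} =
                    {w \<in> points (tangent_bundle N). tangent_proj N w = f q})"

definition prod_chart :: "'x set \<Rightarrow> ('x \<Rightarrow> ('p, 'i) chart) \<Rightarrow> ('x \<Rightarrow> 'p, 'x \<times> 'i) chart" where
  "prod_chart X c =
     \<lparr>cdom = (\<Pi>\<^sub>E x\<in>X. cdom (c x)),
      cind = Sigma X (\<lambda>x. cind (c x)),
      cmap = (\<lambda>m. \<lambda>(x, i)\<in>Sigma X (\<lambda>x. cind (c x)). cmap (c x) (m x) i)\<rparr>"

definition prod_mfd :: "'x set \<Rightarrow> ('x \<Rightarrow> ('p, 'i) mfd) \<Rightarrow> ('x \<Rightarrow> 'p, 'x \<times> 'i) mfd" where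
  "prod_mfd X M =
     \<lparr>mtop = product_topology (\<lambda>x. mtop (M x)) X,
      atlas = prod_chart X ` (\<Pi>\<^sub>E x\<in>X. atlas (M x))\<rparr>"

definition sum_chart :: "'s \<Rightarrow> ('p, 'i) chart \<Rightarrow> ('s \<times> 'p, 'i) chart" where
  "sum_chart s c =
     \<lparr>cdom = {s} \<times> cdom c, cind = cind c, cmap = (\<lambda>u. cmap c (snd u))\<rparr>"

definition sum_mfd :: "'s set \<Rightarrow> ('s \<Rightarrow> ('p, 'i) mfd) \<Rightarrow> ('s \<times> 'p, 'i) mfd" where
  "sum_mfd S M =
     \<lparr>mtop = sum_topology (\<lambda>s. mtop (M s)) S,
      atlas = (\<Union>s\<in>S. sum_chart s ` atlas (M s))\<rparr>"


section \<open>Small categories and hybrid phase spaces\<close>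

record ('o, 'm) cat =
  obj :: "'o set"
  arr :: "'m set"
  src :: "'m \<Rightarrow> 'o"
  tgt :: "'m \<Rightarrow> 'o"
  idt :: "'o \<Rightarrow> 'm"
  cmp :: "'m \<Rightarrow> 'm \<Rightarrow> 'm"   \<comment> \<open>\<open>cmp C g f\<close> is \<open>g \<circ> f\<close>, meaningful if \<open>tgt C f = src C g\<close>\<close>

definition category :: "('o, 'm) cat \<Rightarrow> bool" where
  "category C \<longleftrightarrow>
     (\<forall>f\<in>arr C. src C f \<in> obj C \<and> tgt C f \<in> obj C) \<and>
     (\<forall>x\<in>obj C. idt C x \<in> arr C \<and> src C (idt C x) = x \<and> tgt C (idt C x) = x) \<and>
     (\<forall>f\<in>arr C. \<forall>g\<in>arr C. tgt C f = src C g \<longrightarrow>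
        cmp C g f \<in> arr C \<and> src C (cmp C g f) = src C f \<and> tgt C (cmp C g f) = tgt C g) \<and>
     (\<forall>f\<in>arr C. cmp C f (idt C (src C f)) = f \<and> cmp C (idt C (tgt C f)) f = f) \<and>
     (\<forall>f\<in>arr C. \<forall>g\<in>arr C. \<forall>h\<in>arr C. tgt C f = src C g \<and> tgt C g = src C h \<longrightarrow>
        cmp C h (cmp C g f) = cmp C (cmp C h g) f)"

definition is_functor ::
  "('o, 'm) cat \<Rightarrow> ('r, 'n) cat \<Rightarrow> ('o \<Rightarrow> 'r) \<Rightarrow> ('m \<Rightarrow> 'n) \<Rightarrow> bool" where
  "is_functor C D F0 F1 \<longleftrightarrow>
     F0 \<in> obj C \<rightarrow>\<^sub>E obj D \<and> F1 \<in> arr C \<rightarrow>\<^sub>E arr D \<and>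
     (\<forall>f\<in>arr C. src D (F1 f) = F0 (src C f) \<and> tgt D (F1 f) = F0 (tgt C f)) \<and>
     (\<forall>x\<in>obj C. F1 (idt C x) = idt D (F0 x)) \<and>
     (\<forall>f\<in>arr C. \<forall>g\<in>arr C. tgt C f = src C g \<longrightarrow> F1 (cmp C g f) = cmp D (F1 g) (F1 f))"

definition prod_cat :: "'x set \<Rightarrow> ('x \<Rightarrow> ('o, 'm) cat) \<Rightarrow> ('x \<Rightarrow> 'o, 'x \<Rightarrow> 'm) cat" where
  "prod_cat X C =
     \<lparr>obj = (\<Pi>\<^sub>E x\<in>X. obj (C x)), arr = (\<Pi>\<^sub>E x\<in>X. arr (C x)),
      src = (\<lambda>f. \<lambda>x\<in>X. src (C x) (f x)), tgt = (\<lambda>f. \<lambda>x\<in>X. tgt (C x) (f x)),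
      idt = (\<lambda>s. \<lambda>x\<in>X. idt (C x) (s x)), cmp = (\<lambda>g f. \<lambda>x\<in>X. cmp (C x) (g x) (f x))\<rparr>"

record ('o, 'm, 'p, 'i) hyph =
  shape :: "('o, 'm) cat"
  phase :: "'o \<Rightarrow> ('p, 'i) mfd"
  edge :: "'m \<Rightarrow> ('p \<times> 'p) set"

text \<open>Note that \<open>R O S\<close> is the relation composite \<open>S \<circ> R\<close>.\<close>
definition hybrid_phase_space :: "('o, 'm, 'p, 'i) hyph \<Rightarrow> bool" where
  "hybrid_phase_space a \<longleftrightarrow>
     category (shape a) \<and>
     (\<forall>s\<in>obj (shape a). manifold (phase a s)) \<and>
     (\<forall>\<gamma>\<in>arr (shape a). edge a \<gamma> \<subseteq>
        points (phase a (src (shape a) \<gamma>)) \<times> points (phase a (tgt (shape a) \<gamma>))) \<and>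
     (\<forall>s\<in>obj (shape a). edge a (idt (shape a) s) = Id_on (points (phase a s))) \<and>
     (\<forall>\<gamma>\<in>arr (shape a). \<forall>\<gamma>'\<in>arr (shape a). tgt (shape a) \<gamma> = src (shape a) \<gamma>' \<longrightarrow>
        edge a (cmp (shape a) \<gamma>' \<gamma>) = edge a \<gamma> O edge a \<gamma>')"

record ('o, 'm, 'p, 'r, 'n, 'q) hymor =
  ofun :: "'o \<Rightarrow> 'r"
  afun :: "'m \<Rightarrow> 'n"
  comp_at :: "'o \<Rightarrow> 'p \<Rightarrow> 'q"

definition hyph_hom ::
  "('o, 'm, 'p, 'i) hyph \<Rightarrow> ('r, 'n, 'q, 'j) hyph \<Rightarrow> ('o, 'm, 'p, 'r, 'n, 'q) hymor set" where
  "hyph_hom a b =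
     {f. is_functor (shape a) (shape b) (ofun f) (afun f) \<and>
         comp_at f \<in> (\<Pi>\<^sub>E s\<in>obj (shape a). smooth_maps (phase a s) (phase b (ofun f s))) \<and>
         (\<forall>\<gamma>\<in>arr (shape a).
            map_prod (comp_at f (src (shape a) \<gamma>)) (comp_at f (tgt (shape a) \<gamma>)) ` edge a \<gamma>
              \<subseteq> edge b (afun f \<gamma>))}"

definition hyph_id :: "('o, 'm, 'p, 'i) hyph \<Rightarrow> ('o, 'm, 'p, 'o, 'm, 'p) hymor" where
  "hyph_id a =
     \<lparr>ofun = (\<lambda>s\<in>obj (shape a). s), afun = (\<lambda>\<gamma>\<in>arr (shape a). \<gamma>),
      comp_at = (\<lambda>s\<in>obj (shape a). \<lambda>p\<in>points (phase a s). p)\<rparr>"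

text \<open>The composite of \<open>f : a \<rightarrow> b\<close> and \<open>g : b \<rightarrow> c\<close>; the first argument is the domain \<open>a\<close>.\<close>
definition hyph_comp ::
  "('o, 'm, 'p, 'i) hyph \<Rightarrow> ('r, 'n, 'q, 'u, 'l, 'w) hymor \<Rightarrow> ('o, 'm, 'p, 'r, 'n, 'q) hymor \<Rightarrow>
   ('o, 'm, 'p, 'u, 'l, 'w) hymor" where
  "hyph_comp a g f =
     \<lparr>ofun = compose (obj (shape a)) (ofun g) (ofun f),
      afun = compose (arr (shape a)) (afun g) (afun f),
      comp_at = (\<lambda>s\<in>obj (shape a).
         compose (points (phase a s)) (comp_at g (ofun f s)) (comp_at f s))\<rparr>"

definition hyph_iso ::
  "('o, 'm, 'p, 'i) hyph \<Rightarrow> ('r, 'n, 'q, 'j) hyph \<Rightarrow> ('o, 'm, 'p, 'r, 'n, 'q) hymor \<Rightarrow> bool" where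
  "hyph_iso a b f \<longleftrightarrow>
     f \<in> hyph_hom a b \<and>
     (\<exists>g\<in>hyph_hom b a. hyph_comp a g f = hyph_id a \<and> hyph_comp b f g = hyph_id b)"

definition UU :: "('o, 'm, 'p, 'i) hyph \<Rightarrow> ('o \<times> 'p, 'i) mfd" where
  "UU a = sum_mfd (obj (shape a)) (phase a)"

definition UUmap ::
  "('o, 'm, 'p, 'i) hyph \<Rightarrow> ('o, 'm, 'p, 'r, 'n, 'q) hymor \<Rightarrow> 'o \<times> 'p \<Rightarrow> 'r \<times> 'q" where
  "UUmap a f = (\<lambda>u\<in>points (UU a). (ofun f (fst u), comp_at f (fst u) (snd u)))"

definition hyph_prod ::
  "'x set \<Rightarrow> ('x \<Rightarrow> ('o, 'm, 'p, 'i) hyph) \<Rightarrow>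
   ('x \<Rightarrow> 'o, 'x \<Rightarrow> 'm, 'x \<Rightarrow> 'p, 'x \<times> 'i) hyph" where
  "hyph_prod X a =
     \<lparr>shape = prod_cat X (\<lambda>x. shape (a x)),
      phase = (\<lambda>s. prod_mfd X (\<lambda>x. phase (a x) (s x))),
      edge = (\<lambda>\<gamma>. {(m, m').
         m \<in> (\<Pi>\<^sub>E x\<in>X. points (phase (a x) (src (shape (a x)) (\<gamma> x)))) \<and>
         m' \<in> (\<Pi>\<^sub>E x\<in>X. points (phase (a x) (tgt (shape (a x)) (\<gamma> x)))) \<and>
         (\<forall>x\<in>X. (m x, m' x) \<in> edge (a x) (\<gamma> x))})\<rparr>"

definition hyph_pr ::
  "'x set \<Rightarrow> ('x \<Rightarrow> ('o, 'm, 'p, 'i) hyph) \<Rightarrow> 'x \<Rightarrow>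
   ('x \<Rightarrow> 'o, 'x \<Rightarrow> 'm, 'x \<Rightarrow> 'p, 'o, 'm, 'p) hymor" where
  "hyph_pr X a x =
     \<lparr>ofun = (\<lambda>s\<in>obj (shape (hyph_prod X a)). s x),
      afun = (\<lambda>\<gamma>\<in>arr (shape (hyph_prod X a)). \<gamma> x),
      comp_at = (\<lambda>s\<in>obj (shape (hyph_prod X a)). \<lambda>m\<in>points (phase (hyph_prod X a) s). m x)\<rparr>"

text \<open>The product \<open>\<Prod>\<^sub>x f\<^sub>x : \<Prod>\<^sub>x a\<^sub>x \<rightarrow> \<Prod>\<^sub>x b\<^sub>x\<close> of morphisms; the second argument is \<open>a\<close>.\<close>
definition hyph_prod_map ::
  "'x set \<Rightarrow> ('x \<Rightarrow> ('o, 'm, 'p, 'i) hyph) \<Rightarrow> ('x \<Rightarrow> ('o, 'm, 'p, 'r, 'n, 'q) hymor) \<Rightarrow>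
   ('x \<Rightarrow> 'o, 'x \<Rightarrow> 'm, 'x \<Rightarrow> 'p, 'x \<Rightarrow> 'r, 'x \<Rightarrow> 'n, 'x \<Rightarrow> 'q) hymor" where
  "hyph_prod_map X a f =
     \<lparr>ofun = (\<lambda>s\<in>obj (shape (hyph_prod X a)). \<lambda>x\<in>X. ofun (f x) (s x)),
      afun = (\<lambda>\<gamma>\<in>arr (shape (hyph_prod X a)). \<lambda>x\<in>X. afun (f x) (\<gamma> x)),
      comp_at = (\<lambda>s\<in>obj (shape (hyph_prod X a)). \<lambda>m\<in>points (phase (hyph_prod X a) s).
         \<lambda>x\<in>X. comp_at (f x) (s x) (m x))\<rparr>"


section \<open>Hybrid surjective submersions and control\<close>

record ('o, 'm, 'p, 'i, 'r, 'n, 'q, 'j) ssub =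
  tot :: "('o, 'm, 'p, 'i) hyph"
  st :: "('r, 'n, 'q, 'j) hyph"
  prj :: "('o, 'm, 'p, 'r, 'n, 'q) hymor"

record ('o, 'm, 'p, 'r, 'n, 'q, 'o1, 'm1, 'p1, 'r1, 'n1, 'q1) ssmor =
  mtot :: "('o, 'm, 'p, 'o1, 'm1, 'p1) hymor"
  mst :: "('r, 'n, 'q, 'r1, 'n1, 'q1) hymor"

definition hybrid_ssub :: "('o, 'm, 'p, 'i, 'r, 'n, 'q, 'j) ssub \<Rightarrow> bool" where
  "hybrid_ssub a \<longleftrightarrow>
     hybrid_phase_space (tot a) \<and> hybrid_phase_space (st a) \<and>
     prj a \<in> hyph_hom (tot a) (st a) \<and>
     surjective_submersion (UU (tot a)) (UU (st a)) (UUmap (tot a) (prj a))"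

definition ss_hom ::
  "('o, 'm, 'p, 'i, 'r, 'n, 'q, 'j) ssub \<Rightarrow> ('o1, 'm1, 'p1, 'i1, 'r1, 'n1, 'q1, 'j1) ssub \<Rightarrow>
   ('o, 'm, 'p, 'r, 'n, 'q, 'o1, 'm1, 'p1, 'r1, 'n1, 'q1) ssmor set" where
  "ss_hom a b =
     {f. mtot f \<in> hyph_hom (tot a) (tot b) \<and> mst f \<in> hyph_hom (st a) (st b) \<and>
         hyph_comp (tot a) (prj b) (mtot f) = hyph_comp (tot a) (mst f) (prj a)}"

definition ss_comp ::
  "('o, 'm, 'p, 'i, 'r, 'n, 'q, 'j) ssub \<Rightarrow>
   ('o1, 'm1, 'p1, 'r1, 'n1, 'q1, 'o2, 'm2, 'p2, 'r2, 'n2, 'q2) ssmor \<Rightarrow>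
   ('o, 'm, 'p, 'r, 'n, 'q, 'o1, 'm1, 'p1, 'r1, 'n1, 'q1) ssmor \<Rightarrow>
   ('o, 'm, 'p, 'r, 'n, 'q, 'o2, 'm2, 'p2, 'r2, 'n2, 'q2) ssmor" where
  "ss_comp a g f =
     \<lparr>mtot = hyph_comp (tot a) (mtot g) (mtot f), mst = hyph_comp (st a) (mst g) (mst f)\<rparr>"

definition interconnection ::
  "('o, 'm, 'p, 'i, 'r, 'n, 'q, 'j) ssub \<Rightarrow> ('o1, 'm1, 'p1, 'i1, 'r1, 'n1, 'q1, 'j1) ssub \<Rightarrow>
   ('o, 'm, 'p, 'r, 'n, 'q, 'o1, 'm1, 'p1, 'r1, 'n1, 'q1) ssmor \<Rightarrow> bool" where
  "interconnection a b i \<longleftrightarrow> i \<in> ss_hom a b \<and> hyph_iso (st a) (st b) (mst i)"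

definition ss_prod ::
  "'x set \<Rightarrow> ('x \<Rightarrow> ('o, 'm, 'p, 'i, 'r, 'n, 'q, 'j) ssub) \<Rightarrow>
   ('x \<Rightarrow> 'o, 'x \<Rightarrow> 'm, 'x \<Rightarrow> 'p, 'x \<times> 'i, 'x \<Rightarrow> 'r, 'x \<Rightarrow> 'n, 'x \<Rightarrow> 'q, 'x \<times> 'j) ssub" where
  "ss_prod X a =
     \<lparr>tot = hyph_prod X (\<lambda>x. tot (a x)), st = hyph_prod X (\<lambda>x. st (a x)),
      prj = hyph_prod_map X (\<lambda>x. tot (a x)) (\<lambda>x. prj (a x))\<rparr>"

definition ss_pr ::
  "'x set \<Rightarrow> ('x \<Rightarrow> ('o, 'm, 'p, 'i, 'r, 'n, 'q, 'j) ssub) \<Rightarrow> 'x \<Rightarrow>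
   ('x \<Rightarrow> 'o, 'x \<Rightarrow> 'm, 'x \<Rightarrow> 'p, 'x \<Rightarrow> 'r, 'x \<Rightarrow> 'n, 'x \<Rightarrow> 'q, 'o, 'm, 'p, 'r, 'n, 'q) ssmor"
  where
  "ss_pr X a x =
     \<lparr>mtot = hyph_pr X (\<lambda>x. tot (a x)) x, mst = hyph_pr X (\<lambda>x. st (a x)) x\<rparr>"

definition Crl ::
  "('o, 'm, 'p, 'i, 'r, 'n, 'q, 'j) ssub \<Rightarrow> ('o \<times> 'p \<Rightarrow> ('r \<times> 'q, 'j) tvec) set" where
  "Crl a =
     {V \<in> smooth_maps (UU (tot a)) (tangent_bundle (UU (st a))).
        UUmap (tot a) (prj a) = compose (points (UU (tot a))) (tangent_proj (UU (st a))) V}"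

definition Crl_rel ::
  "('o, 'm, 'p, 'i, 'r, 'n, 'q, 'j) ssub \<Rightarrow> ('o1, 'm1, 'p1, 'i1, 'r1, 'n1, 'q1, 'j1) ssub \<Rightarrow>
   ('o, 'm, 'p, 'r, 'n, 'q, 'o1, 'm1, 'p1, 'r1, 'n1, 'q1) ssmor \<Rightarrow>
   (('o \<times> 'p \<Rightarrow> ('r \<times> 'q, 'j) tvec) \<times> ('o1 \<times> 'p1 \<Rightarrow> ('r1 \<times> 'q1, 'j1) tvec)) set" where
  "Crl_rel a b f =
     {(V, W). V \<in> Crl a \<and> W \<in> Crl b \<and>
        compose (points (UU (tot a)))
          (tangent_map (UU (st a)) (UU (st b)) (UUmap (st a) (mst f))) V =
        compose (points (UU (tot a))) W (UUmap (tot a) (mtot f))}"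

definition Crl_int ::
  "('o, 'm, 'p, 'i, 'r, 'n, 'q, 'j) ssub \<Rightarrow> ('o1, 'm1, 'p1, 'i1, 'r1, 'n1, 'q1, 'j1) ssub \<Rightarrow>
   ('o, 'm, 'p, 'r, 'n, 'q, 'o1, 'm1, 'p1, 'r1, 'n1, 'q1) ssmor \<Rightarrow>
   ('o1 \<times> 'p1 \<Rightarrow> ('r1 \<times> 'q1, 'j1) tvec) \<Rightarrow> ('o \<times> 'p \<Rightarrow> ('r \<times> 'q, 'j) tvec)" where
  "Crl_int a b i =
     (\<lambda>W\<in>Crl b.
        compose (points (UU (tot a)))
          (tangent_map (UU (st b)) (UU (st a))
             (inverse_map (UU (st a)) (UU (st b)) (UUmap (st a) (mst i))))
          (compose (points (UU (tot a))) W (UUmap (tot a) (mtot i))))"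

text \<open>The canonical map \<open>\<U>(\<Prod>\<^sub>x a\<^sub>x) \<rightarrow> \<Prod>\<^sub>x \<U>(a\<^sub>x)\<close> and the canonical map \<open>T(\<Prod>\<^sub>x M\<^sub>x) \<rightarrow> \<Prod>\<^sub>x T M\<^sub>x\<close>.\<close>
definition can_U ::
  "'x set \<Rightarrow> ('x \<Rightarrow> ('o, 'm, 'p, 'i) hyph) \<Rightarrow>
   ('x \<Rightarrow> 'o) \<times> ('x \<Rightarrow> 'p) \<Rightarrow> ('x \<Rightarrow> 'o \<times> 'p)" where
  "can_U X a =
     (\<lambda>u\<in>points (UU (hyph_prod X a)). \<lambda>x\<in>X. UUmap (hyph_prod X a) (hyph_pr X a x) u)"

definition can_T ::
  "'x set \<Rightarrow> ('x \<Rightarrow> ('p, 'i) mfd) \<Rightarrow> ('x \<Rightarrow> 'p, 'x \<times> 'i) tvec \<Rightarrow> ('x \<Rightarrow> ('p, 'i) tvec)" where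
  "can_T X M =
     (\<lambda>w\<in>points (tangent_bundle (prod_mfd X M)). \<lambda>x\<in>X.
        tangent_map (prod_mfd X M) (M x) (\<lambda>m\<in>points (prod_mfd X M). m x) w)"

definition Crl_prod ::
  "'x set \<Rightarrow> ('x \<Rightarrow> ('o, 'm, 'p, 'i, 'r, 'n, 'q, 'j) ssub) \<Rightarrow>
   ('x \<Rightarrow> 'o \<times> 'p \<Rightarrow> ('r \<times> 'q, 'j) tvec) \<Rightarrow>
   ('x \<Rightarrow> 'o) \<times> ('x \<Rightarrow> 'p) \<Rightarrow> (('x \<Rightarrow> 'r) \<times> ('x \<Rightarrow> 'q), 'x \<times> 'j) tvec" where
  "Crl_prod X a =
     (let Etot = UU (hyph_prod X (\<lambda>x. tot (a x)));
          Est = UU (hyph_prod X (\<lambda>x. st (a x)));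
          Mst = (\<lambda>x. UU (st (a x)));
          Tinv = tangent_map (prod_mfd X Mst) Est
                   (inverse_map Est (prod_mfd X Mst) (can_U X (\<lambda>x. st (a x))));
          asm_T = inverse_map (tangent_bundle (prod_mfd X Mst))
                    (prod_mfd X (\<lambda>x. tangent_bundle (Mst x))) (can_T X Mst)
      in (\<lambda>v\<in>(\<Pi>\<^sub>E x\<in>X. Crl (a x)). \<lambda>u\<in>points Etot.
            Tinv (asm_T (\<lambda>x\<in>X. v x (can_U X (\<lambda>x. tot (a x)) u x)))))"


section \<open>Networks of hybrid open systems\<close>

definition network ::
  "'x set \<Rightarrow> ('x \<Rightarrow> ('o, 'm, 'p, 'i, 'r, 'n, 'q, 'j) ssub) \<Rightarrow>
   ('o1, 'm1, 'p1, 'i1, 'r1, 'n1, 'q1, 'j1) ssub \<Rightarrow>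
   ('o1, 'm1, 'p1, 'r1, 'n1, 'q1,
    'x \<Rightarrow> 'o, 'x \<Rightarrow> 'm, 'x \<Rightarrow> 'p, 'x \<Rightarrow> 'r, 'x \<Rightarrow> 'n, 'x \<Rightarrow> 'q) ssmor \<Rightarrow> bool" where
  "network X H a i \<longleftrightarrow>
     finite X \<and> (\<forall>x\<in>X. hybrid_ssub (H x)) \<and> hybrid_ssub a \<and>
     interconnection a (ss_prod X H) i"

definition Pi_mor ::
  "'x set \<Rightarrow> ('x \<Rightarrow> ('o, 'm, 'p, 'i, 'r, 'n, 'q, 'j) ssub) \<Rightarrow>
   'y set \<Rightarrow> ('y \<Rightarrow> ('o1, 'm1, 'p1, 'i1, 'r1, 'n1, 'q1, 'j1) ssub) \<Rightarrow> ('x \<Rightarrow> 'y) \<Rightarrow>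
   ('x \<Rightarrow> ('o1, 'm1, 'p1, 'r1, 'n1, 'q1, 'o, 'm, 'p, 'r, 'n, 'q) ssmor) \<Rightarrow>
   ('y \<Rightarrow> 'o1, 'y \<Rightarrow> 'm1, 'y \<Rightarrow> 'p1, 'y \<Rightarrow> 'r1, 'y \<Rightarrow> 'n1, 'y \<Rightarrow> 'q1,
    'x \<Rightarrow> 'o, 'x \<Rightarrow> 'm, 'x \<Rightarrow> 'p, 'x \<Rightarrow> 'r, 'x \<Rightarrow> 'n, 'x \<Rightarrow> 'q) ssmor" where
  "Pi_mor X HX Y HY \<phi> \<Phi> =
     (THE P. P \<in> ss_hom (ss_prod Y HY) (ss_prod X HX) \<and>
        (\<forall>x\<in>X. ss_comp (ss_prod Y HY) (ss_pr X HX x) P =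
               ss_comp (ss_prod Y HY) (\<Phi> x) (ss_pr Y HY (\<phi> x))))"

definition network_mor ::
  "'x set \<Rightarrow> ('x \<Rightarrow> ('o, 'm, 'p, 'i, 'r, 'n, 'q, 'j) ssub) \<Rightarrow>
   ('o2, 'm2, 'p2, 'i2, 'r2, 'n2, 'q2, 'j2) ssub \<Rightarrow>
   ('o2, 'm2, 'p2, 'r2, 'n2, 'q2,
    'x \<Rightarrow> 'o, 'x \<Rightarrow> 'm, 'x \<Rightarrow> 'p, 'x \<Rightarrow> 'r, 'x \<Rightarrow> 'n, 'x \<Rightarrow> 'q) ssmor \<Rightarrow>
   'y set \<Rightarrow> ('y \<Rightarrow> ('o1, 'm1, 'p1, 'i1, 'r1, 'n1, 'q1, 'j1) ssub) \<Rightarrow>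
   ('o3, 'm3, 'p3, 'i3, 'r3, 'n3, 'q3, 'j3) ssub \<Rightarrow>
   ('o3, 'm3, 'p3, 'r3, 'n3, 'q3,
    'y \<Rightarrow> 'o1, 'y \<Rightarrow> 'm1, 'y \<Rightarrow> 'p1, 'y \<Rightarrow> 'r1, 'y \<Rightarrow> 'n1, 'y \<Rightarrow> 'q1) ssmor \<Rightarrow>
   ('x \<Rightarrow> 'y) \<Rightarrow>
   ('x \<Rightarrow> ('o1, 'm1, 'p1, 'r1, 'n1, 'q1, 'o, 'm, 'p, 'r, 'n, 'q) ssmor) \<Rightarrow>
   ('o3, 'm3, 'p3, 'r3, 'n3, 'q3, 'o2, 'm2, 'p2, 'r2, 'n2, 'q2) ssmor \<Rightarrow> bool" where
  "network_mor X HX a ia Y HY b ib \<phi> \<Phi> z \<longleftrightarrow>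
     \<phi> \<in> X \<rightarrow> Y \<and> (\<forall>x\<in>X. \<Phi> x \<in> ss_hom (HY (\<phi> x)) (HX x)) \<and> z \<in> ss_hom b a \<and>
     ss_comp b ia z = ss_comp b (Pi_mor X HX Y HY \<phi> \<Phi>) ib"

definition Crl_family_rel ::
  "'x set \<Rightarrow> ('x \<Rightarrow> ('o, 'm, 'p, 'i, 'r, 'n, 'q, 'j) ssub) \<Rightarrow>
   'y set \<Rightarrow> ('y \<Rightarrow> ('o1, 'm1, 'p1, 'i1, 'r1, 'n1, 'q1, 'j1) ssub) \<Rightarrow> ('x \<Rightarrow> 'y) \<Rightarrow>
   ('x \<Rightarrow> ('o1, 'm1, 'p1, 'r1, 'n1, 'q1, 'o, 'm, 'p, 'r, 'n, 'q) ssmor) \<Rightarrow>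
   (('y \<Rightarrow> 'o1 \<times> 'p1 \<Rightarrow> ('r1 \<times> 'q1, 'j1) tvec) \<times> ('x \<Rightarrow> 'o \<times> 'p \<Rightarrow> ('r \<times> 'q, 'j) tvec)) set" where
  "Crl_family_rel X HX Y HY \<phi> \<Phi> =
     {(w, v). w \<in> (\<Pi>\<^sub>E y\<in>Y. Crl (HY y)) \<and> v \<in> (\<Pi>\<^sub>E x\<in>X. Crl (HX x)) \<and>
        (\<forall>x\<in>X. (w (\<phi> x), v x) \<in> Crl_rel (HY (\<phi> x)) (HX x) (\<Phi> x))}"

text \<open>
  The relation \<open>R \<subseteq> A \<times> B\<close> is the top, \<open>R' \<subseteq> A' \<times> B'\<close> the bottom, and the functions
  \<open>g : A \<rightarrow> A'\<close>, \<open>h : B \<rightarrow> B'\<close> are the left and right sides of a square in \<open>Set\<^sup>\<box>\<close>.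
\<close>
definition set_square ::
  "'a set \<Rightarrow> 'b set \<Rightarrow> 'c set \<Rightarrow> 'd set \<Rightarrow> ('a \<times> 'b) set \<Rightarrow> ('c \<times> 'd) set \<Rightarrow>
   ('a \<Rightarrow> 'c) \<Rightarrow> ('b \<Rightarrow> 'd) \<Rightarrow> bool" where
  "set_square A B A' B' R R' g h \<longleftrightarrow>
     R \<subseteq> A \<times> B \<and> R' \<subseteq> A' \<times> B' \<and> g \<in> A \<rightarrow>\<^sub>E A' \<and> h \<in> B \<rightarrow>\<^sub>E B' \<and> map_prod g h ` R \<subseteq> R'"

end

theory Submission
  imports Defs
begin

text \<open>
  Write \<open>\<Pi>\<close> for the morphism of products induced by \<open>\<Phi>\<close>.  The control systems \<open>\<P>\<^sub>X v\<close> are determined by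
  \<open>T(\<U> pr\<^sub>x) \<circ> \<P>\<^sub>X v = v\<^sub>x \<circ> \<U> pr\<^sub>x\<close>, because the maps \<open>T(\<U> pr\<^sub>x)\<close> are jointly injective: tangent
  bundles commute with finite products.  Testing against all \<open>pr\<^sub>x\<close> therefore reduces the \<open>\<Pi>\<close>-relatedness
  of \<open>\<P>\<^sub>Y w\<close> and \<open>\<P>\<^sub>X v\<close> to the \<open>\<Phi>\<^sub>x\<close>-relatedness of \<open>w\<^bsub>\<phi>(x)\<^esub>\<close> and \<open>v\<^sub>x\<close>.  Since \<open>T(\<U> i\<^bsub>a,st\<^esub>)\<close> is
  injective, \<open>z\<close>-relatedness of the two pullbacks can be tested after composing with it, where it follows
  from \<open>i\<^sub>a \<circ> z = \<Pi> \<circ> i\<^sub>b\<close> and functoriality of \<open>T\<close>.  All this rests on the chain rule for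
  the partial derivatives of the definitions, which is proved by changing one coordinate at a time; at
  corners it applies because one-sided partial derivatives coincide with those of any local extension.
\<close>

section \<open>Calculus on coordinate spaces\<close>

text \<open>The vertical arrows contain inverses of the canonical maps \<open>can_U\<close> and
  \<open>can_T\<close>, taken pointwise by \<open>inv_into\<close>. A bijection of point sets says
  nothing about the smoothness of its inverse, yet this smoothness is what lets
  \<open>Crl_prod\<close> land in \<open>Crl\<close>, and it makes \<open>tangent_map\<close>
  functorial on the inverse of \<open>can_U\<close>. In charts adapted to a point both inverses only
  rearrange coordinates; the work on charts, sums and products leads up to this.

  Two choices hide in the definitions. \<open>tangent_map\<close> picks a chart by
  \<open>SOME\<close>, so the chain rule is needed even to know its value. \<open>Pi_mor\<close> is
  a \<open>THE\<close>, so the universal property of products has to be established for functors,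
  smooth maps and edge relations together before it can be used.

  Manifolds, disjoint unions, finite products and tangent bundles are all handled through
  \<open>premfd\<close> and \<open>smap\<close>, which can be verified chart by chart. Atlases are
  not maximal and the domains of coordinate expressions vary with the charts, so smoothness is often
  shown in one pair of charts around a point and spread to all pairs by
  \<open>smapI\<close>.\<close>

lemma ext_upd: "x \<in> I \<rightarrow>\<^sub>E UNIV \<Longrightarrow> i \<in> I \<Longrightarrow> x(i := t) \<in> I \<rightarrow>\<^sub>E UNIV"
  by (auto simp: PiE_iff extensional_def)

lemma openin_powertop_subset: "openin (powertop_real I) W \<Longrightarrow> W \<subseteq> I \<rightarrow>\<^sub>E UNIV"
  using openin_subset by fastforce

lemma openin_powertop_box:
  assumes "finite I" "openin (powertop_real I) W" "y \<in> W"
  obtains e where "e > 0" "\<And>z. z \<in> I \<rightarrow>\<^sub>E UNIV \<Longrightarrow> (\<And>i. i \<in> I \<Longrightarrow> \<bar>z i - y i\<bar> < e) \<Longrightarrow> z \<in> W"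
proof -
  obtain U where U: "\<forall>i\<in>I. open (U i)" "y \<in> Pi\<^sub>E I U" "Pi\<^sub>E I U \<subseteq> W"
    using assms(2,3) unfolding openin_product_topology_alt by force
  have "\<exists>e>0. \<forall>t. \<bar>t - y i\<bar> < e \<longrightarrow> t \<in> U i" if "i \<in> I" for i
  proof -
    have "open (U i)" "y i \<in> U i" using U that by auto
    then show ?thesis by (auto simp: open_dist dist_real_def)
  qed
  then obtain e where e: "\<And>i. i \<in> I \<Longrightarrow> e i > 0 \<and> (\<forall>t. \<bar>t - y i\<bar> < e i \<longrightarrow> t \<in> U i)"
    by metis
  show thesis
  \<comment> \<open>The inserted \<open>1\<close> keeps the minimum defined and positive when
    \<open>I\<close> is empty.\<close>
  proof (rule that[of "Min (insert 1 (e ` I))"])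
    show "0 < Min (insert 1 (e ` I))" using e assms(1) by (auto simp: Min_gr_iff)
    show "z \<in> W" if "z \<in> I \<rightarrow>\<^sub>E UNIV" "\<And>i. i \<in> I \<Longrightarrow> \<bar>z i - y i\<bar> < Min (insert 1 (e ` I))" for z
    proof -
      have "z i \<in> U i" if "i \<in> I" for i
        using that e \<open>i \<in> I \<Longrightarrow> \<bar>z i - y i\<bar> < _\<close> assms(1) by (simp add: Min_gr_iff)
      then have "z \<in> Pi\<^sub>E I U" using that(1) by (auto simp: PiE_iff)
      then show ?thesis using U by auto
    qed
  qed
qed

text \<open>Converts openness in the product topology into a statement about one real variable, the
  form that derivatives along a coordinate line can use: functions agreeing on \<open>W\<close>
  agree near \<open>x i\<close> on that line.\<close>

lemma eventually_upd:
  assumes "finite I" "openin (powertop_real I) W" "x \<in> W" "i \<in> I"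
  shows "eventually (\<lambda>t. x(i := t) \<in> W) (nhds (x i))"
proof -
  obtain e where e: "e > 0"
      "\<And>z. z \<in> I \<rightarrow>\<^sub>E UNIV \<Longrightarrow> (\<And>i. i \<in> I \<Longrightarrow> \<bar>z i - x i\<bar> < e) \<Longrightarrow> z \<in> W"
    using openin_powertop_box[OF assms(1-3)] by blast
  have x: "x \<in> I \<rightarrow>\<^sub>E UNIV" using assms openin_powertop_subset by blast
  show ?thesis unfolding eventually_nhds_metric
    by (rule exI[of _ e]) (use e x assms(4) in \<open>auto simp: dist_real_def intro!: e(2) ext_upd\<close>)
qed

subsection \<open>Partial derivatives\<close>

text \<open>At such points one-sided partial derivatives within \<open>A\<close> are unique.\<close>
definition thick :: "'i set \<Rightarrow> ('i \<Rightarrow> real) set \<Rightarrow> ('i \<Rightarrow> real) \<Rightarrow> bool" where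
  "thick I A x \<longleftrightarrow> (\<forall>i\<in>I. at (x i) within {t. x(i := t) \<in> A} \<noteq> bot)"

lemma thick_open:
  assumes "finite I" "openin (powertop_real I) W" "x \<in> W"
  shows "thick I W x"
  unfolding thick_def
proof
  fix i assume i: "i \<in> I"
  have "\<exists>S. open S \<and> x i \<in> S \<and> (\<forall>t\<in>S. x(i := t) \<in> W)"
    using eventually_upd[OF assms i] unfolding eventually_nhds .
  then obtain S where S: "open S" "x i \<in> S" "\<forall>t\<in>S. x(i := t) \<in> W"
    by (elim exE conjE)
  have "x i \<in> interior {t. x(i := t) \<in> W}"
  proof (rule interiorI[OF S(1,2)])
    show "S \<subseteq> {t. x(i := t) \<in> W}" using S(3) by blast
  qed
  then have "at (x i) within {t. x(i := t) \<in> W} = at (x i)"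
    by (rule at_within_interior)
  then show "at (x i) within {t. x(i := t) \<in> W} \<noteq> bot"
    using trivial_limit_at[of "x i"] by metis
qed

text \<open>\<open>pdv A\<close> sees \<open>f\<close> only at points of \<open>A\<close> on a
  coordinate line near \<open>x\<close>, where \<open>f\<close> coincides with \<open>g\<close>.
  Thickness makes the derivative within that set unique, so it must be the two-sided derivative of
  \<open>g\<close>. Open sets are the case \<open>A = W\<close> and \<open>g = f\<close>.\<close>

lemma pdv_eqI:
  assumes "finite I" "thick I A x" "i \<in> I" "openin (powertop_real I) W" "x \<in> W"
    and "\<And>y. y \<in> A \<inter> W \<Longrightarrow> f y = g y" "x \<in> A"
    and D: "((\<lambda>t. g (x(i := t))) has_real_derivative D) (at (x i))"
  shows "pdv A i f x = D"
  unfolding pdv_def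
proof (rule vector_derivative_within)
  let ?S = "{t. x(i := t) \<in> A}"
  show "at (x i) within ?S \<noteq> bot" using assms by (auto simp: thick_def)
  have "((\<lambda>t. g (x(i := t))) has_real_derivative D) (at (x i) within ?S)"
    using D by (rule has_field_derivative_at_within)
  moreover have "eventually (\<lambda>t. t \<in> ?S \<longrightarrow> g (x(i := t)) = f (x(i := t))) (nhds (x i))"
    using eventually_upd[OF assms(1,4,5,3)] by eventually_elim (simp add: assms(6))
  ultimately have "((\<lambda>t. f (x(i := t))) has_real_derivative D) (at (x i) within ?S)"
    using has_field_derivative_cong_ev[of "x i" "x i" ?S "\<lambda>t. g (x(i := t))" "\<lambda>t. f (x(i := t))" D D ?S]
      assms(7) by simp
  then show "((\<lambda>t. f (x(i := t))) has_vector_derivative D) (at (x i) within ?S)"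
    by (simp add: has_real_derivative_iff_has_vector_derivative)
qed

lemma pdv_open_eqI:
  assumes "finite I" "openin (powertop_real I) W" "x \<in> W" "i \<in> I"
    and "((\<lambda>t. f (x(i := t))) has_real_derivative D) (at (x i))"
  shows "pdv W i f x = D"
  by (rule pdv_eqI[of I W x i W f f]) (use assms thick_open in auto)

lemma has_pdv:
  assumes "finite I" "openin (powertop_real I) W" "x \<in> W" "i \<in> I"
    and "(\<lambda>t. f (x(i := t))) differentiable (at (x i))"
  shows "((\<lambda>t. f (x(i := t))) has_real_derivative pdv W i f x) (at (x i))"
proof -
  obtain D where D: "((\<lambda>t. f (x(i := t))) has_real_derivative D) (at (x i))"
    using assms(5) real_differentiable_def by blast
  then show ?thesis using pdv_open_eqI[OF assms(1-4) D] by simp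
qed

section \<open>Stability of \<open>C\<^sup>k\<close> functions on open sets\<close>

lemma Ck_on_open_continuous:
  "Ck_on_open k I W f \<Longrightarrow> continuous_map (subtopology (powertop_real I) W) euclideanreal f"
  by (cases k) auto

text \<open>Differentiability is asked of total functions, but on an open \<open>W\<close> it
  depends only on values in \<open>W\<close>. The partial derivatives again agree on
  \<open>W\<close>, which is all that the induction hypothesis demands.\<close>

lemma Ck_on_open_cong:
  assumes "finite I" "openin (powertop_real I) W"
  shows "Ck_on_open k I W f \<Longrightarrow> (\<And>x. x \<in> W \<Longrightarrow> f x = g x) \<Longrightarrow> Ck_on_open k I W g"
proof (induction k arbitrary: f g)
  case 0
  then show ?case by (auto intro: continuous_map_eq)
next
  case (Suc k)
  have D: "((\<lambda>t. g (x(i := t))) has_real_derivative pdv W i f x) (at (x i))"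
    if "i \<in> I" "x \<in> W" for i x
  proof -
    have "((\<lambda>t. f (x(i := t))) has_real_derivative pdv W i f x) (at (x i))"
      using has_pdv[OF assms that(2,1)] Suc.prems(1) that by auto
    moreover have "eventually (\<lambda>t. f (x(i := t)) = g (x(i := t))) (nhds (x i))"
      using eventually_upd[OF assms that(2,1)] by eventually_elim (rule Suc.prems)
    ultimately show ?thesis using DERIV_cong_ev[OF refl _ refl] by fast
  qed
  show ?case
    unfolding Ck_on_open.simps
  proof (intro conjI ballI)
    show "continuous_map (subtopology (powertop_real I) W) euclideanreal g"
      using Suc.prems by (auto intro: continuous_map_eq)
    show "(\<lambda>t. g (x(i := t))) differentiable (at (x i))" if "i \<in> I" "x \<in> W" for i x
      using D[OF that] by (auto simp: real_differentiable_def)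
    show "Ck_on_open k I W (pdv W i g)" if "i \<in> I" for i
    proof (rule Suc.IH)
      show "Ck_on_open k I W (pdv W i f)" using Suc.prems that by auto
      show "pdv W i f x = pdv W i g x" if "x \<in> W" for x
        using pdv_open_eqI[OF assms that \<open>i \<in> I\<close> D] that \<open>i \<in> I\<close> by simp
    qed
  qed
qed

text \<open>Lets closure proofs name the derivatives by explicit formulas \<open>D i\<close>; by
  uniqueness these agree with \<open>pdv W i f\<close> on \<open>W\<close>, which suffices by
  \<open>Ck_on_open_cong\<close>.\<close>

lemma Ck_on_open_SucI:
  assumes "finite I" "openin (powertop_real I) W"
    and "continuous_map (subtopology (powertop_real I) W) euclideanreal f"
    and D: "\<And>i x. i \<in> I \<Longrightarrow> x \<in> W \<Longrightarrow> ((\<lambda>t. f (x(i := t))) has_real_derivative D i x) (at (x i))"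
    and "\<And>i. i \<in> I \<Longrightarrow> Ck_on_open k I W (D i)"
  shows "Ck_on_open (Suc k) I W f"
  unfolding Ck_on_open.simps
proof (intro conjI ballI)
  show "(\<lambda>t. f (x(i := t))) differentiable (at (x i))" if "i \<in> I" "x \<in> W" for i x
    using D[OF that] by (auto simp: real_differentiable_def)
  show "Ck_on_open k I W (pdv W i f)" if "i \<in> I" for i
    using Ck_on_open_cong[OF assms(1,2) assms(5)[OF that]]
      pdv_open_eqI[OF assms(1,2) _ that D[OF that]] by metis
qed (rule assms(3))

lemma Ck_on_open_SucD:
  assumes "finite I" "openin (powertop_real I) W" "Ck_on_open (Suc k) I W f" "i \<in> I"
  shows "Ck_on_open k I W (pdv W i f)"
    and "x \<in> W \<Longrightarrow> ((\<lambda>t. f (x(i := t))) has_real_derivative pdv W i f x) (at (x i))"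
proof -
  show "Ck_on_open k I W (pdv W i f)" using assms by auto
  show "((\<lambda>t. f (x(i := t))) has_real_derivative pdv W i f x) (at (x i))" if "x \<in> W"
    by (rule has_pdv[OF assms(1,2) that assms(4)]) (use assms that in auto)
qed

lemma Ck_on_open_mono:
  assumes "finite I" "openin (powertop_real I) W"
  shows "Ck_on_open (Suc k) I W f \<Longrightarrow> Ck_on_open k I W f"
proof (induction k arbitrary: f)
  case (Suc k)
  show ?case
    using Suc.prems Suc.IH Ck_on_open_SucD[OF assms Suc.prems]
    by (intro Ck_on_open_SucI[OF assms, where D="\<lambda>i. pdv W i f"]) auto
qed simp

text \<open>\<open>pdv W\<close> and \<open>pdv W'\<close> are taken within different sets, but on
  \<open>W'\<close> both are ordinary partial derivatives, so those over \<open>W\<close> serve as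
  witnesses over \<open>W'\<close>.\<close>

lemma Ck_on_open_subset:
  assumes "finite I" "openin (powertop_real I) W" "openin (powertop_real I) W'" "W' \<subseteq> W"
  shows "Ck_on_open k I W f \<Longrightarrow> Ck_on_open k I W' f"
proof (induction k arbitrary: f)
  case 0
  then show ?case using assms(4) continuous_map_from_subtopology_mono by auto
next
  case (Suc k)
  show ?case
    using Suc.prems Suc.IH Ck_on_open_SucD[OF assms(1,2) Suc.prems] assms(4)
    by (intro Ck_on_open_SucI[OF assms(1,3), where D="\<lambda>i. pdv W i f"])
       (auto intro: continuous_map_from_subtopology_mono)
qed

lemma Ck_on_open_const:
  assumes "finite I" "openin (powertop_real I) W"
  shows "Ck_on_open k I W (\<lambda>x. c)"
proof (induction k arbitrary: c)
  case (Suc k)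
  then show ?case by (intro Ck_on_open_SucI[OF assms, where D="\<lambda>i x. 0"]) auto
qed auto

lemma Ck_on_open_coord:
  assumes "finite I" "openin (powertop_real I) W" "j \<in> I"
  shows "Ck_on_open k I W (\<lambda>x. x j)"
proof -
  have c: "continuous_map (subtopology (powertop_real I) W) euclideanreal (\<lambda>x. x j)"
    using assms(3) by (intro continuous_map_from_subtopology continuous_map_product_projection)
  show ?thesis
  proof (cases k)
    case (Suc n)
    have "((\<lambda>t. (x(i := t)) j) has_real_derivative (if i = j then 1 else 0)) (at (x i))" for x i
      by auto
    then show ?thesis unfolding Suc using c assms Ck_on_open_const
      by (intro Ck_on_open_SucI[OF assms(1,2), where D="\<lambda>i x. if i = j then 1 else 0"]) auto
  qed (use c in auto)
qed

lemma Ck_on_open_add: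
  assumes "finite I" "openin (powertop_real I) W"
  shows "Ck_on_open k I W f \<Longrightarrow> Ck_on_open k I W g \<Longrightarrow> Ck_on_open k I W (\<lambda>x. f x + g x)"
proof (induction k arbitrary: f g)
  case (Suc k)
  show ?case
    using Suc.IH Ck_on_open_SucD[OF assms Suc.prems(1)] Ck_on_open_SucD[OF assms Suc.prems(2)]
      Suc.prems[THEN Ck_on_open_continuous]
    by (intro Ck_on_open_SucI[OF assms, where D="\<lambda>i x. pdv W i f x + pdv W i g x"])
       (auto intro!: continuous_map_add derivative_intros)
qed (auto intro: continuous_map_add)

lemma Ck_on_open_mult:
  assumes "finite I" "openin (powertop_real I) W"
  shows "Ck_on_open k I W f \<Longrightarrow> Ck_on_open k I W g \<Longrightarrow> Ck_on_open k I W (\<lambda>x. f x * g x)"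
proof (induction k arbitrary: f g)
  case (Suc k)
  have d: "((\<lambda>t. f (x(i := t)) * g (x(i := t))) has_real_derivative
          pdv W i f x * g x + pdv W i g x * f x) (at (x i))" if "i \<in> I" "x \<in> W" for i x
    using DERIV_mult[OF Ck_on_open_SucD(2)[OF assms Suc.prems(1) that]
        Ck_on_open_SucD(2)[OF assms Suc.prems(2) that]] by (simp only: fun_upd_triv)
  \<comment> \<open>The product rule multiplies derivatives by the undifferentiated factors, which
    are lowered from class \<open>Suc k\<close> to \<open>k\<close> before the induction hypothesis
    is applied.\<close>
  have "Ck_on_open k I W (\<lambda>x. pdv W i f x * g x + pdv W i g x * f x)" if "i \<in> I" for i
    using Ck_on_open_mono[OF assms] Suc.prems that
    by (intro Ck_on_open_add[OF assms] Suc.IH Ck_on_open_SucD[OF assms]) auto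
  then show ?case
    using Suc.prems[THEN Ck_on_open_continuous]
    by (intro Ck_on_open_SucI[OF assms _ d] continuous_map_real_mult)
qed (auto intro: continuous_map_real_mult)

lemma Ck_on_open_sum:
  assumes "finite I" "openin (powertop_real I) W" "finite S"
    and "\<And>s. s \<in> S \<Longrightarrow> Ck_on_open k I W (f s)"
  shows "Ck_on_open k I W (\<lambda>x. \<Sum>s\<in>S. f s x)"
  using assms(3,4)
  by (induction S rule: finite_induct)
     (auto intro: Ck_on_open_add[OF assms(1,2)] Ck_on_open_const[OF assms(1,2)])

text \<open>Only one coordinate is moved at a time, so the mean value theorem in that coordinate applies.\<close>
lemma has_derivative_along_curve:
  fixes \<gamma> :: "real \<Rightarrow> 'j \<Rightarrow> real"
  assumes J: "finite J" "openin (powertop_real J) V" "\<gamma> t0 \<in> V"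
    and d\<gamma>: "\<And>j. j \<in> J \<Longrightarrow> ((\<lambda>t. \<gamma> t j) has_real_derivative \<gamma>' j) (at t0)"
    and ext: "\<And>t. \<gamma> t \<in> J \<rightarrow>\<^sub>E UNIV"
    and D: "\<And>j y. j \<in> J \<Longrightarrow> y \<in> V \<Longrightarrow> ((\<lambda>s. f (y(j := s))) has_real_derivative D j y) (at (y j))"
    and cD: "\<And>j. j \<in> J \<Longrightarrow> continuous_map (subtopology (powertop_real J) V) euclideanreal (D j)"
  shows "((\<lambda>t. f (\<gamma> t)) has_real_derivative (\<Sum>j\<in>J. D j (\<gamma> t0) * \<gamma>' j)) (at t0)"
proof -
  define y where "y = \<gamma> t0"
  \<comment> \<open>\<open>\<zeta> K t\<close> follows the curve in the coordinates of
    \<open>K\<close> and stays at \<open>y\<close> in the others. Enlarging \<open>K\<close> by one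
    element at a time makes the increment of \<open>f\<close> telescope.\<close>
  define \<zeta> where "\<zeta> = (\<lambda>K t i. if i \<in> K then \<gamma> t i else y i)"
  have yV: "y \<in> V" and yE: "y \<in> J \<rightarrow>\<^sub>E UNIV" using J ext by (auto simp: y_def)
  have \<zeta>E: "\<zeta> K t \<in> J \<rightarrow>\<^sub>E UNIV" if "K \<subseteq> J" for K t
    using yE that ext[of t] by (auto simp: \<zeta>_def PiE_iff extensional_def)
  have ev: "eventually (\<lambda>t. \<forall>j\<in>J. \<bar>\<gamma> t j - y j\<bar> < e) (at t0)" if "e > 0" for e
  proof (rule eventually_ball_finite[OF J(1)], intro ballI)
    fix j assume j: "j \<in> J"
    have "((\<lambda>t. \<gamma> t j) \<longlongrightarrow> \<gamma> t0 j) (at t0)" using DERIV_isCont[OF d\<gamma>[OF j]] by (simp add: isCont_def)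
    from tendstoD[OF this that] show "eventually (\<lambda>t. \<bar>\<gamma> t j - y j\<bar> < e) (at t0)"
      by (simp add: dist_real_def y_def)
  qed
  have "((\<lambda>t. f (\<zeta> K t)) has_real_derivative (\<Sum>j\<in>K. D j y * \<gamma>' j)) (at t0)" if "K \<subseteq> J" for K
    using finite_subset[OF that J(1)] that
  proof (induction K rule: finite_induct)
    case empty
    then show ?case by (simp add: \<zeta>_def)
  next
    case (insert j K)
    then have j: "j \<in> J" "K \<subseteq> J" "j \<notin> K" by auto
    define h where "h = (\<lambda>t. f (\<zeta> (insert j K) t) - f (\<zeta> K t))"
    \<comment> \<open>\<open>r\<close> is the difference quotient of \<open>f\<close> in direction
      \<open>j\<close>. The curve may return to the value \<open>y j\<close> at times other than
      \<open>t0\<close>, so the quotient is filled in there by its expected limit; the factorisation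
      \<open>hr\<close> then holds for every \<open>t\<close>.\<close>
    define r where "r = (\<lambda>t. if \<gamma> t j = y j then D j y else h t / (\<gamma> t j - y j))"
    have upd: "\<zeta> (insert j K) t = (\<zeta> K t)(j := \<gamma> t j)" for t by (auto simp: \<zeta>_def)
    have \<zeta>j: "\<zeta> K t j = y j" for t using j by (simp add: \<zeta>_def)
    then have upd0: "(\<zeta> K t)(j := y j) = \<zeta> K t" for t by (metis fun_upd_triv)
    have hr: "h t = r t * (\<gamma> t j - y j)" for t
      using upd upd0 by (simp add: r_def h_def)
    have "(r \<longlongrightarrow> D j y) (at t0)"
    proof (rule tendstoI)
      fix e :: real assume e: "e > 0"
      \<comment> \<open>Continuity of \<open>D j\<close> gives a box around \<open>y\<close> in
        which it stays within \<open>e\<close> of \<open>D j y\<close>; the segment on which the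
        mean value theorem is applied will lie in this box.\<close>
      have "openin (powertop_real J) {z \<in> V. D j z \<in> ball (D j y) e}"
        using openin_continuous_map_preimage[OF cD[OF j(1)], of "ball (D j y) e"] J(2)
          openin_powertop_subset[OF J(2)]
        by (simp add: openin_open_subtopology Int_absorb1 topspace_subtopology)
      moreover have "y \<in> {z \<in> V. D j z \<in> ball (D j y) e}" using yV e by simp
      ultimately obtain d where d: "d > 0" "\<And>z. z \<in> J \<rightarrow>\<^sub>E UNIV \<Longrightarrow> (\<And>i. i \<in> J \<Longrightarrow> \<bar>z i - y i\<bar> < d) \<Longrightarrow>
           z \<in> {z \<in> V. D j z \<in> ball (D j y) e}"
        using openin_powertop_box[OF J(1)] by blast
      have "dist (r t) (D j y) < e" if t: "\<forall>j\<in>J. \<bar>\<gamma> t j - y j\<bar> < d" for t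
      proof (cases "\<gamma> t j = y j")
        case True
        then show ?thesis using e by (simp add: r_def)
      next
        case False
        have in_box: "(\<zeta> K t)(j := s) \<in> {z \<in> V. D j z \<in> ball (D j y) e}"
          if "min (y j) (\<gamma> t j) \<le> s" "s \<le> max (y j) (\<gamma> t j)" for s
        proof (rule d(2))
          show "(\<zeta> K t)(j := s) \<in> J \<rightarrow>\<^sub>E UNIV" using \<zeta>E[OF j(2)] j(1) by (rule ext_upd)
          show "\<bar>((\<zeta> K t)(j := s)) i - y i\<bar> < d" if "i \<in> J" for i
            using t that j(1) d(1) \<open>min _ _ \<le> s\<close> \<open>s \<le> _\<close> bspec[OF t j(1)] by (auto simp: \<zeta>_def)
        qed
        have der: "((\<lambda>s. f ((\<zeta> K t)(j := s))) has_real_derivative D j ((\<zeta> K t)(j := s))) (at s)"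
          if "min (y j) (\<gamma> t j) \<le> s" "s \<le> max (y j) (\<gamma> t j)" for s
          using D[OF j(1), of "(\<zeta> K t)(j := s)"] in_box[OF that] by simp
        \<comment> \<open>The mean value theorem wants ordered endpoints. For
          \<open>\<gamma> t j < y j\<close> it is applied backwards, and the two sign changes
          cancel.\<close>
        obtain s where s: "min (y j) (\<gamma> t j) \<le> s" "s \<le> max (y j) (\<gamma> t j)"
          "h t = (\<gamma> t j - y j) * D j ((\<zeta> K t)(j := s))"
        proof (cases "y j < \<gamma> t j")
          case True
          then obtain s where "y j < s" "s < \<gamma> t j"
              "f ((\<zeta> K t)(j := \<gamma> t j)) - f ((\<zeta> K t)(j := y j)) = (\<gamma> t j - y j) * D j ((\<zeta> K t)(j := s))"
            using MVT2[OF True, of "\<lambda>s. f ((\<zeta> K t)(j := s))" "\<lambda>s. D j ((\<zeta> K t)(j := s))"] der by auto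
          then show thesis using that[of s] by (simp add: h_def upd upd0)
        next
          case 2: False
          then have lt: "\<gamma> t j < y j" using False by auto
          then obtain s where "\<gamma> t j < s" "s < y j"
              "f ((\<zeta> K t)(j := y j)) - f ((\<zeta> K t)(j := \<gamma> t j)) = (y j - \<gamma> t j) * D j ((\<zeta> K t)(j := s))"
            using MVT2[OF lt, of "\<lambda>s. f ((\<zeta> K t)(j := s))" "\<lambda>s. D j ((\<zeta> K t)(j := s))"] der by auto
          then show thesis using that[of s] by (simp add: h_def upd upd0 algebra_simps)
        qed
        then have "r t = D j ((\<zeta> K t)(j := s))" using False by (simp add: r_def)
        then show ?thesis using in_box[OF s(1,2)] by (simp add: dist_commute)
      qed
      then show "eventually (\<lambda>t. dist (r t) (D j y) < e) (at t0)"
        using ev[OF d(1)] by (auto elim: eventually_mono)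
    qed
    moreover have "((\<lambda>t. (\<gamma> t j - y j) / (t - t0)) \<longlongrightarrow> \<gamma>' j) (at t0)"
      using d\<gamma>[OF j(1)] by (simp add: has_field_derivative_iff y_def)
    ultimately have "((\<lambda>t. r t * ((\<gamma> t j - y j) / (t - t0))) \<longlongrightarrow> D j y * \<gamma>' j) (at t0)"
      by (rule tendsto_mult)
    moreover have "h t0 = 0" by (simp add: hr y_def)
    ultimately have "(h has_real_derivative D j y * \<gamma>' j) (at t0)"
      unfolding has_field_derivative_iff by (simp add: hr y_def)
    from DERIV_add[OF this insert.IH[OF j(2)]] show ?case
      using insert.hyps by (simp add: h_def)
  qed
  from this[of J] have "((\<lambda>t. f (\<zeta> J t)) has_real_derivative (\<Sum>j\<in>J. D j y * \<gamma>' j)) (at t0)"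
    by simp
  moreover have "\<zeta> J t = \<gamma> t" for t
    by (rule PiE_ext[OF \<zeta>E[OF subset_refl] ext]) (simp add: \<zeta>_def)
  ultimately show ?thesis by (simp add: y_def)
qed

section \<open>Composition of \<open>C\<^sup>k\<close> functions\<close>

lemma openin_powertop_ext: "openin (powertop_real I) (I \<rightarrow>\<^sub>E UNIV)"
  using openin_topspace[of "powertop_real I"] by simp

lemma Ck_on_open_compose_continuous:
  assumes "openin (powertop_real J) V"
    and gV: "\<And>x. x \<in> W \<Longrightarrow> g x \<in> V"
    and f: "Ck_on_open k J V f" and g: "\<And>j. j \<in> J \<Longrightarrow> Ck_on_open l I W (\<lambda>x. g x j)"
  shows "continuous_map (subtopology (powertop_real I) W) euclideanreal (\<lambda>x. f (g x))"
proof -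
  have "g x \<in> extensional J" if "x \<in> W" for x
    using subsetD[OF openin_powertop_subset[OF assms(1)] gV[OF that]] by (simp add: PiE_iff)
  then have "continuous_map (subtopology (powertop_real I) W) (subtopology (powertop_real J) V) g"
    using gV g[THEN Ck_on_open_continuous]
    by (auto simp: continuous_map_in_subtopology continuous_map_componentwise)
  from continuous_map_compose[OF this Ck_on_open_continuous[OF f]] show ?thesis
    by (simp add: o_def)
qed

text \<open>Induction on \<open>k\<close> with \<open>g\<close> fixed: the chain rule expresses each
  derivative through \<open>pdv V j f\<close> composed with the same \<open>g\<close>, and
  \<open>pdv V j f\<close> has one class less.\<close>

lemma Ck_on_open_compose:
  assumes "finite I" "openin (powertop_real I) W" "finite J" "openin (powertop_real J) V"
    and gV: "\<And>x. x \<in> W \<Longrightarrow> g x \<in> V"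
  shows "Ck_on_open k J V f \<Longrightarrow> (\<And>j. j \<in> J \<Longrightarrow> Ck_on_open k I W (\<lambda>x. g x j)) \<Longrightarrow>
    Ck_on_open k I W (\<lambda>x. f (g x))"
proof (induction k arbitrary: f)
  case 0
  show ?case using Ck_on_open_compose_continuous[OF assms(4) gV 0] by simp
next
  case (Suc k)
  have d: "((\<lambda>t. f (g (x(i := t)))) has_real_derivative
        (\<Sum>j\<in>J. pdv V j f (g x) * pdv W i (\<lambda>x. g x j) x)) (at (x i))" if "i \<in> I" "x \<in> W" for i x
  proof -
    have gx: "restrict (g y) J = g y" if "y \<in> W" for y
      using subsetD[OF openin_powertop_subset[OF assms(4)] gV[OF that]] by (rule PiE_restrict)
    \<comment> \<open>The curve lemma asks for extensional values at every \<open>t\<close>, also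
      where \<open>x(i := t)\<close> has left \<open>W\<close> and \<open>g\<close> is
      unconstrained. Restricting to \<open>J\<close> repairs this and changes nothing near
      \<open>x i\<close>.\<close>
    have "((\<lambda>t. f (restrict (g (x(i := t))) J)) has_real_derivative
        (\<Sum>j\<in>J. pdv V j f (restrict (g (x(i := x i))) J) * pdv W i (\<lambda>x. g x j) x)) (at (x i))"
    proof (rule has_derivative_along_curve[OF assms(3,4)])
      show "restrict (g (x(i := x i))) J \<in> V" using gx gV that by simp
      show "((\<lambda>t. restrict (g (x(i := t))) J j) has_real_derivative pdv W i (\<lambda>x. g x j) x) (at (x i))"
        if "j \<in> J" for j
      proof -
        have eq: "(\<lambda>t. restrict (g (x(i := t))) J j) = (\<lambda>t. g (x(i := t)) j)"
          using that by (intro ext) (rule restrict_apply')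
        show ?thesis unfolding eq
          by (rule Ck_on_open_SucD(2)[OF assms(1,2) Suc.prems(2)[OF that] \<open>i \<in> I\<close> \<open>x \<in> W\<close>])
      qed
      show "((\<lambda>s. f (y(j := s))) has_real_derivative pdv V j f y) (at (y j))"
        if "j \<in> J" "y \<in> V" for j y
        using Ck_on_open_SucD(2)[OF assms(3,4) Suc.prems(1)] that by blast
      show "continuous_map (subtopology (powertop_real J) V) euclideanreal (pdv V j f)"
        if "j \<in> J" for j
        using Ck_on_open_SucD(1)[OF assms(3,4) Suc.prems(1) that] by (rule Ck_on_open_continuous)
    qed auto
    moreover have "eventually (\<lambda>t. f (restrict (g (x(i := t))) J) = f (g (x(i := t)))) (nhds (x i))"
      using eventually_upd[OF assms(1,2) that(2,1)] by eventually_elim (simp add: gx)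
    ultimately have "((\<lambda>t. f (g (x(i := t)))) has_real_derivative
        (\<Sum>j\<in>J. pdv V j f (restrict (g (x(i := x i))) J) * pdv W i (\<lambda>x. g x j) x)) (at (x i))"
      using DERIV_cong_ev[OF refl _ refl] by fast
    then show ?thesis using gx[OF that(2)] by (simp only: fun_upd_triv)
  qed
  have "Ck_on_open k I W (\<lambda>x. pdv V j f (g x) * pdv W i (\<lambda>x. g x j) x)" if "i \<in> I" "j \<in> J" for i j
  proof (rule Ck_on_open_mult[OF assms(1,2)])
    show "Ck_on_open k I W (\<lambda>x. pdv V j f (g x))"
      by (rule Suc.IH[OF Ck_on_open_SucD(1)[OF assms(3,4) Suc.prems(1) that(2)]
            Ck_on_open_mono[OF assms(1,2) Suc.prems(2)]])
    show "Ck_on_open k I W (\<lambda>x. pdv W i (\<lambda>x. g x j) x)"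
      by (rule Ck_on_open_SucD(1)[OF assms(1,2) Suc.prems(2)[OF that(2)] that(1)])
  qed
  then have S: "Ck_on_open k I W (\<lambda>x. \<Sum>j\<in>J. pdv V j f (g x) * pdv W i (\<lambda>x. g x j) x)" if "i \<in> I" for i
    using that by (intro Ck_on_open_sum[OF assms(1,2,3)])
  show ?case
    by (rule Ck_on_open_SucI[OF assms(1,2) Ck_on_open_compose_continuous[OF assms(4) gV Suc.prems] d S])
qed

subsection \<open>Smooth vector-valued functions\<close>

context
  fixes I :: "'i set" and W
  assumes fin: "finite I" and W: "openin (powertop_real I) W"
begin

lemma smooth_on_open_subset:
  "openin (powertop_real I) W' \<Longrightarrow> W' \<subseteq> W \<Longrightarrow> smooth_on_open I W f \<Longrightarrow> smooth_on_open I W' f"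
  using Ck_on_open_subset[OF fin W] unfolding smooth_on_open_def by blast

lemma smooth_on_open_coord: "j \<in> I \<Longrightarrow> smooth_on_open I W (\<lambda>x. x j)"
  using Ck_on_open_coord[OF fin W] unfolding smooth_on_open_def by blast

lemma smooth_on_open_mult:
  "smooth_on_open I W f \<Longrightarrow> smooth_on_open I W g \<Longrightarrow> smooth_on_open I W (\<lambda>x. f x * g x)"
  using Ck_on_open_mult[OF fin W] unfolding smooth_on_open_def by blast

lemma smooth_on_open_sum:
  "finite S \<Longrightarrow> (\<And>s. s \<in> S \<Longrightarrow> smooth_on_open I W (f s)) \<Longrightarrow> smooth_on_open I W (\<lambda>x. \<Sum>s\<in>S. f s x)"
  using Ck_on_open_sum[OF fin W] unfolding smooth_on_open_def by blast

lemma smooth_on_open_compose: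
  assumes "finite J" "openin (powertop_real J) V" "\<And>x. x \<in> W \<Longrightarrow> g x \<in> V"
    and "smooth_on_open J V f" "\<And>j. j \<in> J \<Longrightarrow> smooth_on_open I W (\<lambda>x. g x j)"
  shows "smooth_on_open I W (\<lambda>x. f (g x))"
  unfolding smooth_on_open_def
proof
  fix k show "Ck_on_open k I W (\<lambda>x. f (g x))"
    by (rule Ck_on_open_compose[OF fin W assms(1-3)]) (use assms in \<open>auto simp: smooth_on_open_def\<close>)
qed

lemma smooth_on_open_pdv: "smooth_on_open I W f \<Longrightarrow> i \<in> I \<Longrightarrow> smooth_on_open I W (pdv W i f)"
  using Ck_on_open_SucD(1)[OF fin W] unfolding smooth_on_open_def by blast

lemma smooth_on_open_has_pdv:
  "smooth_on_open I W f \<Longrightarrow> i \<in> I \<Longrightarrow> x \<in> W \<Longrightarrow>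
    ((\<lambda>t. f (x(i := t))) has_real_derivative pdv W i f x) (at (x i))"
  using Ck_on_open_SucD(2)[OF fin W] unfolding smooth_on_open_def by blast

end

lemma smooth_on_open_continuous:
  "smooth_on_open I W f \<Longrightarrow> continuous_map (subtopology (powertop_real I) W) euclideanreal f"
  unfolding smooth_on_open_def using Ck_on_open_continuous by blast

text \<open>Describes an extension of all components at once; \<open>smooth_vec_on\<close> only
  provides extensions component by component, each on its own neighbourhood.\<close>

definition smooth_vec_open ::
  "'i set \<Rightarrow> 'j set \<Rightarrow> ('i \<Rightarrow> real) set \<Rightarrow> (('i \<Rightarrow> real) \<Rightarrow> 'j \<Rightarrow> real) \<Rightarrow> bool" where
  "smooth_vec_open I J W F \<longleftrightarrow> F \<in> W \<rightarrow> (J \<rightarrow>\<^sub>E UNIV) \<and> (\<forall>j\<in>J. smooth_on_open I W (\<lambda>y. F y j))"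

lemma smooth_vec_open_continuous:
  assumes "smooth_vec_open I J W F"
  shows "continuous_map (subtopology (powertop_real I) W) (powertop_real J) F"
  using assms smooth_on_open_continuous
  by (fastforce simp: smooth_vec_open_def continuous_map_componentwise PiE_iff Pi_iff)

lemma smooth_vec_open_preimage:
  assumes "smooth_vec_open I J W F" "openin (powertop_real I) W" "openin (powertop_real J) V"
  shows "openin (powertop_real I) {x \<in> W. F x \<in> V}"
  using openin_continuous_map_preimage[OF smooth_vec_open_continuous[OF assms(1)] assms(3)]
    assms(2) openin_powertop_subset[OF assms(2)]
  by (simp add: openin_open_subtopology Int_absorb1)

lemma smooth_vec_open_subset:
  assumes "smooth_vec_open I J W F" "finite I" "openin (powertop_real I) W"
    "openin (powertop_real I) W'" "W' \<subseteq> W"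
  shows "smooth_vec_open I J W' F"
  using assms smooth_on_open_subset[OF assms(2-5)] by (auto simp: smooth_vec_open_def)

lemma smooth_vec_open_compose:
  assumes "finite I" "openin (powertop_real I) W" "finite J" "openin (powertop_real J) V"
    and "smooth_vec_open I J W F" "smooth_vec_open J K V G" "\<And>x. x \<in> W \<Longrightarrow> F x \<in> V"
  shows "smooth_vec_open I K W (\<lambda>x. G (F x))"
  unfolding smooth_vec_open_def
proof (intro conjI ballI)
  show "(\<lambda>x. G (F x)) \<in> W \<rightarrow> (K \<rightarrow>\<^sub>E UNIV)" using assms by (auto simp: smooth_vec_open_def)
  show "smooth_on_open I W (\<lambda>y. G (F y) k)" if "k \<in> K" for k
    by (rule smooth_on_open_compose[OF assms(1-4), where f="\<lambda>z. G z k"])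
      (use assms that in \<open>auto simp: smooth_vec_open_def\<close>)
qed

section \<open>Maps on arbitrary subsets through local extensions\<close>

lemma smooth_vec_onI:
  assumes "\<And>x. x \<in> A \<Longrightarrow> f x \<in> J \<rightarrow>\<^sub>E UNIV"
    and "\<And>x. x \<in> A \<Longrightarrow> \<exists>W F. openin (powertop_real I) W \<and> x \<in> W \<and> smooth_vec_open I J W F \<and>
      (\<forall>y\<in>A \<inter> W. f y = F y)"
  shows "smooth_vec_on I J A f"
  unfolding smooth_vec_on_def smooth_on_subset_def
proof (intro conjI ballI)
  fix j x assume "j \<in> J" "x \<in> A"
  obtain W F where "openin (powertop_real I) W" "x \<in> W" "smooth_vec_open I J W F" "\<forall>y\<in>A \<inter> W. f y = F y"
    using assms(2)[OF \<open>x \<in> A\<close>] by blast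
  with \<open>j \<in> J\<close> show "\<exists>W g. openin (powertop_real I) W \<and> x \<in> W \<and> smooth_on_open I W g \<and>
      (\<forall>y\<in>A \<inter> W. f y j = g y)"
    by (intro exI[of _ W] exI[of _ "\<lambda>y. F y j"]) (auto simp: smooth_vec_open_def)
qed (use assms in auto)

text \<open>As \<open>J\<close> is finite, the neighbourhoods belonging to the components can be
  intersected, so that one map extends all of them.\<close>

lemma smooth_vec_onE:
  assumes "smooth_vec_on I J A f" "finite I" "finite J" "A \<subseteq> I \<rightarrow>\<^sub>E UNIV" "x \<in> A"
  obtains W F where "openin (powertop_real I) W" "x \<in> W" "smooth_vec_open I J W F"
    "\<And>y. y \<in> A \<Longrightarrow> y \<in> W \<Longrightarrow> f y = F y"
proof -
  have "\<forall>j\<in>J. \<exists>W g. openin (powertop_real I) W \<and> x \<in> W \<and> smooth_on_open I W g \<and>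
      (\<forall>y\<in>A \<inter> W. f y j = g y)"
    using assms by (auto simp: smooth_vec_on_def smooth_on_subset_def)
  then obtain W g where Wg: "\<And>j. j \<in> J \<Longrightarrow> openin (powertop_real I) (W j)" "\<And>j. j \<in> J \<Longrightarrow> x \<in> W j"
      "\<And>j. j \<in> J \<Longrightarrow> smooth_on_open I (W j) (g j)" "\<And>j y. j \<in> J \<Longrightarrow> y \<in> A \<Longrightarrow> y \<in> W j \<Longrightarrow> f y j = g j y"
    by (metis IntI)
  \<comment> \<open>The factor \<open>topspace\<close> matters for empty \<open>J\<close>, where the
    intersection over \<open>J\<close> alone would be all of the function type.\<close>
  define V where "V = topspace (powertop_real I) \<inter> (\<Inter>j\<in>J. W j)"
  have V: "openin (powertop_real I) V"
  proof (cases "J = {}")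
    case False
    have "openin (powertop_real I) (\<Inter>j\<in>J. W j)"
      using openin_INT2[OF assms(3) False] Wg(1) by blast
    then show ?thesis unfolding V_def by blast
  next
    case True
    then show ?thesis by (simp add: V_def openin_powertop_ext)
  qed
  have sm: "smooth_on_open I V (\<lambda>y. restrict (\<lambda>j. g j y) J j)" if "j \<in> J" for j
    using smooth_on_open_subset[OF assms(2) Wg(1)[OF that] V _ Wg(3)[OF that]] that by (auto simp: V_def)
  have fJ: "f y \<in> J \<rightarrow>\<^sub>E UNIV" if "y \<in> A" for y using assms(1) that by (auto simp: smooth_vec_on_def)
  show thesis
  proof (rule that[OF V])
    show "x \<in> V" using assms Wg(2) by (auto simp: V_def)
    show "smooth_vec_open I J V (\<lambda>y. \<lambda>j\<in>J. g j y)" using sm by (auto simp: smooth_vec_open_def)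
    show "f y = (\<lambda>j\<in>J. g j y)" if "y \<in> A" "y \<in> V" for y
    proof (rule PiE_ext[OF fJ[OF that(1)]])
      show "(\<lambda>j\<in>J. g j y) \<in> J \<rightarrow>\<^sub>E UNIV" by simp
      show "f y j = (\<lambda>j\<in>J. g j y) j" if "j \<in> J" for j
        using Wg(4)[OF that \<open>y \<in> A\<close>] \<open>y \<in> V\<close> that by (simp add: V_def)
    qed
  qed
qed

lemma smooth_vec_on_subset:
  assumes "smooth_vec_on I J A f" "B \<subseteq> A"
  shows "smooth_vec_on I J B f"
  unfolding smooth_vec_on_def smooth_on_subset_def
proof (intro conjI ballI)
  show "f \<in> B \<rightarrow> (J \<rightarrow>\<^sub>E UNIV)" using assms by (auto simp: smooth_vec_on_def)
  fix j x assume "j \<in> J" "x \<in> B"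
  then have "x \<in> A" using assms by auto
  then obtain W g where "openin (powertop_real I) W" "x \<in> W" "smooth_on_open I W g" "\<forall>y\<in>A \<inter> W. f y j = g y"
    using assms(1) \<open>j \<in> J\<close> unfolding smooth_vec_on_def smooth_on_subset_def by meson
  then show "\<exists>W g. openin (powertop_real I) W \<and> x \<in> W \<and> smooth_on_open I W g \<and> (\<forall>y\<in>B \<inter> W. f y j = g y)"
    using assms(2) by (intro exI[of _ W] exI[of _ g]) auto
qed

lemma smooth_vec_on_cong:
  assumes "smooth_vec_on I J A f" "\<And>x. x \<in> A \<Longrightarrow> f x = g x"
  shows "smooth_vec_on I J A g"
  using assms unfolding smooth_vec_on_def smooth_on_subset_def
  by (simp add: Pi_iff cong: conj_cong)

lemma smooth_vec_on_local:
  assumes "finite I" "\<And>x. x \<in> A \<Longrightarrow>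
    \<exists>W. openin (powertop_real I) W \<and> x \<in> W \<and> smooth_vec_on I J (A \<inter> W) f"
  shows "smooth_vec_on I J A f"
  unfolding smooth_vec_on_def smooth_on_subset_def
proof (intro conjI ballI)
  show "f \<in> A \<rightarrow> (J \<rightarrow>\<^sub>E UNIV)" using assms(2) by (fastforce simp: smooth_vec_on_def)
  fix j x assume "j \<in> J" "x \<in> A"
  obtain W where W: "openin (powertop_real I) W" "x \<in> W" "smooth_vec_on I J (A \<inter> W) f"
    using assms(2)[OF \<open>x \<in> A\<close>] by blast
  then obtain V g where V: "openin (powertop_real I) V" "x \<in> V" "smooth_on_open I V g"
      "\<forall>y\<in>A \<inter> W \<inter> V. f y j = g y"
    using \<open>j \<in> J\<close> \<open>x \<in> A\<close> unfolding smooth_vec_on_def smooth_on_subset_def by (meson IntI)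
  have VW: "openin (powertop_real I) (V \<inter> W)" using V W by blast
  show "\<exists>W g. openin (powertop_real I) W \<and> x \<in> W \<and> smooth_on_open I W g \<and> (\<forall>y\<in>A \<inter> W. f y j = g y)"
    using smooth_on_open_subset[OF assms(1) V(1) VW _ V(3)] V W VW
    by (intro exI[of _ "V \<inter> W"] exI[of _ g]) auto
qed

lemma smooth_vec_on_compose:
  assumes "finite I" "finite J" "A \<subseteq> I \<rightarrow>\<^sub>E UNIV" "B \<subseteq> J \<rightarrow>\<^sub>E UNIV" "finite K"
    and f: "smooth_vec_on I J A f" and g: "smooth_vec_on J K B g" and fB: "\<And>x. x \<in> A \<Longrightarrow> f x \<in> B"
  shows "smooth_vec_on I K A (\<lambda>x. g (f x))"
proof (rule smooth_vec_onI)
  show "g (f x) \<in> K \<rightarrow>\<^sub>E UNIV" if "x \<in> A" for x using fB that g by (auto simp: smooth_vec_on_def)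
  fix x assume x: "x \<in> A"
  obtain W F where W: "openin (powertop_real I) W" "x \<in> W" "smooth_vec_open I J W F"
    "\<And>y. y \<in> A \<Longrightarrow> y \<in> W \<Longrightarrow> f y = F y"
    using smooth_vec_onE[OF f assms(1,2,3) x] by metis
  obtain V G where V: "openin (powertop_real J) V" "f x \<in> V" "smooth_vec_open J K V G"
    "\<And>y. y \<in> B \<Longrightarrow> y \<in> V \<Longrightarrow> g y = G y"
    using smooth_vec_onE[OF g assms(2,5,4) fB[OF x]] by metis
  \<comment> \<open>The extension \<open>F\<close> need not map into \<open>V\<close> away from
    \<open>x\<close>, so it is cut down to the preimage of \<open>V\<close>.\<close>
  define U where "U = {y \<in> W. F y \<in> V}"
  have U: "openin (powertop_real I) U" unfolding U_def by (rule smooth_vec_open_preimage[OF W(3,1) V(1)])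
  have "smooth_vec_open I K U (\<lambda>x. G (F x))"
    by (rule smooth_vec_open_compose[OF assms(1) U assms(2) V(1) _ V(3)])
      (use smooth_vec_open_subset[OF W(3) assms(1) W(1) U] in \<open>auto simp: U_def\<close>)
  moreover have "x \<in> U" using W V x by (simp add: U_def)
  moreover have "\<forall>y\<in>A \<inter> U. g (f y) = G (F y)" using W(4) V(4) fB by (fastforce simp: U_def)
  ultimately show "\<exists>W F. openin (powertop_real I) W \<and> x \<in> W \<and> smooth_vec_open I K W F \<and>
      (\<forall>y\<in>A \<inter> W. g (f y) = F y)"
    using U by blast
qed

lemma smooth_vec_on_continuous:
  assumes "smooth_vec_on I J A f" "finite I" "finite J" "A \<subseteq> I \<rightarrow>\<^sub>E UNIV"
  shows "continuous_map (subtopology (powertop_real I) A) (powertop_real J) f"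
  unfolding continuous_map_def
proof (intro conjI allI impI)
  show "f \<in> topspace (subtopology (powertop_real I) A) \<rightarrow> topspace (powertop_real J)"
    using assms(1) by (auto simp: smooth_vec_on_def)
  fix V assume V: "openin (powertop_real J) V"
  have eq: "{x \<in> topspace (subtopology (powertop_real I) A). f x \<in> V} = {x \<in> A. f x \<in> V}"
    using assms(4) by auto
  show "openin (subtopology (powertop_real I) A) {x \<in> topspace (subtopology (powertop_real I) A). f x \<in> V}"
    unfolding eq
  proof (subst openin_subopen, intro ballI)
    fix x assume x: "x \<in> {x \<in> A. f x \<in> V}"
    then obtain W F where W: "openin (powertop_real I) W" "x \<in> W" "smooth_vec_open I J W F"
        "\<And>y. y \<in> A \<Longrightarrow> y \<in> W \<Longrightarrow> f y = F y"
      using smooth_vec_onE[OF assms(1-4)] by (metis (no_types, lifting) mem_Collect_eq)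
    have "openin (subtopology (powertop_real I) A) (A \<inter> {y \<in> W. F y \<in> V})"
      using smooth_vec_open_preimage[OF W(3,1) V] openin_subtopology_Int2 by blast
    moreover have "x \<in> A \<inter> {y \<in> W. F y \<in> V}" using x W by auto
    moreover have "A \<inter> {y \<in> W. F y \<in> V} \<subseteq> {x \<in> A. f x \<in> V}" using W by auto
    ultimately show "\<exists>T. openin (subtopology (powertop_real I) A) T \<and> x \<in> T \<and> T \<subseteq> {x \<in> A. f x \<in> V}"
      by blast
  qed
qed

text \<open>Projections from products and tangent bundles, and the inverses of \<open>can_U\<close>
  and \<open>can_T\<close>, all take this form in adapted charts.\<close>

lemma smooth_vec_on_coords:
  assumes "finite I" "A \<subseteq> I \<rightarrow>\<^sub>E UNIV" "\<And>j. j \<in> J \<Longrightarrow> \<sigma> j \<in> I"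
  shows "smooth_vec_on I J A (\<lambda>x. \<lambda>j\<in>J. x (\<sigma> j))"
proof (rule smooth_vec_onI)
  fix x assume "x \<in> A"
  have "smooth_vec_open I J (topspace (powertop_real I)) (\<lambda>x. \<lambda>j\<in>J. x (\<sigma> j))"
    using smooth_on_open_coord[OF assms(1) openin_topspace assms(3)] by (auto simp: smooth_vec_open_def)
  then show "\<exists>W F. openin (powertop_real I) W \<and> x \<in> W \<and> smooth_vec_open I J W F \<and>
      (\<forall>y\<in>A \<inter> W. (\<lambda>j\<in>J. y (\<sigma> j)) = F y)"
    using \<open>x \<in> A\<close> assms(2)
    by (intro exI[of _ "topspace (powertop_real I)"] exI[of _ "\<lambda>x. \<lambda>j\<in>J. x (\<sigma> j)"]) (auto simp: openin_powertop_ext)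
qed auto

subsection \<open>Jacobians\<close>

lemma jacobian_apply_in: "jacobian_apply I J A f x v \<in> J \<rightarrow>\<^sub>E UNIV"
  by (simp add: jacobian_apply_def)

lemma jacobian_apply_extension:
  assumes "finite I" "thick I A x" "x \<in> A" "openin (powertop_real I) W" "x \<in> W"
    and "smooth_vec_open I J W F" "\<And>y. y \<in> A \<Longrightarrow> y \<in> W \<Longrightarrow> f y = F y"
  shows "jacobian_apply I J A f x v = jacobian_apply I J W F x v"
proof -
  have "pdv A i (\<lambda>y. f y j) x = pdv W i (\<lambda>y. F y j) x" if "i \<in> I" "j \<in> J" for i j
    by (rule pdv_eqI[OF assms(1,2) that(1) assms(4,5), where g="\<lambda>y. F y j"])
      (use assms that in \<open>auto simp: smooth_vec_open_def intro!: smooth_on_open_has_pdv\<close>)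
  then show ?thesis by (auto simp: jacobian_apply_def intro!: restrict_ext sum.cong)
qed

text \<open>Each column comes from \<open>has_derivative_along_curve\<close> for the image under
  \<open>F\<close> of a coordinate line; exchanging the two finite sums turns the result into the
  product of the Jacobians.\<close>

lemma jacobian_apply_compose_open:
  assumes "finite I" "openin (powertop_real I) W" "finite J" "openin (powertop_real J) V"
    and F: "smooth_vec_open I J W F" and G: "smooth_vec_open J K V G" and FV: "\<And>x. x \<in> W \<Longrightarrow> F x \<in> V"
    and x: "x \<in> W"
  shows "jacobian_apply I K W (\<lambda>x. G (F x)) x v
    = jacobian_apply J K V G (F x) (jacobian_apply I J W F x v)"
proof -
  have Fext: "restrict (F y) J = F y" if "y \<in> W" for y
    using F that by (auto simp: smooth_vec_open_def intro!: PiE_restrict)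
  have "pdv W i (\<lambda>y. G (F y) k) x = (\<Sum>j\<in>J. pdv V j (\<lambda>y. G y k) (F x) * pdv W i (\<lambda>y. F y j) x)"
    if i: "i \<in> I" and k: "k \<in> K" for i k
  proof (rule pdv_eqI[OF assms(1) thick_open[OF assms(1,2) x] i assms(2) x,
        where g="\<lambda>y. G (restrict (F y) J) k"])
    show "((\<lambda>t. G (restrict (F (x(i := t))) J) k) has_real_derivative
      (\<Sum>j\<in>J. pdv V j (\<lambda>y. G y k) (F x) * pdv W i (\<lambda>y. F y j) x)) (at (x i))"
    proof -
      have "((\<lambda>t. G (restrict (F (x(i := t))) J) k) has_real_derivative
        (\<Sum>j\<in>J. pdv V j (\<lambda>y. G y k) (restrict (F (x(i := x i))) J) * pdv W i (\<lambda>y. F y j) x)) (at (x i))"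
      proof (rule has_derivative_along_curve[OF assms(3,4), where f="\<lambda>y. G y k"])
        show "restrict (F (x(i := x i))) J \<in> V" using FV[OF x] Fext[OF x] by simp
        show "((\<lambda>t. restrict (F (x(i := t))) J j) has_real_derivative pdv W i (\<lambda>y. F y j) x) (at (x i))"
          if "j \<in> J" for j
          using smooth_on_open_has_pdv[OF assms(1,2) _ i x, of "\<lambda>y. F y j"] F that
          by (simp add: smooth_vec_open_def)
        show "((\<lambda>s. G (y(j := s)) k) has_real_derivative pdv V j (\<lambda>y. G y k) y) (at (y j))"
          if "j \<in> J" "y \<in> V" for j y
          using smooth_on_open_has_pdv[OF assms(3,4) _ that, of "\<lambda>y. G y k"] G k
          by (simp add: smooth_vec_open_def)
        show "continuous_map (subtopology (powertop_real J) V) euclideanreal (pdv V j (\<lambda>y. G y k))"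
          if "j \<in> J" for j
          using smooth_on_open_pdv[OF assms(3,4) _ that, of "\<lambda>y. G y k"] G k
          by (simp add: smooth_vec_open_def smooth_on_open_continuous)
      qed auto
      then show ?thesis using Fext[OF x] by (simp only: fun_upd_triv)
    qed
  qed (use Fext x in auto)
  then have "(\<Sum>i\<in>I. pdv W i (\<lambda>y. G (F y) k) x * v i)
      = (\<Sum>i\<in>I. \<Sum>j\<in>J. pdv V j (\<lambda>y. G y k) (F x) * (pdv W i (\<lambda>y. F y j) x * v i))" if "k \<in> K" for k
    using that by (simp add: sum_distrib_right mult.assoc)
  moreover have "(\<Sum>i\<in>I. \<Sum>j\<in>J. pdv V j (\<lambda>y. G y k) (F x) * (pdv W i (\<lambda>y. F y j) x * v i))
      = (\<Sum>j\<in>J. pdv V j (\<lambda>y. G y k) (F x) * (\<Sum>i\<in>I. pdv W i (\<lambda>y. F y j) x * v i))" for k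
    by (subst sum.swap) (simp add: sum_distrib_left)
  ultimately have "(\<Sum>i\<in>I. pdv W i (\<lambda>y. G (F y) k) x * v i)
      = (\<Sum>j\<in>J. pdv V j (\<lambda>y. G y k) (F x) * (\<Sum>i\<in>I. pdv W i (\<lambda>y. F y j) x * v i))" if "k \<in> K" for k
    using that by simp
  then show ?thesis by (auto simp: jacobian_apply_def intro!: restrict_ext)
qed

text \<open>In the application \<open>A\<close>, \<open>B\<close> and \<open>C\<close> are domains
  of coordinate expressions for three pairs of charts, and \<open>C\<close> may contain points that
  \<open>f\<close> moves out of the middle chart. Hence \<open>h\<close> is compared with the
  composite on \<open>W0\<close> only, and all Jacobians are computed on open sets from the
  extensions \<open>F\<close> and \<open>G\<close>.\<close>

lemma jacobian_apply_compose:
  assumes fin: "finite I" "finite J" "finite K" and ext: "A \<subseteq> I \<rightarrow>\<^sub>E UNIV" "B \<subseteq> J \<rightarrow>\<^sub>E UNIV"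
    and f: "smooth_vec_on I J A f" and g: "smooth_vec_on J K B g"
    and x: "x \<in> A" "f x \<in> B" "x \<in> C"
    and thick: "thick I A x" "thick J B (f x)" "thick I C x"
    and W0: "openin (powertop_real I) W0" "x \<in> W0"
    and h: "\<And>y. y \<in> C \<Longrightarrow> y \<in> W0 \<Longrightarrow> y \<in> A \<and> f y \<in> B \<and> h y = g (f y)"
  shows "jacobian_apply I K C h x v = jacobian_apply J K B g (f x) (jacobian_apply I J A f x v)"
proof -
  obtain W F where W: "openin (powertop_real I) W" "x \<in> W" "smooth_vec_open I J W F"
    "\<And>y. y \<in> A \<Longrightarrow> y \<in> W \<Longrightarrow> f y = F y"
    using smooth_vec_onE[OF f fin(1,2) ext(1) x(1)] by metis
  obtain V G where V: "openin (powertop_real J) V" "f x \<in> V" "smooth_vec_open J K V G"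
    "\<And>y. y \<in> B \<Longrightarrow> y \<in> V \<Longrightarrow> g y = G y"
    using smooth_vec_onE[OF g fin(2,3) ext(2) x(2)] by metis
  define U where "U = {y \<in> W. F y \<in> V} \<inter> W0"
  have U: "openin (powertop_real I) U" unfolding U_def
    using smooth_vec_open_preimage[OF W(3,1) V(1)] W0 by blast
  have FU: "smooth_vec_open I J U F"
    by (rule smooth_vec_open_subset[OF W(3) fin(1) W(1) U]) (auto simp: U_def)
  have FUV: "F y \<in> V" if "y \<in> U" for y using that by (simp add: U_def)
  have xU: "x \<in> U" using W V x W0 by (simp add: U_def)
  have "jacobian_apply I K C h x v = jacobian_apply I K U (\<lambda>x. G (F x)) x v"
  proof (rule jacobian_apply_extension[OF fin(1) thick(3) x(3) U xU])
    show "smooth_vec_open I K U (\<lambda>x. G (F x))"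
      by (rule smooth_vec_open_compose[OF fin(1) U fin(2) V(1) FU V(3) FUV])
    show "h y = G (F y)" if "y \<in> C" "y \<in> U" for y
      using h[of y] W(4)[of y] V(4)[of "f y"] that by (auto simp: U_def)
  qed
  also have "\<dots> = jacobian_apply J K V G (F x) (jacobian_apply I J U F x v)"
    by (rule jacobian_apply_compose_open[OF fin(1) U fin(2) V(1) FU V(3) FUV xU])
  also have "jacobian_apply I J U F x v = jacobian_apply I J A f x v"
    by (rule jacobian_apply_extension[OF fin(1) thick(1) x(1) U xU FU, symmetric])
      (use W(4) in \<open>auto simp: U_def\<close>)
  also have "jacobian_apply J K V G (F x) = jacobian_apply J K B g (f x)"
  proof
    show "jacobian_apply J K V G (F x) w = jacobian_apply J K B g (f x) w" for w
      using jacobian_apply_extension[OF fin(2) thick(2) x(2) V(1,2,3), of g w] V(4) W(2,4) x(1) by simp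
  qed
  finally show ?thesis .
qed

lemma jacobian_apply_coords:
  assumes "finite I" "A \<subseteq> I \<rightarrow>\<^sub>E UNIV" "\<And>j. j \<in> J \<Longrightarrow> \<sigma> j \<in> I" "thick I A x" "x \<in> A"
    and f: "\<And>y j. y \<in> A \<Longrightarrow> j \<in> J \<Longrightarrow> f y j = y (\<sigma> j)"
  shows "jacobian_apply I J A f x v = (\<lambda>j\<in>J. v (\<sigma> j))"
proof -
  have "pdv A i (\<lambda>y. f y j) x = (if i = \<sigma> j then 1 else 0)" if "i \<in> I" "j \<in> J" for i j
  proof (rule pdv_eqI[OF assms(1,4) that(1) openin_topspace, where g="\<lambda>y. y (\<sigma> j)"])
    show "((\<lambda>t. (x(i := t)) (\<sigma> j)) has_real_derivative (if i = \<sigma> j then 1 else 0)) (at (x i))"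
      by auto
  qed (use assms that in auto)
  then have "(\<Sum>i\<in>I. pdv A i (\<lambda>y. f y j) x * v i) = v (\<sigma> j)" if "j \<in> J" for j
    using that assms(1,3) by (simp add: if_distrib[of "\<lambda>z. z * _"] cong: if_cong)
  then show ?thesis by (auto simp: jacobian_apply_def intro!: restrict_ext)
qed

text \<open>The coordinate form of smoothness of the tangent map: \<open>Inl\<close> carries the
  base point, \<open>Inr\<close> the vector. After replacing \<open>f\<close> by a local extension,
  the fibre part is a sum of smooth partial derivatives times coordinates. Only the base part is
  confined to \<open>A\<close>, so vectors range over the full space even at a corner.\<close>

lemma smooth_vec_on_jacobian:
  assumes fin: "finite I" "finite J" and ext: "A \<subseteq> I \<rightarrow>\<^sub>E UNIV" and f: "smooth_vec_on I J A f"
    and thick: "\<And>x. x \<in> A \<Longrightarrow> thick I A x"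
  shows "smooth_vec_on (I <+> I) (J <+> J) {z \<in> (I <+> I) \<rightarrow>\<^sub>E UNIV. (\<lambda>i\<in>I. z (Inl i)) \<in> A}
    (\<lambda>z. \<lambda>k\<in>J <+> J. case_sum (f (\<lambda>i\<in>I. z (Inl i)))
       (jacobian_apply I J A f (\<lambda>i\<in>I. z (Inl i)) (\<lambda>i\<in>I. z (Inr i))) k)" (is "smooth_vec_on _ _ ?TA ?Tf")
proof (rule smooth_vec_onI)
  let ?\<pi> = "\<lambda>z::'a + 'a \<Rightarrow> real. \<lambda>i\<in>I. z (Inl i)"
  fix z0 assume z0: "z0 \<in> ?TA"
  obtain W F where W: "openin (powertop_real I) W" "?\<pi> z0 \<in> W" "smooth_vec_open I J W F"
    "\<And>y. y \<in> A \<Longrightarrow> y \<in> W \<Longrightarrow> f y = F y"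
    using smooth_vec_onE[OF f fin ext, of "?\<pi> z0"] z0 by auto
  have finI: "finite (I <+> I)" using fin by simp
  define T where "T = topspace (powertop_real (I <+> I))"
  have \<pi>: "smooth_vec_open (I <+> I) I T ?\<pi>"
    using smooth_on_open_coord[OF finI openin_topspace] unfolding T_def
    by (auto simp: smooth_vec_open_def)
  have T: "openin (powertop_real (I <+> I)) T" unfolding T_def by (rule openin_topspace)
  define U where "U = {z \<in> T. ?\<pi> z \<in> W}"
  have U: "openin (powertop_real (I <+> I)) U"
    unfolding U_def by (rule smooth_vec_open_preimage[OF \<pi> T W(1)])
  have \<pi>U: "smooth_vec_open (I <+> I) I U ?\<pi>"
    by (rule smooth_vec_open_subset[OF \<pi> finI T U]) (auto simp: U_def)
  define G where "G = (\<lambda>z. \<lambda>k\<in>J <+> J. case_sum (F (?\<pi> z))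
       (jacobian_apply I J W F (?\<pi> z) (\<lambda>i\<in>I. z (Inr i))) k)"
  have "smooth_on_open (I <+> I) U (\<lambda>z. G z k)" if "k \<in> J <+> J" for k
  proof (cases k)
    case (Inl j)
    then have j: "j \<in> J" using that by auto
    have "smooth_on_open (I <+> I) U (\<lambda>z. F (?\<pi> z) j)"
      by (rule smooth_on_open_compose[OF finI U fin(1) W(1), where f="\<lambda>y. F y j"])
        (use W(3) \<pi>U j in \<open>auto simp: smooth_vec_open_def U_def\<close>)
    then show ?thesis using Inl j by (simp add: G_def InlI)
  next
    case (Inr j)
    then have j: "j \<in> J" using that by auto
    have "smooth_on_open (I <+> I) U (\<lambda>z. pdv W i (\<lambda>y. F y j) (?\<pi> z))" if "i \<in> I" for i
      by (rule smooth_on_open_compose[OF finI U fin(1) W(1), where f="pdv W i (\<lambda>y. F y j)"])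
        (use W \<pi>U j that fin in \<open>auto simp: smooth_vec_open_def U_def intro!: smooth_on_open_pdv\<close>)
    then have "smooth_on_open (I <+> I) U (\<lambda>z. \<Sum>i\<in>I. pdv W i (\<lambda>y. F y j) (?\<pi> z) * z (Inr i))"
      using fin finI U by (auto intro!: smooth_on_open_sum smooth_on_open_mult smooth_on_open_coord)
    then show ?thesis using Inr j by (simp add: G_def jacobian_apply_def InrI)
  qed
  then have "smooth_vec_open (I <+> I) (J <+> J) U G" by (auto simp: smooth_vec_open_def G_def)
  moreover have "?Tf z = G z" if "z \<in> ?TA" "z \<in> U" for z
  proof -
    have "f (?\<pi> z) = F (?\<pi> z)" using W(4) that by (auto simp: U_def)
    moreover have "jacobian_apply I J A f (?\<pi> z) w = jacobian_apply I J W F (?\<pi> z) w" for w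
      by (rule jacobian_apply_extension[OF fin(1) thick _ W(1) _ W(3,4)]) (use that in \<open>auto simp: U_def\<close>)
    ultimately show ?thesis unfolding G_def by (intro restrict_ext) (simp split: sum.split)
  qed
  moreover have "z0 \<in> U" using z0 W by (simp add: U_def T_def)
  ultimately show "\<exists>W F. openin (powertop_real (I <+> I)) W \<and> z0 \<in> W \<and>
      smooth_vec_open (I <+> I) (J <+> J) W F \<and> (\<forall>y\<in>?TA \<inter> W. ?Tf y = F y)"
    using U by (intro exI[of _ U] exI[of _ G]) auto
qed auto

section \<open>Charts\<close>

lemma openin_powertop_reindex:
  assumes "openin (powertop_real J) W" "\<And>j. j \<in> J \<Longrightarrow> \<sigma> j \<in> I"
  shows "openin (powertop_real I) {x \<in> I \<rightarrow>\<^sub>E UNIV. (\<lambda>j\<in>J. x (\<sigma> j)) \<in> W}"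
proof -
  have "continuous_map (powertop_real I) (powertop_real J) (\<lambda>x. \<lambda>j\<in>J. x (\<sigma> j))"
    using assms(2) by (auto simp: continuous_map_componentwise intro: continuous_map_product_projection)
  from openin_continuous_map_preimage[OF this assms(1)] show ?thesis by simp
qed

lemma openin_subtopology_chain:
  assumes "openin (subtopology T S) A" "openin (subtopology T A) B" "A \<subseteq> S"
  shows "openin (subtopology T S) B"
proof -
  obtain U V where "openin T U" "A = U \<inter> S" "openin T V" "B = V \<inter> A"
    using assms by (auto simp: openin_subtopology)
  then show ?thesis by (auto simp: openin_subtopology intro!: exI[of _ "V \<inter> U"])
qed

context
  fixes T :: "'p topology" and c :: "('p, 'i) chart"
  assumes c: "is_chart T c"
begin

lemma chart_finite: "finite (cind c)" and chart_openin: "openin T (cdom c)"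
  using c by (auto simp: is_chart_def)

lemma chart_subset: "cdom c \<subseteq> topspace T"
  using chart_openin by (rule openin_subset)

lemma chart_homeomorphic:
  "homeomorphic_map (subtopology T (cdom c)) (subtopology (powertop_real (cind c)) (cmap c ` cdom c)) (cmap c)"
  using c by (auto simp: is_chart_def)

lemma chart_topspace: "topspace (subtopology T (cdom c)) = cdom c"
  using chart_subset by (auto simp: topspace_subtopology)

lemma chart_inj: "inj_on (cmap c) (cdom c)"
  using homeomorphic_imp_injective_map[OF chart_homeomorphic] by (simp only: chart_topspace)

lemma chart_image_ext: "cmap c ` cdom c \<subseteq> cind c \<rightarrow>\<^sub>E UNIV"
proof -
  have "cmap c ` cdom c = topspace (subtopology (powertop_real (cind c)) (cmap c ` cdom c))"
    using homeomorphic_imp_surjective_map[OF chart_homeomorphic] by (simp only: chart_topspace)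
  also have "\<dots> \<subseteq> topspace (powertop_real (cind c))"
    unfolding topspace_subtopology by (rule Int_lower1)
  finally show ?thesis by simp
qed

lemma chart_cmap_ext: "p \<in> cdom c \<Longrightarrow> cmap c p \<in> cind c \<rightarrow>\<^sub>E UNIV"
  using chart_image_ext by blast

lemma chart_open_image:
  assumes "openin T U" "U \<subseteq> cdom c"
  obtains W where "openin (powertop_real (cind c)) W" "cmap c ` U = W \<inter> cmap c ` cdom c"
proof -
  have "openin (subtopology T (cdom c)) U"
    using assms by (auto simp: openin_open_subtopology[OF chart_openin])
  then have "openin (subtopology (powertop_real (cind c)) (cmap c ` cdom c)) (cmap c ` U)"
    using homeomorphic_imp_open_map[OF chart_homeomorphic] by (auto simp: open_map_def)
  then show thesis using that by (auto simp: openin_subtopology)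
qed

lemma chart_open_preimage:
  assumes "openin (powertop_real (cind c)) W"
  shows "openin T {p \<in> cdom c. cmap c p \<in> W}"
proof -
  have cm: "continuous_map (subtopology T (cdom c)) (powertop_real (cind c)) (cmap c)"
    using homeomorphic_imp_continuous_map[OF chart_homeomorphic]
    by (simp add: continuous_map_in_subtopology)
  have "openin (subtopology T (cdom c)) {p \<in> cdom c. cmap c p \<in> W}"
    using openin_continuous_map_preimage[OF cm assms] unfolding chart_topspace .
  then show ?thesis by (simp add: openin_open_subtopology[OF chart_openin])
qed

text \<open>A relatively open subset of a sector contains a one-sided segment in every coordinate direction.\<close>
lemma chart_thick:
  assumes "openin T U" "U \<subseteq> cdom c" "p \<in> U"
  shows "thick (cind c) (cmap c ` U) (cmap c p)"
  unfolding thick_def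
proof
  fix i assume i: "i \<in> cind c"
  obtain K where K: "openin (subtopology (powertop_real (cind c)) (sector (cind c) K)) (cmap c ` cdom c)"
    using c by (auto simp: is_chart_def)
  obtain W where W: "openin (powertop_real (cind c)) W" "cmap c ` U = W \<inter> cmap c ` cdom c"
    using chart_open_image[OF assms(1,2)] by blast
  obtain V where V: "openin (powertop_real (cind c)) V" "cmap c ` cdom c = V \<inter> sector (cind c) K"
    using K by (auto simp: openin_subtopology)
  let ?x = "cmap c p" and ?S = "{t. (cmap c p)(i := t) \<in> cmap c ` U}"
  have x: "?x \<in> W \<inter> V" "?x \<in> sector (cind c) K" using assms(3) W(2) V(2) by auto
  have WV: "openin (powertop_real (cind c)) (W \<inter> V)" using W V by blast
  have "eventually (\<lambda>t. ?x(i := t) \<in> W \<inter> V) (nhds (?x i))"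
    by (rule eventually_upd[OF chart_finite WV x(1) i])
  then have "eventually (\<lambda>t. ?x(i := t) \<in> W \<inter> V) (at_right (?x i))"
    by (simp add: eventually_at_filter eventually_mono)
  moreover have "eventually (\<lambda>t. t > ?x i) (at_right (?x i))"
    by (rule eventually_at_right_less)
  ultimately have S: "eventually (\<lambda>t. t \<in> ?S) (at_right (?x i))"
  proof eventually_elim
    case (elim t)
    \<comment> \<open>A sector imposes only lower bounds, so increasing a coordinate never leaves
      it; hence the approach from the right.\<close>
    then have "?x(i := t) \<in> sector (cind c) K"
      using x(2) i by (auto simp: sector_def PiE_iff extensional_def)
    then show ?case using elim W(2) V(2) by auto
  qed
  show "at (?x i) within ?S \<noteq> bot"
  proof
    assume "at (?x i) within ?S = bot"
    then have "eventually (\<lambda>t. False) (at (?x i) within ?S)" by simp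
    then have "eventually (\<lambda>t. t \<noteq> ?x i \<longrightarrow> t \<notin> ?S) (nhds (?x i))"
      unfolding eventually_at_filter by (rule eventually_mono) blast
    then have "eventually (\<lambda>t. t \<notin> ?S) (at_right (?x i))"
      unfolding eventually_at_filter by (rule eventually_mono) blast
    with S have "eventually (\<lambda>t. False) (at_right (?x i))" by eventually_elim simp
    then show False by simp
  qed
qed

lemma local_rep_cmap: "p \<in> cdom c \<Longrightarrow> local_rep c d f (cmap c p) = cmap d (f p)"
  using chart_inj by (simp add: local_rep_def)

lemma cmap_in_local_dom: "p \<in> cdom c \<Longrightarrow> cmap c p \<in> local_dom c d f \<longleftrightarrow> f p \<in> cdom d"
  using chart_inj by (auto simp: local_dom_def inj_on_def)

lemma local_dom_ext: "local_dom c d f \<subseteq> cind c \<rightarrow>\<^sub>E UNIV"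
  using chart_image_ext by (auto simp: local_dom_def)

end

lemma local_smooth_cong:
  assumes "is_chart T c" "\<And>p. p \<in> cdom c \<Longrightarrow> f p = g p"
  shows "local_smooth c d f \<longleftrightarrow> local_smooth c d g"
proof -
  have dom: "local_dom c d f = local_dom c d g" using assms(2) by (auto simp: local_dom_def)
  have rep: "local_rep c d f x = local_rep c d g x" if x: "x \<in> local_dom c d g" for x
  proof -
    obtain p where "p \<in> cdom c" "x = cmap c p" using x by (auto simp: local_dom_def)
    then show ?thesis using assms(2) by (simp add: local_rep_cmap[OF assms(1)])
  qed
  show ?thesis unfolding local_smooth_def dom
    using rep smooth_vec_on_cong by metis
qed

section \<open>Smooth maps between atlases\<close>

text \<open>The part of being a manifold that is inherited by products, sums and tangent bundles for purely
  local reasons.\<close>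
definition premfd :: "('p, 'i) mfd \<Rightarrow> bool" where
  "premfd M \<longleftrightarrow> (\<forall>c\<in>atlas M. is_chart (mtop M) c) \<and> (\<Union>c\<in>atlas M. cdom c) = points M \<and>
     (\<forall>c\<in>atlas M. \<forall>d\<in>atlas M. local_smooth c d (\<lambda>p. p))"

lemma manifold_premfd: "manifold M \<Longrightarrow> premfd M"
  by (simp add: manifold_def premfd_def)

lemma premfd_chart: "premfd M \<Longrightarrow> c \<in> atlas M \<Longrightarrow> is_chart (mtop M) c"
  by (simp add: premfd_def)

lemma premfd_chart_at:
  assumes "premfd M" "p \<in> points M"
  obtains c where "c \<in> atlas M" "p \<in> cdom c"
  using assms unfolding premfd_def by blast

lemma premfd_cdom: "premfd M \<Longrightarrow> c \<in> atlas M \<Longrightarrow> p \<in> cdom c \<Longrightarrow> p \<in> points M"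
  by (auto simp: premfd_def)

text \<open>Smooth maps without the extensionality convention.\<close>
definition smap :: "('p, 'i) mfd \<Rightarrow> ('q, 'j) mfd \<Rightarrow> ('p \<Rightarrow> 'q) \<Rightarrow> bool" where
  "smap M N f \<longleftrightarrow> continuous_map (mtop M) (mtop N) f \<and>
     (\<forall>c\<in>atlas M. \<forall>d\<in>atlas N. local_smooth c d f)"

lemma smap_points: "smap M N f \<Longrightarrow> p \<in> points M \<Longrightarrow> f p \<in> points N"
  using continuous_map_image_subset_topspace by (fastforce simp: smap_def)

lemma smooth_maps_iff: "f \<in> smooth_maps M N \<longleftrightarrow> smap M N f \<and> f \<in> extensional (points M)"
  using smap_points[of M N f] unfolding smooth_maps_def smap_def PiE_iff by blast

lemma smap_cong:
  assumes "premfd M" "smap M N f" "\<And>p. p \<in> points M \<Longrightarrow> f p = g p"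
  shows "smap M N g"
  unfolding smap_def
proof (intro conjI ballI)
  show "continuous_map (mtop M) (mtop N) g"
    using assms by (auto simp: smap_def intro: continuous_map_eq)
  show "local_smooth c d g" if "c \<in> atlas M" "d \<in> atlas N" for c d
    using local_smooth_cong[OF premfd_chart[OF assms(1) that(1)], of f g] assms that
    by (auto simp: smap_def premfd_cdom)
qed

lemma smap_restrict: "premfd M \<Longrightarrow> smap M N f \<Longrightarrow> restrict f (points M) \<in> smooth_maps M N"
  unfolding smooth_maps_iff by (auto intro: smap_cong[of M N f])

text \<open>Makes the domain of a coordinate expression the chart image of an open set, which is
  what \<open>chart_thick\<close> requires for one-sided partial derivatives to be unique
  there.\<close>

lemma smap_local_open:
  assumes "premfd M" "premfd N" "smap M N f" "c \<in> atlas M" "d \<in> atlas N"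
  shows "openin (mtop M) {q \<in> cdom c. f q \<in> cdom d}"
proof -
  have "openin (mtop M) {q \<in> points M. f q \<in> cdom d}"
    using assms chart_openin[OF premfd_chart[OF assms(2,5)]]
    by (auto simp: smap_def intro: openin_continuous_map_preimage)
  moreover have "{q \<in> cdom c. f q \<in> cdom d} = cdom c \<inter> {q \<in> points M. f q \<in> cdom d}"
    using premfd_cdom[OF assms(1,4)] by auto
  ultimately show ?thesis using chart_openin[OF premfd_chart[OF assms(1,4)]] by auto
qed

lemma smap_id: "premfd M \<Longrightarrow> smap M M (\<lambda>p. p)"
  by (simp add: smap_def premfd_def)

text \<open>One well-chosen pair of charts around each point suffices: continuity is read off the
  coordinate expression there, and every other pair of charts is reached through the smooth
  coordinate changes of \<open>M\<close> and \<open>N\<close>. Canonical maps can thus be checked in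
  adapted charts alone.\<close>

lemma smapI:
  assumes M: "premfd M" and N: "premfd N"
    and ex: "\<And>p. p \<in> points M \<Longrightarrow> \<exists>c\<in>atlas M. \<exists>d\<in>atlas N. \<exists>U. openin (mtop M) U \<and> p \<in> U \<and>
      U \<subseteq> cdom c \<and> f ` U \<subseteq> cdom d \<and>
      smooth_vec_on (cind c) (cind d) (cmap c ` U) (local_rep c d f)"
  shows "smap M N f"
proof -
  have cont: "continuous_map (mtop M) (mtop N) f"
    unfolding continuous_map_def
  proof (intro conjI allI impI)
    show "f \<in> points M \<rightarrow> points N"
      using ex premfd_cdom[OF N] by blast
    fix V assume V: "openin (mtop N) V"
    show "openin (mtop M) {p \<in> points M. f p \<in> V}"
    proof (subst openin_subopen, intro ballI)
      fix p assume p: "p \<in> {p \<in> points M. f p \<in> V}"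
      then obtain c d U where cd: "c \<in> atlas M" "d \<in> atlas N" and U: "openin (mtop M) U" "p \<in> U"
          "U \<subseteq> cdom c" "f ` U \<subseteq> cdom d" and sm: "smooth_vec_on (cind c) (cind d) (cmap c ` U) (local_rep c d f)"
        using ex by blast
      note C = premfd_chart[OF M cd(1)] and D = premfd_chart[OF N cd(2)]
      obtain O' where O': "openin (powertop_real (cind d)) O'"
          "cmap d ` (V \<inter> cdom d) = O' \<inter> cmap d ` cdom d"
        using chart_open_image[OF D openin_Int[OF V chart_openin[OF D]]] by blast
      let ?A = "cmap c ` U"
      have Aext: "?A \<subseteq> cind c \<rightarrow>\<^sub>E UNIV" using chart_image_ext[OF C] U(3) by blast
      have "continuous_map (subtopology (powertop_real (cind c)) ?A) (powertop_real (cind d)) (local_rep c d f)"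
        by (rule smooth_vec_on_continuous[OF sm chart_finite[OF C] chart_finite[OF D] Aext])
      from openin_continuous_map_preimage[OF this O'(1)]
      have "openin (subtopology (powertop_real (cind c)) ?A) {y \<in> ?A. local_rep c d f y \<in> O'}"
        using Aext by (simp add: Int_absorb1)
      then obtain W where W: "openin (powertop_real (cind c)) W"
          "{y \<in> ?A. local_rep c d f y \<in> O'} = W \<inter> ?A"
        by (auto simp: openin_subtopology)
      obtain W1 where W1: "openin (powertop_real (cind c)) W1" "?A = W1 \<inter> cmap c ` cdom c"
        using chart_open_image[OF C U(1,3)] by blast
      \<comment> \<open>\<open>W1\<close> records membership in \<open>U\<close>, and
        \<open>W\<close> records that the coordinate expression lands in the image of
        \<open>V\<close>; the chart preimage of both is the required neighbourhood.\<close>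
      let ?Q = "{q \<in> cdom c. cmap c q \<in> W \<inter> W1}"
      have Q: "openin (mtop M) ?Q"
        using chart_open_preimage[OF C openin_Int[OF W(1) W1(1)]] .
      have iff: "q \<in> ?Q \<longleftrightarrow> q \<in> U \<and> f q \<in> V" for q
      proof -
        have inU: "q \<in> U \<longleftrightarrow> cmap c q \<in> W1" if "q \<in> cdom c" for q
          using W1(2) chart_inj[OF C] that U(3) by (auto simp: inj_on_def set_eq_iff image_iff)
        have inV: "f q \<in> V \<longleftrightarrow> cmap d (f q) \<in> O'" if "f q \<in> cdom d"
        proof
          assume "f q \<in> V"
          then have "cmap d (f q) \<in> cmap d ` (V \<inter> cdom d)" using that by blast
          then show "cmap d (f q) \<in> O'" using O'(2) by blast
        next
          assume "cmap d (f q) \<in> O'"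
          then have "cmap d (f q) \<in> cmap d ` (V \<inter> cdom d)" using that O'(2) by blast
          then show "f q \<in> V" using chart_inj[OF D] that by (auto simp: inj_on_def)
        qed
        have inW: "cmap c q \<in> W \<longleftrightarrow> cmap d (f q) \<in> O'" if "q \<in> U"
        proof -
          have "cmap c q \<in> ?A" "q \<in> cdom c" using that U(3) by auto
          moreover have "cmap c q \<in> W \<inter> ?A \<longleftrightarrow> cmap c q \<in> {y \<in> ?A. local_rep c d f y \<in> O'}"
            using W(2) by (simp only:)
          ultimately show ?thesis using local_rep_cmap[OF C \<open>q \<in> cdom c\<close>, of d f] by simp
        qed
        show ?thesis using inU inV inW U by blast
      qed
      show "\<exists>T. openin (mtop M) T \<and> p \<in> T \<and> T \<subseteq> {p \<in> points M. f p \<in> V}"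
      proof (intro exI conjI)
        show "openin (mtop M) ?Q" by (rule Q)
        show "p \<in> ?Q" using iff U(2) p by blast
        show "?Q \<subseteq> {p \<in> points M. f p \<in> V}" using iff premfd_cdom[OF M cd(1)] by blast
      qed
    qed
  qed
  have "local_smooth c' d' f" if c': "c' \<in> atlas M" and d': "d' \<in> atlas N" for c' d'
    unfolding local_smooth_def
  proof (rule smooth_vec_on_local)
    note C' = premfd_chart[OF M c'] and D' = premfd_chart[OF N d']
    show "finite (cind c')" by (rule chart_finite[OF C'])
    fix x assume "x \<in> local_dom c' d' f"
    then obtain p where p: "p \<in> cdom c'" "f p \<in> cdom d'" "x = cmap c' p" by (auto simp: local_dom_def)
    have "p \<in> points M" using premfd_cdom[OF M c' p(1)] .
    then obtain c d U where cd: "c \<in> atlas M" "d \<in> atlas N" and U: "openin (mtop M) U" "p \<in> U"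
          "U \<subseteq> cdom c" "f ` U \<subseteq> cdom d" and sm: "smooth_vec_on (cind c) (cind d) (cmap c ` U) (local_rep c d f)"
      using ex by blast
    note C = premfd_chart[OF M cd(1)] and D = premfd_chart[OF N cd(2)]
    define Q where "Q = U \<inter> cdom c' \<inter> {q \<in> points M. f q \<in> cdom d'}"
    have "openin (mtop M) Q"
      unfolding Q_def using U(1) chart_openin[OF C'] openin_continuous_map_preimage[OF cont chart_openin[OF D']]
      by blast
    then obtain W where W: "openin (powertop_real (cind c')) W" "cmap c' ` Q = W \<inter> cmap c' ` cdom c'"
      using chart_open_image[OF C', of Q] by (auto simp: Q_def)
    \<comment> \<open>On \<open>Q\<close> the expression in \<open>c'\<close> and \<open>d'\<close>
      factors into the change from \<open>c'\<close> to \<open>c\<close>, the given expression, and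
      the change from \<open>d\<close> to \<open>d'\<close>; \<open>s1\<close>, \<open>s2\<close>
      and \<open>s3\<close> build it up in this order.\<close>
    have s1: "smooth_vec_on (cind c') (cind c) (cmap c' ` Q) (local_rep c' c (\<lambda>p. p))"
    proof (rule smooth_vec_on_subset)
      show "smooth_vec_on (cind c') (cind c) (local_dom c' c (\<lambda>p. p)) (local_rep c' c (\<lambda>p. p))"
        using M c' cd by (simp add: premfd_def local_smooth_def)
      show "cmap c' ` Q \<subseteq> local_dom c' c (\<lambda>p. p)" using U(3) by (auto simp: Q_def local_dom_def)
    qed
    have s2: "smooth_vec_on (cind c') (cind d) (cmap c' ` Q) (\<lambda>x. local_rep c d f (local_rep c' c (\<lambda>p. p) x))"
    proof (rule smooth_vec_on_compose[OF chart_finite[OF C'] chart_finite[OF C] _ _ chart_finite[OF D] s1 sm])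
      show "local_rep c' c (\<lambda>p. p) x \<in> cmap c ` U" if "x \<in> cmap c' ` Q" for x
        using that local_rep_cmap[OF C'] by (auto simp: Q_def)
      show "cmap c' ` Q \<subseteq> cind c' \<rightarrow>\<^sub>E UNIV" using chart_image_ext[OF C'] by (auto simp: Q_def)
      show "cmap c ` U \<subseteq> cind c \<rightarrow>\<^sub>E UNIV" using chart_image_ext[OF C] U(3) by blast
    qed
    have rep: "local_rep c d f (local_rep c' c (\<lambda>p. p) (cmap c' q)) = cmap d (f q)" if "q \<in> Q" for q
      using that local_rep_cmap[OF C', of q c "\<lambda>p. p"] local_rep_cmap[OF C, of q d f] U(3)
      by (auto simp: Q_def)
    have s3: "smooth_vec_on (cind c') (cind d') (cmap c' ` Q)
        (\<lambda>x. local_rep d d' (\<lambda>p. p) (local_rep c d f (local_rep c' c (\<lambda>p. p) x)))"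
    proof (rule smooth_vec_on_compose[OF chart_finite[OF C'] chart_finite[OF D] _ _ chart_finite[OF D'] s2])
      show "smooth_vec_on (cind d) (cind d') (local_dom d d' (\<lambda>p. p)) (local_rep d d' (\<lambda>p. p))"
        using N d' cd by (simp add: premfd_def local_smooth_def)
      show "cmap c' ` Q \<subseteq> cind c' \<rightarrow>\<^sub>E UNIV" using chart_image_ext[OF C'] by (auto simp: Q_def)
      show "local_dom d d' (\<lambda>p. p) \<subseteq> cind d \<rightarrow>\<^sub>E UNIV" by (rule local_dom_ext[OF D])
      fix x assume "x \<in> cmap c' ` Q"
      then obtain q where q: "q \<in> Q" "x = cmap c' q" by auto
      then have "f q \<in> cdom d" "f q \<in> cdom d'" using U(4) by (auto simp: Q_def)
      then show "local_rep c d f (local_rep c' c (\<lambda>p. p) x) \<in> local_dom d d' (\<lambda>p. p)"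
        using rep[OF q(1)] q(2) cmap_in_local_dom[OF D, of "f q" d' "\<lambda>p. p"] by simp
    qed
    have "smooth_vec_on (cind c') (cind d') (local_dom c' d' f \<inter> W) (local_rep c' d' f)"
    proof (rule smooth_vec_on_cong[OF smooth_vec_on_subset[OF s3]])
      show sub: "local_dom c' d' f \<inter> W \<subseteq> cmap c' ` Q" using W(2) by (auto simp: local_dom_def)
      fix x assume "x \<in> local_dom c' d' f \<inter> W"
      then obtain q where q: "q \<in> Q" "x = cmap c' q" using sub by auto
      then have "f q \<in> cdom d" "q \<in> cdom c'" using U(4) by (auto simp: Q_def)
      then show "local_rep d d' (\<lambda>p. p) (local_rep c d f (local_rep c' c (\<lambda>p. p) x)) = local_rep c' d' f x"
        using rep[OF q(1)] q(2) local_rep_cmap[OF D, of "f q" d' "\<lambda>p. p"] local_rep_cmap[OF C', of q d' f]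
        by simp
    qed
    moreover have "x \<in> W" using W(2) p U(2) \<open>p \<in> points M\<close> by (auto simp: Q_def)
    ultimately show "\<exists>W. openin (powertop_real (cind c')) W \<and> x \<in> W \<and>
        smooth_vec_on (cind c') (cind d') (local_dom c' d' f \<inter> W) (local_rep c' d' f)"
      using W(1) by blast
  qed
  then show ?thesis using cont by (simp add: smap_def)
qed

text \<open>For given outer charts no single chart of \<open>N\<close> need cover the intermediate
  image, so the composite is checked near one point at a time, with a middle chart chosen
  there.\<close>

lemma smap_compose:
  assumes M: "premfd M" and N: "premfd N" and P: "premfd P" and f: "smap M N f" and g: "smap N P g"
  shows "smap M P (\<lambda>p. g (f p))"
proof (rule smapI[OF M P])
  fix p assume p: "p \<in> points M"
  obtain c where c: "c \<in> atlas M" "p \<in> cdom c" using premfd_chart_at[OF M p] .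
  obtain d where d: "d \<in> atlas N" "f p \<in> cdom d" using premfd_chart_at[OF N smap_points[OF f p]] .
  obtain e where e: "e \<in> atlas P" "g (f p) \<in> cdom e"
    using premfd_chart_at[OF P smap_points[OF g smap_points[OF f p]]] .
  note C = premfd_chart[OF M c(1)] and D = premfd_chart[OF N d(1)] and E = premfd_chart[OF P e(1)]
  define U where "U = {q \<in> cdom c. f q \<in> cdom d \<and> g (f q) \<in> cdom e}"
  have "continuous_map (mtop M) (mtop N) f" using f by (simp add: smap_def)
  from openin_continuous_map_preimage[OF this smap_local_open[OF N P g d(1) e(1)]]
  have "openin (mtop M) (cdom c \<inter> {q \<in> points M. f q \<in> {q \<in> cdom d. g q \<in> cdom e}})"
    using chart_openin[OF C] by blast
  moreover have "U = cdom c \<inter> {q \<in> points M. f q \<in> {q \<in> cdom d. g q \<in> cdom e}}"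
    using premfd_cdom[OF M c(1)] by (auto simp: U_def)
  ultimately have U: "openin (mtop M) U" by simp
  have "smooth_vec_on (cind c) (cind e) (cmap c ` U) (\<lambda>x. local_rep d e g (local_rep c d f x))"
  proof (rule smooth_vec_on_compose[OF chart_finite[OF C] chart_finite[OF D] _ local_dom_ext[OF D] chart_finite[OF E]])
    show "cmap c ` U \<subseteq> cind c \<rightarrow>\<^sub>E UNIV" using chart_image_ext[OF C] by (auto simp: U_def)
    have "smooth_vec_on (cind c) (cind d) (local_dom c d f) (local_rep c d f)"
      using f c d by (auto simp: smap_def local_smooth_def)
    then show "smooth_vec_on (cind c) (cind d) (cmap c ` U) (local_rep c d f)"
      by (rule smooth_vec_on_subset) (auto simp: U_def local_dom_def)
    show "smooth_vec_on (cind d) (cind e) (local_dom d e g) (local_rep d e g)"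
      using g d e by (auto simp: smap_def local_smooth_def)
    show "local_rep c d f x \<in> local_dom d e g" if "x \<in> cmap c ` U" for x
      using that local_rep_cmap[OF C, of _ d f] by (auto simp: U_def local_dom_def)
  qed
  then have "smooth_vec_on (cind c) (cind e) (cmap c ` U) (local_rep c e (\<lambda>p. g (f p)))"
    by (rule smooth_vec_on_cong)
      (auto simp: U_def local_rep_cmap[OF C] local_rep_cmap[OF D])
  then show "\<exists>c\<in>atlas M. \<exists>d\<in>atlas P. \<exists>U. openin (mtop M) U \<and> p \<in> U \<and> U \<subseteq> cdom c \<and>
      (\<lambda>p. g (f p)) ` U \<subseteq> cdom d \<and> smooth_vec_on (cind c) (cind d) (cmap c ` U) (local_rep c d (\<lambda>p. g (f p)))"
    using c d e U by (intro bexI[of _ c] bexI[of _ e] exI[of _ U]) (auto simp: U_def)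
qed

text \<open>With \<open>f\<close> or \<open>g\<close> the identity this describes changes of charts.\<close>
lemma local_deriv_compose:
  assumes M: "premfd M" and N: "premfd N" and P: "premfd P" and f: "smap M N f" and g: "smap N P g"
    and h: "\<And>q. q \<in> points M \<Longrightarrow> h q = g (f q)"
    and cde: "c \<in> atlas M" "d \<in> atlas N" "e \<in> atlas P"
    and p: "p \<in> cdom c" "f p \<in> cdom d" "h p \<in> cdom e"
  shows "local_deriv c e h p v = local_deriv d e g (f p) (local_deriv c d f p v)"
proof -
  note C = premfd_chart[OF M cde(1)] and D = premfd_chart[OF N cde(2)] and E = premfd_chart[OF P cde(3)]
  have pM: "p \<in> points M" using premfd_cdom[OF M cde(1) p(1)] .
  have sh: "smap M P h"
    by (rule smap_cong[OF M smap_compose[OF M N P f g]]) (simp add: h)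
  obtain W where W: "openin (powertop_real (cind c)) W"
      "cmap c ` {q \<in> cdom c. f q \<in> cdom d} = W \<inter> cmap c ` cdom c"
    using chart_open_image[OF C smap_local_open[OF M N f cde(1,2)]] by blast
  have rep: "local_rep c d f (cmap c q) = cmap d (f q)" if "q \<in> cdom c" for q
    using local_rep_cmap[OF C that] .
  have th: "thick (cind c) (local_dom c d f) (cmap c p)" "thick (cind d) (local_dom d e g) (cmap d (f p))"
    "thick (cind c) (local_dom c e h) (cmap c p)"
    unfolding local_dom_def using p h[OF pM]
    by (auto intro!: chart_thick[OF C smap_local_open[OF M N f cde(1,2)]]
        chart_thick[OF D smap_local_open[OF N P g cde(2,3)]]
        chart_thick[OF C smap_local_open[OF M P sh cde(1,3)]])
  have "jacobian_apply (cind c) (cind e) (local_dom c e h) (local_rep c e h) (cmap c p) v =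
    jacobian_apply (cind d) (cind e) (local_dom d e g) (local_rep d e g) (local_rep c d f (cmap c p))
      (jacobian_apply (cind c) (cind d) (local_dom c d f) (local_rep c d f) (cmap c p) v)"
  proof (rule jacobian_apply_compose[OF chart_finite[OF C] chart_finite[OF D] chart_finite[OF E]
        local_dom_ext[OF C] local_dom_ext[OF D]])
    show "smooth_vec_on (cind c) (cind d) (local_dom c d f) (local_rep c d f)"
      "smooth_vec_on (cind d) (cind e) (local_dom d e g) (local_rep d e g)"
      using f g cde by (auto simp: smap_def local_smooth_def)
    show "cmap c p \<in> local_dom c d f" "cmap c p \<in> local_dom c e h"
      using p by (auto simp: local_dom_def)
    show "local_rep c d f (cmap c p) \<in> local_dom d e g"
      using p rep h[OF pM] by (auto simp: local_dom_def)
    show "thick (cind c) (local_dom c d f) (cmap c p)"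
      "thick (cind d) (local_dom d e g) (local_rep c d f (cmap c p))"
      "thick (cind c) (local_dom c e h) (cmap c p)" using th rep[OF p(1)] by simp_all
    show "openin (powertop_real (cind c)) W" by (rule W(1))
    show "cmap c p \<in> W" using W(2) p by blast
    show "y \<in> local_dom c d f \<and> local_rep c d f y \<in> local_dom d e g \<and>
        local_rep c e h y = local_rep d e g (local_rep c d f y)"
      if y: "y \<in> local_dom c e h" "y \<in> W" for y
    proof -
      obtain q where q: "q \<in> cdom c" "h q \<in> cdom e" "y = cmap c q" using y by (auto simp: local_dom_def)
      then have "y \<in> cmap c ` {q \<in> cdom c. f q \<in> cdom d}" using W(2) y by blast
      then have fq: "f q \<in> cdom d" using q chart_inj[OF C] by (auto simp: inj_on_def)
      have "h q = g (f q)" using h premfd_cdom[OF M cde(1) q(1)] by blast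
      then show ?thesis using q fq rep local_rep_cmap[OF C q(1), of e h] local_rep_cmap[OF D fq, of e g]
        by (auto simp: local_dom_def)
    qed
  qed
  then show ?thesis by (simp add: local_deriv_def rep[OF p(1)])
qed

lemma local_deriv_in: "local_deriv c d f p v \<in> cind d \<rightarrow>\<^sub>E UNIV"
  unfolding local_deriv_def by (rule jacobian_apply_in)

text \<open>Whenever a map selects coordinates, its Jacobian is the corresponding zero-one matrix.
  Applied to identities, with \<open>\<sigma>\<close> the identity, and to product projections, with
  \<open>\<sigma> i = (x, i)\<close>.\<close>

lemma local_deriv_coords:
  assumes M: "premfd M" and N: "premfd N" and f: "smap M N f" and cd: "c \<in> atlas M" "d \<in> atlas N"
    and \<sigma>: "\<And>j. j \<in> cind d \<Longrightarrow> \<sigma> j \<in> cind c"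
    and p: "p \<in> cdom c" "f p \<in> cdom d"
    and rep: "\<And>q j. q \<in> cdom c \<Longrightarrow> f q \<in> cdom d \<Longrightarrow> j \<in> cind d \<Longrightarrow> cmap d (f q) j = cmap c q (\<sigma> j)"
  shows "local_deriv c d f p v = (\<lambda>j\<in>cind d. v (\<sigma> j))"
  unfolding local_deriv_def
proof (rule jacobian_apply_coords)
  note C = premfd_chart[OF M cd(1)]
  show "finite (cind c)" by (rule chart_finite[OF C])
  show "local_dom c d f \<subseteq> cind c \<rightarrow>\<^sub>E UNIV" by (rule local_dom_ext[OF C])
  show "thick (cind c) (local_dom c d f) (cmap c p)"
    unfolding local_dom_def using p
    by (auto intro!: chart_thick[OF C smap_local_open[OF M N f cd]])
  show "cmap c p \<in> local_dom c d f" using p by (auto simp: local_dom_def)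
  show "local_rep c d f y j = y (\<sigma> j)" if "y \<in> local_dom c d f" "j \<in> cind d" for y j
    using that rep by (auto simp: local_dom_def local_rep_cmap[OF C])
qed (rule \<sigma>)

lemma local_deriv_id:
  assumes M: "premfd M" and c: "c \<in> atlas M" "p \<in> cdom c" and v: "v \<in> cind c \<rightarrow>\<^sub>E UNIV"
  shows "local_deriv c c (\<lambda>q. q) p v = v"
  using local_deriv_coords[OF M M smap_id[OF M] c(1) c(1), of "\<lambda>i. i" p v] c PiE_restrict[OF v] by simp

section \<open>The tangent bundle\<close>

lemma tangent_space_PiE:
  "v \<in> tangent_space M p \<Longrightarrow> v \<in> (\<Pi>\<^sub>E c\<in>{c \<in> atlas M. p \<in> cdom c}. cind c \<rightarrow>\<^sub>E UNIV)"
  unfolding tangent_space_def by (drule CollectD) (erule conjunct1)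

lemma tangent_space_coord:
  assumes "v \<in> tangent_space M p" "c \<in> atlas M" "p \<in> cdom c"
  shows "v c \<in> cind c \<rightarrow>\<^sub>E UNIV"
  by (rule PiE_mem[OF tangent_space_PiE[OF assms(1)]]) (simp add: assms)

lemma tangent_space_transition:
  assumes "v \<in> tangent_space M p" "c \<in> atlas M" "p \<in> cdom c" "d \<in> atlas M" "p \<in> cdom d"
  shows "v d = local_deriv c d (\<lambda>q. q) p (v c)"
  using CollectD[OF assms(1)[unfolded tangent_space_def], THEN conjunct2] assms(2-5) by blast

text \<open>The transition law makes every component a function of the one in
  \<open>c\<close>.\<close>

lemma tangent_space_eqI:
  assumes "v \<in> tangent_space M p" "w \<in> tangent_space M p" "c \<in> atlas M" "p \<in> cdom c" "v c = w c"
  shows "v = w"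
proof (rule PiE_ext)
  let ?D = "{d \<in> atlas M. p \<in> cdom d}"
  show "v \<in> (\<Pi>\<^sub>E c\<in>?D. cind c \<rightarrow>\<^sub>E UNIV)" "w \<in> (\<Pi>\<^sub>E c\<in>?D. cind c \<rightarrow>\<^sub>E UNIV)"
    by (rule assms(1,2)[THEN tangent_space_PiE])+
  show "v d = w d" if "d \<in> ?D" for d
    using that assms tangent_space_transition[OF assms(1,3,4), of d]
      tangent_space_transition[OF assms(2,3,4), of d] by simp
qed

text \<open>The fibre part of \<open>tangent_map\<close> with the chart \<open>c\<close> as an
  explicit argument. For \<open>f\<close> the identity it extends an arbitrary coordinate vector to
  a tangent vector.\<close>

definition push_coords :: "('p, 'i) chart \<Rightarrow> ('q, 'j) mfd \<Rightarrow> ('p \<Rightarrow> 'q) \<Rightarrow> 'p \<Rightarrow> ('i \<Rightarrow> real) \<Rightarrow>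
    ('q, 'j) chart \<Rightarrow> 'j \<Rightarrow> real" where
  "push_coords c N f p \<xi> = (\<lambda>d\<in>{d \<in> atlas N. f p \<in> cdom d}. local_deriv c d f p \<xi>)"

text \<open>The transition law is the chain rule for \<open>f\<close> followed by the identity of
  \<open>N\<close>, read in the charts \<open>c\<close>, \<open>d\<close> and
  \<open>e\<close>.\<close>

lemma push_coords_tangent:
  assumes M: "premfd M" and N: "premfd N" and f: "smap M N f" and c: "c \<in> atlas M" "p \<in> cdom c"
  shows "push_coords c N f p \<xi> \<in> tangent_space N (f p)"
  unfolding tangent_space_def
proof (intro CollectI conjI ballI impI)
  show "push_coords c N f p \<xi> \<in> (\<Pi>\<^sub>E d\<in>{d \<in> atlas N. f p \<in> cdom d}. cind d \<rightarrow>\<^sub>E UNIV)"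
    unfolding push_coords_def by (intro restrict_PiE_iff[THEN iffD2] ballI local_deriv_in)
  fix d e assume de: "d \<in> atlas N" "e \<in> atlas N" "f p \<in> cdom d \<and> f p \<in> cdom e"
  then show "push_coords c N f p \<xi> e = local_deriv d e (\<lambda>q. q) (f p) (push_coords c N f p \<xi> d)"
    using local_deriv_compose[OF M N N f smap_id[OF N] _ c(1) de(1,2) c(2), of f \<xi>]
    by (simp add: push_coords_def)
qed

lemma push_coords_id:
  assumes "premfd M" "c \<in> atlas M" "p \<in> cdom c" "\<xi> \<in> cind c \<rightarrow>\<^sub>E UNIV"
  shows "push_coords c M (\<lambda>q. q) p \<xi> c = \<xi>"
  using assms local_deriv_id by (simp add: push_coords_def)

section \<open>Points and coordinates of the tangent bundle\<close>

lemma topspace_tangent: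
  assumes "premfd M"
  shows "points (tangent_bundle M) = Sigma (points M) (tangent_space M)"
proof
  show "points (tangent_bundle M) \<subseteq> Sigma (points M) (tangent_space M)"
    by (auto simp: tangent_bundle_def topology_generated_by_topspace tangent_chart_def)
  show "Sigma (points M) (tangent_space M) \<subseteq> points (tangent_bundle M)"
  proof
    fix w assume w: "w \<in> Sigma (points M) (tangent_space M)"
    then have "fst w \<in> points M" by auto
    then obtain c where c: "c \<in> atlas M" "fst w \<in> cdom c"
      using premfd_chart_at[OF assms] by blast
    \<comment> \<open>The whole coordinate space is an admissible \<open>W\<close>, so each full
      chart domain is a generator.\<close>
    have "w \<in> {w \<in> cdom (tangent_chart M c). cmap (tangent_chart M c) w \<in> (cind c <+> cind c) \<rightarrow>\<^sub>E UNIV}"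
      using w c by (auto simp: tangent_chart_def)
    then show "w \<in> points (tangent_bundle M)"
      unfolding tangent_bundle_def using c(1) openin_powertop_ext
      by (simp add: topology_generated_by_topspace) blast
  qed
qed

lemma atlas_tangent: "atlas (tangent_bundle M) = tangent_chart M ` atlas M"
  by (simp add: tangent_bundle_def)

lemma cind_tangent_chart [simp]: "cind (tangent_chart M c) = cind c <+> cind c"
  by (simp add: tangent_chart_def)

lemma cdom_tangent_chart:
  "premfd M \<Longrightarrow> c \<in> atlas M \<Longrightarrow> w \<in> cdom (tangent_chart M c) \<longleftrightarrow> fst w \<in> cdom c \<and> snd w \<in> tangent_space M (fst w)"
  by (cases w) (auto simp: tangent_chart_def premfd_cdom)

lemma cmap_tangent_chart:
  "cmap (tangent_chart M c) w = (\<lambda>k\<in>cind c <+> cind c. case_sum (cmap c (fst w)) (snd w c) k)"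
  by (cases w) (auto simp: tangent_chart_def intro!: restrict_ext split: sum.split)

lemma cmap_tangent_chart_fst:
  assumes "premfd M" "c \<in> atlas M" "fst w \<in> cdom c"
  shows "(\<lambda>i\<in>cind c. cmap (tangent_chart M c) w (Inl i)) = cmap c (fst w)"
  using PiE_restrict[OF chart_cmap_ext[OF premfd_chart[OF assms(1,2)] assms(3)]]
  by (simp add: cmap_tangent_chart InlI cong: restrict_cong)

lemma cmap_tangent_chart_snd:
  assumes "c \<in> atlas M" "fst w \<in> cdom c" "snd w \<in> tangent_space M (fst w)"
  shows "(\<lambda>i\<in>cind c. cmap (tangent_chart M c) w (Inr i)) = snd w c"
  using PiE_restrict[OF tangent_space_coord[OF assms(3,1,2)]]
  by (simp add: cmap_tangent_chart InrI cong: restrict_cong)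

lemma tangent_chart_inj:
  assumes M: "premfd M" and c: "c \<in> atlas M"
  shows "inj_on (cmap (tangent_chart M c)) (cdom (tangent_chart M c))"
proof (rule inj_onI)
  fix w w' assume w: "w \<in> cdom (tangent_chart M c)" "w' \<in> cdom (tangent_chart M c)"
    and eq: "cmap (tangent_chart M c) w = cmap (tangent_chart M c) w'"
  have W: "fst w \<in> cdom c" "snd w \<in> tangent_space M (fst w)"
    "fst w' \<in> cdom c" "snd w' \<in> tangent_space M (fst w')"
    using w by (auto simp: cdom_tangent_chart[OF M c])
  have "cmap c (fst w) = cmap c (fst w')"
    using cmap_tangent_chart_fst[OF M c W(1)] cmap_tangent_chart_fst[OF M c W(3)] eq by simp
  then have 1: "fst w = fst w'"
    using chart_inj[OF premfd_chart[OF M c]] W by (auto simp: inj_on_def)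
  have "snd w c = snd w' c"
    using cmap_tangent_chart_snd[OF c W(1,2)] cmap_tangent_chart_snd[OF c W(3,4)] eq by simp
  then have "snd w = snd w'"
    using tangent_space_eqI[OF W(2) _ c W(1)] W(4) 1 by simp
  with 1 show "w = w'" by (simp add: prod_eq_iff)
qed

lemma tangent_chart_image:
  assumes M: "premfd M" and c: "c \<in> atlas M" and U: "U \<subseteq> cdom c"
  shows "cmap (tangent_chart M c) ` {w \<in> cdom (tangent_chart M c). fst w \<in> U}
    = {z \<in> (cind c <+> cind c) \<rightarrow>\<^sub>E UNIV. (\<lambda>i\<in>cind c. z (Inl i)) \<in> cmap c ` U}" (is "?L = ?R")
proof
  show "?L \<subseteq> ?R"
  proof
    fix z assume "z \<in> ?L"
    then obtain w where w: "w \<in> cdom (tangent_chart M c)" "fst w \<in> U" "z = cmap (tangent_chart M c) w" by auto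
    have "fst w \<in> cdom c" using w(1) by (simp add: cdom_tangent_chart[OF M c])
    then have "(\<lambda>i\<in>cind c. z (Inl i)) = cmap c (fst w)"
      using cmap_tangent_chart_fst[OF M c] w(3) by simp
    moreover have "z \<in> (cind c <+> cind c) \<rightarrow>\<^sub>E UNIV" unfolding w(3) cmap_tangent_chart by simp
    ultimately show "z \<in> ?R" using w(2) by simp
  qed
  show "?R \<subseteq> ?L"
  proof
    fix z assume z: "z \<in> ?R"
    then obtain p where p: "p \<in> U" "(\<lambda>i\<in>cind c. z (Inl i)) = cmap c p" by auto
    then have pc: "p \<in> cdom c" using U by auto
    \<comment> \<open>A prescribed fibre vector is realised by transporting it to all charts through
      the identity.\<close>
    define w where "w = (p, push_coords c M (\<lambda>q. q) p (\<lambda>i\<in>cind c. z (Inr i)))"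
    have "w \<in> cdom (tangent_chart M c)"
      using push_coords_tangent[OF M M smap_id[OF M] c pc] pc by (simp add: w_def cdom_tangent_chart[OF M c])
    moreover have "cmap (tangent_chart M c) w = z"
    proof (rule PiE_ext)
      show "cmap (tangent_chart M c) w \<in> (cind c <+> cind c) \<rightarrow>\<^sub>E UNIV"
        unfolding cmap_tangent_chart by simp
      show "z \<in> (cind c <+> cind c) \<rightarrow>\<^sub>E UNIV" using z by simp
      have s: "snd w c = (\<lambda>i\<in>cind c. z (Inr i))"
        unfolding w_def using push_coords_id[OF M c pc] by simp
      show "cmap (tangent_chart M c) w k = z k" if "k \<in> cind c <+> cind c" for k
        using that fun_cong[OF p(2)] s
        by (auto simp: cmap_tangent_chart w_def[THEN arg_cong[of _ _ fst]] InlI InrI split: if_splits)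
          (metis restrict_apply')
    qed
    ultimately show "z \<in> ?L" using p(1) by (auto simp: w_def intro!: image_eqI[of _ _ w])
  qed
qed

section \<open>The tangent map and its functoriality\<close>

lemma tangent_map_eq:
  assumes M: "premfd M" and N: "premfd N" and f: "smap M N f" and w: "w \<in> points (tangent_bundle M)"
    and c: "c \<in> atlas M" "fst w \<in> cdom c"
  shows "tangent_map M N f w = (f (fst w), push_coords c N f (fst w) (snd w c))"
proof -
  define c' where "c' = (SOME c. c \<in> atlas M \<and> fst w \<in> cdom c)"
  have c': "c' \<in> atlas M" "fst w \<in> cdom c'"
    using someI[of "\<lambda>c. c \<in> atlas M \<and> fst w \<in> cdom c" c] c by (auto simp: c'_def)
  have sw: "snd w \<in> tangent_space M (fst w)" using w by (auto simp: topspace_tangent[OF M])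
  \<comment> \<open>Independence of the chart picked by \<open>SOME\<close>: the chain rule for the
    identity followed by \<open>f\<close>, combined with the transition law for
    \<open>snd w\<close>.\<close>
  have "local_deriv c' d f (fst w) (snd w c') = local_deriv c d f (fst w) (snd w c)"
    if "d \<in> atlas N" "f (fst w) \<in> cdom d" for d
    using local_deriv_compose[OF M M N smap_id[OF M] f refl c(1) c'(1) that(1) c(2) c'(2) that(2)]
      tangent_space_transition[OF sw c c'] by simp
  then have "push_coords c' N f (fst w) (snd w c') = push_coords c N f (fst w) (snd w c)"
    unfolding push_coords_def by (intro restrict_ext) auto
  moreover have "tangent_map M N f w = (f (fst w), push_coords c' N f (fst w) (snd w c'))"
    using w by (simp add: tangent_map_def Let_def c'_def push_coords_def)
  ultimately show ?thesis by simp
qed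

lemma tangent_map_points:
  assumes M: "premfd M" and N: "premfd N" and f: "smap M N f" and w: "w \<in> points (tangent_bundle M)"
  shows "tangent_map M N f w \<in> points (tangent_bundle N)"
proof -
  have p: "fst w \<in> points M" using w by (auto simp: topspace_tangent[OF M])
  obtain c where c: "c \<in> atlas M" "fst w \<in> cdom c" using premfd_chart_at[OF M p] .
  show ?thesis
    using tangent_map_eq[OF M N f w c] push_coords_tangent[OF M N f c] smap_points[OF f p]
    by (simp add: topspace_tangent[OF N])
qed

lemma tangent_map_coord:
  assumes M: "premfd M" and N: "premfd N" and f: "smap M N f" and w: "w \<in> points (tangent_bundle M)"
    and c: "c \<in> atlas M" "fst w \<in> cdom c" and d: "d \<in> atlas N" "f (fst w) \<in> cdom d"
  shows "fst (tangent_map M N f w) = f (fst w)"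
    "snd (tangent_map M N f w) d = local_deriv c d f (fst w) (snd w c)"
  using tangent_map_eq[OF M N f w c] d by (simp_all add: push_coords_def)

lemma fst_tangent_map: "w \<in> points (tangent_bundle M) \<Longrightarrow> fst (tangent_map M N f w) = f (fst w)"
  by (simp add: tangent_map_def Let_def)

lemma tangent_points_fst: "premfd M \<Longrightarrow> w \<in> points (tangent_bundle M) \<Longrightarrow> fst w \<in> points M"
  by (auto simp: topspace_tangent)

lemma tangent_points_eqI:
  assumes M: "premfd M" and w: "w \<in> points (tangent_bundle M)" "w' \<in> points (tangent_bundle M)"
    and "fst w = fst w'" "c \<in> atlas M" "fst w \<in> cdom c" "snd w c = snd w' c"
  shows "w = w'"
  using assms tangent_space_eqI[of "snd w" M "fst w" "snd w'" c]
  by (auto simp: topspace_tangent[OF M])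

text \<open>\<open>h\<close> is kept separate from \<open>g \<circ> f\<close> because extensional
  maps agree with composites only on the points of \<open>M\<close>. Both sides lie over the same
  base point, so it suffices to compare them in one chart \<open>e\<close>, where the claim is the
  local chain rule.\<close>

lemma tangent_map_compose:
  assumes M: "premfd M" and N: "premfd N" and P: "premfd P" and f: "smap M N f" and g: "smap N P g"
    and h: "\<And>q. q \<in> points M \<Longrightarrow> h q = g (f q)" and w: "w \<in> points (tangent_bundle M)"
  shows "tangent_map M P h w = tangent_map N P g (tangent_map M N f w)"
proof -
  have sh: "smap M P h" by (rule smap_cong[OF M smap_compose[OF M N P f g]]) (simp add: h)
  have p: "fst w \<in> points M" using tangent_points_fst[OF M w] .
  have Tw: "tangent_map M N f w \<in> points (tangent_bundle N)" by (rule tangent_map_points[OF M N f w])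
  obtain c where c: "c \<in> atlas M" "fst w \<in> cdom c" using premfd_chart_at[OF M p] .
  obtain d where d: "d \<in> atlas N" "f (fst w) \<in> cdom d" using premfd_chart_at[OF N smap_points[OF f p]] .
  obtain e where e: "e \<in> atlas P" "h (fst w) \<in> cdom e" using premfd_chart_at[OF P smap_points[OF sh p]] .
  have hp: "h (fst w) = g (f (fst w))" using h[OF p] .
  have e': "g (fst (tangent_map M N f w)) \<in> cdom e" and d': "fst (tangent_map M N f w) \<in> cdom d"
    using e hp d by (simp_all add: fst_tangent_map[OF w])
  show ?thesis
  proof (rule tangent_points_eqI[OF P _ _ _ e(1)])
    show "tangent_map M P h w \<in> points (tangent_bundle P)" by (rule tangent_map_points[OF M P sh w])
    show "tangent_map N P g (tangent_map M N f w) \<in> points (tangent_bundle P)"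
      by (rule tangent_map_points[OF N P g Tw])
    show "fst (tangent_map M P h w) = fst (tangent_map N P g (tangent_map M N f w))"
      by (simp add: fst_tangent_map[OF w] fst_tangent_map[OF Tw] hp)
    show "fst (tangent_map M P h w) \<in> cdom e" using e by (simp add: fst_tangent_map[OF w])
    show "snd (tangent_map M P h w) e = snd (tangent_map N P g (tangent_map M N f w)) e"
      using tangent_map_coord(2)[OF M P sh w c e] tangent_map_coord(2)[OF N P g Tw d(1) d' e(1) e']
        tangent_map_coord(2)[OF M N f w c d] local_deriv_compose[OF M N P f g h c(1) d(1) e(1) c(2) d(2) e(2)]
      by (simp add: fst_tangent_map[OF w])
  qed
qed

lemma tangent_map_id:
  assumes M: "premfd M" and h: "\<And>q. q \<in> points M \<Longrightarrow> h q = q" and w: "w \<in> points (tangent_bundle M)"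
  shows "tangent_map M M h w = w"
proof -
  have sh: "smap M M h" by (rule smap_cong[OF M smap_id[OF M]]) (simp add: h)
  have p: "fst w \<in> points M" using tangent_points_fst[OF M w] .
  obtain c where c: "c \<in> atlas M" "fst w \<in> cdom c" using premfd_chart_at[OF M p] .
  have hc: "h (fst w) \<in> cdom c" using c h[OF p] by simp
  have sw: "snd w \<in> tangent_space M (fst w)" using w by (auto simp: topspace_tangent[OF M])
  show ?thesis
  proof (rule tangent_points_eqI[OF M tangent_map_points[OF M M sh w] w _ c(1)])
    show "fst (tangent_map M M h w) = fst w" "fst (tangent_map M M h w) \<in> cdom c"
      using h[OF p] c by (simp_all add: fst_tangent_map[OF w])
    \<comment> \<open>\<open>h\<close> is the identity only on the points of \<open>M\<close>, so it
      is factored there as identity after identity and the chain rule replaces it.\<close>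
    have "local_deriv c c h (fst w) (snd w c)
        = local_deriv c c (\<lambda>q. q) (fst w) (local_deriv c c (\<lambda>q. q) (fst w) (snd w c))"
      by (rule local_deriv_compose[OF M M M smap_id[OF M] smap_id[OF M] h c(1) c(1) c(1) c(2) c(2) hc])
    then show "snd (tangent_map M M h w) c = snd w c"
      using tangent_map_coord(2)[OF M M sh w c c(1) hc] local_deriv_id[OF M c tangent_space_coord[OF sw c]]
      by simp
  qed
qed

text \<open>In tangent charts the tangent map sends \<open>(x, v)\<close> to \<open>f x\<close> and
  the Jacobian applied to \<open>v\<close>, the map of \<open>smooth_vec_on_jacobian\<close>. With
  \<open>f\<close> the identity, both parts enter the proof that tangent charts are charts; hence
  only the injectivity and the images of tangent charts are used here.\<close>

lemma local_smooth_tangent_map: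
  assumes M: "premfd M" and N: "premfd N" and f: "smap M N f" and cd: "c \<in> atlas M" "d \<in> atlas N"
  shows "local_dom (tangent_chart M c) (tangent_chart N d) (tangent_map M N f) =
      {z \<in> (cind c <+> cind c) \<rightarrow>\<^sub>E UNIV. (\<lambda>i\<in>cind c. z (Inl i)) \<in> local_dom c d f}" (is "?LD = ?D")
    and "local_smooth (tangent_chart M c) (tangent_chart N d) (tangent_map M N f)"
proof -
  note C = premfd_chart[OF M cd(1)] and D = premfd_chart[OF N cd(2)]
  define U where "U = {q \<in> cdom c. f q \<in> cdom d}"
  have pts: "w \<in> points (tangent_bundle M)" if "w \<in> cdom (tangent_chart M c)" for w
    using that premfd_cdom[OF M cd(1)] by (auto simp: topspace_tangent[OF M] cdom_tangent_chart[OF M cd(1)] mem_Times_iff)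
      (metis SigmaI prod.collapse)
  \<comment> \<open>Tangent charts contain whole fibres, so membership is decided by the base
    point.\<close>
  have iff: "tangent_map M N f w \<in> cdom (tangent_chart N d) \<longleftrightarrow> fst w \<in> U"
    if w: "w \<in> cdom (tangent_chart M c)" for w
  proof -
    have "snd (tangent_map M N f w) \<in> tangent_space N (fst (tangent_map M N f w))"
      using tangent_map_points[OF M N f pts[OF w]] unfolding topspace_tangent[OF N] by auto
    then show ?thesis
      using w by (simp add: cdom_tangent_chart[OF N cd(2)] cdom_tangent_chart[OF M cd(1)] U_def
          fst_tangent_map[OF pts[OF w]])
  qed
  have "?LD = cmap (tangent_chart M c) ` {w \<in> cdom (tangent_chart M c). fst w \<in> U}"
    unfolding local_dom_def using iff by blast
  also have "\<dots> = {z \<in> (cind c <+> cind c) \<rightarrow>\<^sub>E UNIV. (\<lambda>i\<in>cind c. z (Inl i)) \<in> cmap c ` U}"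
    by (rule tangent_chart_image[OF M cd(1)]) (auto simp: U_def)
  also have "cmap c ` U = local_dom c d f" by (simp add: U_def local_dom_def)
  finally show LD: "?LD = ?D" .
  show "local_smooth (tangent_chart M c) (tangent_chart N d) (tangent_map M N f)"
    unfolding local_smooth_def LD cind_tangent_chart
  proof (rule smooth_vec_on_cong[OF smooth_vec_on_jacobian])
    show "finite (cind c)" "finite (cind d)" using chart_finite C D by blast+
    show "local_dom c d f \<subseteq> cind c \<rightarrow>\<^sub>E UNIV" by (rule local_dom_ext[OF C])
    show "smooth_vec_on (cind c) (cind d) (local_dom c d f) (local_rep c d f)"
      using f cd by (auto simp: smap_def local_smooth_def)
    show "thick (cind c) (local_dom c d f) x" if x: "x \<in> local_dom c d f" for x
      using x unfolding local_dom_def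
      by (auto intro!: chart_thick[OF C smap_local_open[OF M N f cd]])
    fix z assume "z \<in> ?D"
    then have "z \<in> ?LD" unfolding LD .
    then obtain w where w: "w \<in> cdom (tangent_chart M c)" "fst w \<in> U" "z = cmap (tangent_chart M c) w"
      unfolding local_dom_def using iff by blast
    have fw: "fst w \<in> cdom c" "f (fst w) \<in> cdom d" using w(2) by (auto simp: U_def)
    have sw: "snd w \<in> tangent_space M (fst w)" using w(1) by (simp add: cdom_tangent_chart[OF M cd(1)])
    have "local_rep (tangent_chart M c) (tangent_chart N d) (tangent_map M N f) z
        = cmap (tangent_chart N d) (tangent_map M N f w)"
      unfolding w(3) local_rep_def using tangent_chart_inj[OF M cd(1)] w(1) by simp
    also have "\<dots> = (\<lambda>k\<in>cind d <+> cind d. case_sum (cmap d (f (fst w))) (local_deriv c d f (fst w) (snd w c)) k)"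
      unfolding cmap_tangent_chart tangent_map_coord[OF M N f pts[OF w(1)] cd(1) fw(1) cd(2) fw(2)] ..
    also have "cmap d (f (fst w)) = local_rep c d f (\<lambda>i\<in>cind c. z (Inl i))"
      unfolding w(3) cmap_tangent_chart_fst[OF M cd(1) fw(1)] local_rep_cmap[OF C fw(1)] ..
    also have "local_deriv c d f (fst w) (snd w c) = jacobian_apply (cind c) (cind d) (local_dom c d f)
        (local_rep c d f) (\<lambda>i\<in>cind c. z (Inl i)) (\<lambda>i\<in>cind c. z (Inr i))"
      unfolding w(3) cmap_tangent_chart_fst[OF M cd(1) fw(1)] cmap_tangent_chart_snd[OF cd(1) fw(1) sw]
        local_deriv_def ..
    finally show "(\<lambda>k\<in>cind d <+> cind d. case k of Inl x \<Rightarrow> local_rep c d f (\<lambda>i\<in>cind c. z (Inl i)) x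
           | Inr x \<Rightarrow> jacobian_apply (cind c) (cind d) (local_dom c d f) (local_rep c d f)
                 (\<lambda>i\<in>cind c. z (Inl i)) (\<lambda>i\<in>cind c. z (Inr i)) x)
        = local_rep (tangent_chart M c) (tangent_chart N d) (tangent_map M N f) z" ..
  qed
qed

text \<open>The topology is generated by all tangent charts, so openness of the coordinate map of
  one of them has to be tested on generators coming from another chart \<open>d\<close>. There the
  claim becomes continuity of a coordinate change, which is the expression of the tangent map of the
  identity.\<close>

lemma tangent_chart_is_chart:
  assumes M: "premfd M" and c: "c \<in> atlas M"
  shows "is_chart (mtop (tangent_bundle M)) (tangent_chart M c)"
proof -
  note C = premfd_chart[OF M c]
  let ?T = "mtop (tangent_bundle M)" and ?c = "tangent_chart M c" and ?I = "cind c <+> cind c"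
  let ?\<pi> = "\<lambda>z. \<lambda>i\<in>cind c. z (Inl i)"
  define G where "G = {{w \<in> cdom (tangent_chart M c). cmap (tangent_chart M c) w \<in> W} | c W.
           c \<in> atlas M \<and> openin (powertop_real (cind c <+> cind c)) W}"
  have T: "?T = topology_generated_by G" by (simp add: tangent_bundle_def G_def)
  have ext: "cmap ?c w \<in> ?I \<rightarrow>\<^sub>E UNIV" for w by (simp add: cmap_tangent_chart)
  have im: "cmap ?c ` cdom ?c = {z \<in> ?I \<rightarrow>\<^sub>E UNIV. ?\<pi> z \<in> cmap c ` cdom c}"
  proof -
    have "{w \<in> cdom ?c. fst w \<in> cdom c} = cdom ?c" by (auto simp: cdom_tangent_chart[OF M c])
    then show ?thesis using tangent_chart_image[OF M c subset_refl] by simp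
  qed
  have gen: "openin ?T {w \<in> cdom ?c. cmap ?c w \<in> W}" if "openin (powertop_real ?I) W" for W
    unfolding T using that c by (intro topology_generated_by_Basis) (auto simp: G_def)
  have open_dom: "openin ?T (cdom ?c)"
    using gen[OF openin_powertop_ext] ext by simp
  have inj: "inj_on (cmap ?c) (cdom ?c)" by (rule tangent_chart_inj[OF M c])
  let ?Y = "subtopology (powertop_real ?I) (cmap ?c ` cdom ?c)"
  have basis: "openin ?Y (cmap ?c ` (S \<inter> cdom ?c))" if SG: "S \<in> G" for S
  proof -
    obtain d W where d: "d \<in> atlas M" and W: "openin (powertop_real (cind d <+> cind d)) W"
      and S: "S = {w \<in> cdom (tangent_chart M d). cmap (tangent_chart M d) w \<in> W}"
      using SG unfolding G_def by blast
    note D = premfd_chart[OF M d]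
    let ?d = "tangent_chart M d" and ?id = "tangent_map M M (\<lambda>q. q)"
    let ?LD = "local_dom ?c ?d ?id"
    have pts: "w \<in> points (tangent_bundle M)" if "w \<in> cdom ?c" for w
      using openin_subset[OF open_dom] that by blast
    have id: "?id w = w" if "w \<in> cdom ?c" for w
      by (rule tangent_map_id[OF M refl pts[OF that]])
    have LD: "?LD = {z \<in> ?I \<rightarrow>\<^sub>E UNIV. ?\<pi> z \<in> local_dom c d (\<lambda>q. q)}"
      and sm: "smooth_vec_on ?I (cind d <+> cind d) ?LD (local_rep ?c ?d ?id)"
      using local_smooth_tangent_map[OF M M smap_id[OF M] c d] by (simp_all add: local_smooth_def)
    have "openin (mtop M) {q \<in> cdom c. q \<in> cdom d}"
      by (rule smap_local_open[OF M M smap_id[OF M] c d])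
    then obtain W1 where W1: "openin (powertop_real (cind c)) W1"
        "cmap c ` {q \<in> cdom c. q \<in> cdom d} = W1 \<inter> cmap c ` cdom c"
      using chart_open_image[OF C] by blast
    have "?LD = {z \<in> ?I \<rightarrow>\<^sub>E UNIV. ?\<pi> z \<in> W1} \<inter> cmap ?c ` cdom ?c"
    proof -
      have ld: "local_dom c d (\<lambda>q. q) = W1 \<inter> cmap c ` cdom c" unfolding local_dom_def by (rule W1(2))
      show ?thesis unfolding LD im ld set_eq_iff Int_iff mem_Collect_eq
        by (intro allI iffI; elim conjE; intro conjI; assumption)
    qed
    moreover have "openin (powertop_real ?I) {z \<in> ?I \<rightarrow>\<^sub>E UNIV. ?\<pi> z \<in> W1}"
      by (rule openin_powertop_reindex[OF W1(1)]) auto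
    ultimately have LDo: "openin ?Y ?LD" unfolding openin_subtopology by blast
    have LDext: "?LD \<subseteq> ?I \<rightarrow>\<^sub>E UNIV" using LD by auto
    have "continuous_map (subtopology (powertop_real ?I) ?LD) (powertop_real (cind d <+> cind d))
        (local_rep ?c ?d ?id)"
      using smooth_vec_on_continuous[OF sm _ _ LDext] chart_finite[OF C] chart_finite[OF D] by simp
    from openin_continuous_map_preimage[OF this W]
    have "openin (subtopology (powertop_real ?I) ?LD) {z \<in> ?LD. local_rep ?c ?d ?id z \<in> W}"
      using LDext by (simp add: Int_absorb1)
    then have "openin ?Y {z \<in> ?LD. local_rep ?c ?d ?id z \<in> W}"
      by (rule openin_subtopology_chain[OF LDo]) (auto simp: local_dom_def)
    moreover have "{z \<in> ?LD. local_rep ?c ?d ?id z \<in> W} = cmap ?c ` (S \<inter> cdom ?c)"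
    proof -
      have "?LD = cmap ?c ` (cdom ?c \<inter> cdom ?d)"
        unfolding local_dom_def by (rule arg_cong[of _ _ "image (cmap ?c)"]) (use id in auto)
      moreover have "local_rep ?c ?d ?id (cmap ?c w) = cmap ?d w" if "w \<in> cdom ?c" for w
        unfolding local_rep_def using inj that id[OF that] by simp
      ultimately have "{z \<in> ?LD. local_rep ?c ?d ?id z \<in> W} = cmap ?c ` {w \<in> cdom ?c \<inter> cdom ?d. cmap ?d w \<in> W}"
        by auto
      also have "{w \<in> cdom ?c \<inter> cdom ?d. cmap ?d w \<in> W} = S \<inter> cdom ?c"
        unfolding S by blast
      finally show ?thesis .
    qed
    ultimately show ?thesis by simp
  qed
  \<comment> \<open>Images under an injective map commute with finite intersections, so openness
    passes from the generators to the generated topology.\<close>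
  have gen_open: "openin ?Y (cmap ?c ` (S \<inter> cdom ?c))" if "generate_topology_on G S" for S
    using that
  proof induction
    case (Int A B)
    have "cmap ?c ` ((A \<inter> B) \<inter> cdom ?c) = cmap ?c ` (A \<inter> cdom ?c) \<inter> cmap ?c ` (B \<inter> cdom ?c)"
      using inj by (auto simp: inj_on_def)
    then show ?case using openin_Int[OF Int.IH] by (simp only:)
  next
    case (UN K)
    have "cmap ?c ` (\<Union>K \<inter> cdom ?c) = (\<Union>k\<in>K. cmap ?c ` (k \<inter> cdom ?c))" by auto
    then show ?case using UN.IH by (auto intro!: openin_Union)
  qed (use basis in auto)
  have top_dom: "topspace (subtopology ?T (cdom ?c)) = cdom ?c"
    using openin_subset[OF open_dom] by auto
  have "homeomorphic_map (subtopology ?T (cdom ?c)) ?Y (cmap ?c)"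
  proof (rule bijective_open_imp_homeomorphic_map)
    show "continuous_map (subtopology ?T (cdom ?c)) ?Y (cmap ?c)"
      unfolding continuous_map_in_subtopology
    proof
      show "continuous_map (subtopology ?T (cdom ?c)) (powertop_real ?I) (cmap ?c)"
        unfolding continuous_map_def top_dom
      proof (intro conjI allI impI)
        show "cmap ?c \<in> cdom ?c \<rightarrow> topspace (powertop_real ?I)" using ext by simp
        show "openin (subtopology ?T (cdom ?c)) {w \<in> cdom ?c. cmap ?c w \<in> W}"
          if "openin (powertop_real ?I) W" for W
          unfolding openin_open_subtopology[OF open_dom] using gen[OF that] by auto
      qed
      show "cmap ?c \<in> topspace (subtopology ?T (cdom ?c)) \<rightarrow> cmap ?c ` cdom ?c" by auto
    qed
    show "open_map (subtopology ?T (cdom ?c)) ?Y (cmap ?c)"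
      unfolding open_map_def
    proof (intro allI impI)
      fix U assume "openin (subtopology ?T (cdom ?c)) U"
      then have "openin ?T U" "U \<subseteq> cdom ?c" by (auto simp: openin_open_subtopology[OF open_dom])
      then show "openin ?Y (cmap ?c ` U)"
        using gen_open[of U] unfolding T openin_topology_generated_by_iff by (simp add: Int_absorb2)
    qed
    show "cmap ?c ` topspace (subtopology ?T (cdom ?c)) = topspace ?Y"
      unfolding top_dom using ext by auto
    show "inj_on (cmap ?c) (topspace (subtopology ?T (cdom ?c)))" unfolding top_dom by (rule inj)
  qed
  moreover have "\<exists>K\<subseteq>?I. openin (subtopology (powertop_real ?I) (sector ?I K)) (cmap ?c ` cdom ?c)"
  proof -
    obtain K where K: "K \<subseteq> cind c"
        "openin (subtopology (powertop_real (cind c)) (sector (cind c) K)) (cmap c ` cdom c)"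
      using C by (auto simp: is_chart_def)
    then obtain W where W: "openin (powertop_real (cind c)) W" "cmap c ` cdom c = W \<inter> sector (cind c) K"
      by (auto simp: openin_subtopology)
    \<comment> \<open>Vectors are unconstrained even at corners: only the base coordinates with
      index \<open>Inl i\<close>, for \<open>i\<close> in \<open>K\<close>, carry
      inequalities.\<close>
    have eqv: "?\<pi> z \<in> sector (cind c) K \<longleftrightarrow> z \<in> sector ?I (Inl ` K)" if "z \<in> ?I \<rightarrow>\<^sub>E UNIV" for z
      using that K(1) by (auto simp: sector_def subset_iff)
    have sub: "z \<in> ?I \<rightarrow>\<^sub>E UNIV" if "z \<in> sector ?I (Inl ` K)" for z
      using that by (simp add: sector_def)
    have "cmap ?c ` cdom ?c = {z \<in> ?I \<rightarrow>\<^sub>E UNIV. ?\<pi> z \<in> W} \<inter> sector ?I (Inl ` K)"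
      unfolding im W(2) using eqv sub by blast
    moreover have "openin (powertop_real ?I) {z \<in> ?I \<rightarrow>\<^sub>E UNIV. ?\<pi> z \<in> W}"
      by (rule openin_powertop_reindex[OF W(1)]) auto
    ultimately have "openin (subtopology (powertop_real ?I) (sector ?I (Inl ` K))) (cmap ?c ` cdom ?c)"
      unfolding openin_subtopology by blast
    then show ?thesis using K(1) by (intro exI[of _ "Inl ` K"]) auto
  qed
  ultimately show ?thesis
    using open_dom chart_finite[OF C] by (simp add: is_chart_def)
qed

lemma premfd_tangent_bundle:
  assumes M: "premfd M"
  shows "premfd (tangent_bundle M)"
  unfolding premfd_def atlas_tangent
proof (intro conjI ballI)
  show "is_chart (mtop (tangent_bundle M)) c" if "c \<in> tangent_chart M ` atlas M" for c
    using that tangent_chart_is_chart[OF M] by blast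
  show "(\<Union>c\<in>tangent_chart M ` atlas M. cdom c) = points (tangent_bundle M)"
  proof
    show "(\<Union>c\<in>tangent_chart M ` atlas M. cdom c) \<subseteq> points (tangent_bundle M)"
      using chart_subset[OF tangent_chart_is_chart[OF M]] by blast
    show "points (tangent_bundle M) \<subseteq> (\<Union>c\<in>tangent_chart M ` atlas M. cdom c)"
    proof
      fix w assume w: "w \<in> points (tangent_bundle M)"
      obtain c where "c \<in> atlas M" "fst w \<in> cdom c"
        using premfd_chart_at[OF M tangent_points_fst[OF M w]] .
      then show "w \<in> (\<Union>c\<in>tangent_chart M ` atlas M. cdom c)"
        using w cdom_tangent_chart[OF M] by (auto simp: topspace_tangent[OF M])
    qed
  qed
  fix c' d' assume "c' \<in> tangent_chart M ` atlas M" "d' \<in> tangent_chart M ` atlas M"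
  then obtain c d where c: "c \<in> atlas M" "c' = tangent_chart M c" and d: "d \<in> atlas M" "d' = tangent_chart M d"
    by blast
  \<comment> \<open>The identity is viewed as the tangent map of the identity, whose coordinate
    expressions are known to be smooth.\<close>
  have "local_smooth c' d' (tangent_map M M (\<lambda>q. q))"
    unfolding c(2) d(2) by (rule local_smooth_tangent_map[OF M M smap_id[OF M] c(1) d(1)])
  moreover have "tangent_map M M (\<lambda>q. q) w = w" if "w \<in> cdom c'" for w
    using tangent_map_id[OF M refl] that chart_subset[OF tangent_chart_is_chart[OF M c(1)]] c(2) by blast
  ultimately show "local_smooth c' d' (\<lambda>p. p)"
    using local_smooth_cong[OF tangent_chart_is_chart[OF M c(1)], of "tangent_map M M (\<lambda>q. q)" "\<lambda>p. p" d'] c(2)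
    by simp
qed

lemma smap_tangent_proj:
  assumes M: "premfd M"
  shows "smap (tangent_bundle M) M fst"
proof (rule smapI[OF premfd_tangent_bundle[OF M] M])
  fix w assume w: "w \<in> points (tangent_bundle M)"
  obtain c where c: "c \<in> atlas M" "fst w \<in> cdom c"
    using premfd_chart_at[OF M tangent_points_fst[OF M w]] .
  let ?c = "tangent_chart M c"
  note C = tangent_chart_is_chart[OF M c(1)]
  have "smooth_vec_on (cind ?c) (cind c) (cmap ?c ` cdom ?c) (\<lambda>z. \<lambda>i\<in>cind c. z (Inl i))"
    using chart_finite[OF C] chart_image_ext[OF C] by (intro smooth_vec_on_coords) auto
  then have "smooth_vec_on (cind ?c) (cind c) (cmap ?c ` cdom ?c) (local_rep ?c c fst)"
  proof (rule smooth_vec_on_cong)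
    fix z assume "z \<in> cmap ?c ` cdom ?c"
    then obtain w where w: "w \<in> cdom ?c" "z = cmap ?c w" by blast
    then have "fst w \<in> cdom c" by (simp add: cdom_tangent_chart[OF M c(1)])
    then show "(\<lambda>i\<in>cind c. z (Inl i)) = local_rep ?c c fst z"
      unfolding w(2) local_rep_cmap[OF C w(1)] by (rule cmap_tangent_chart_fst[OF M c(1)])
  qed
  then show "\<exists>c\<in>atlas (tangent_bundle M). \<exists>d\<in>atlas M. \<exists>U. openin (mtop (tangent_bundle M)) U \<and>
      w \<in> U \<and> U \<subseteq> cdom c \<and> fst ` U \<subseteq> cdom d \<and>
      smooth_vec_on (cind c) (cind d) (cmap c ` U) (local_rep c d fst)"
    using w c chart_openin[OF C]
    by (intro bexI[of _ ?c] bexI[of _ c] exI[of _ "cdom ?c"])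
      (auto simp: cdom_tangent_chart[OF M c(1)] topspace_tangent[OF M] atlas_tangent)
qed

lemma smap_tangent_map:
  assumes M: "premfd M" and N: "premfd N" and f: "smap M N f"
  shows "smap (tangent_bundle M) (tangent_bundle N) (tangent_map M N f)"
proof (rule smapI[OF premfd_tangent_bundle[OF M] premfd_tangent_bundle[OF N]])
  fix w assume w: "w \<in> points (tangent_bundle M)"
  have p: "fst w \<in> points M" using tangent_points_fst[OF M w] .
  obtain c where c: "c \<in> atlas M" "fst w \<in> cdom c" using premfd_chart_at[OF M p] .
  obtain d where d: "d \<in> atlas N" "f (fst w) \<in> cdom d" using premfd_chart_at[OF N smap_points[OF f p]] .
  let ?c = "tangent_chart M c" and ?d = "tangent_chart N d"
  note C = tangent_chart_is_chart[OF M c(1)]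
  define U where "U = {w \<in> points (tangent_bundle M). fst w \<in> {q \<in> cdom c. f q \<in> cdom d}}"
  have U: "openin (mtop (tangent_bundle M)) U"
    unfolding U_def using smap_tangent_proj[OF M]
    by (intro openin_continuous_map_preimage[OF _ smap_local_open[OF M N f c(1) d(1)]]) (simp add: smap_def)
  have Uc: "U \<subseteq> cdom ?c" by (auto simp: U_def cdom_tangent_chart[OF M c(1)] topspace_tangent[OF M])
  have Ud: "tangent_map M N f ` U \<subseteq> cdom ?d"
  proof (rule image_subsetI)
    fix u assume "u \<in> U"
    then have u: "u \<in> points (tangent_bundle M)" "f (fst u) \<in> cdom d" by (auto simp: U_def)
    have "snd (tangent_map M N f u) \<in> tangent_space N (fst (tangent_map M N f u))"
      using tangent_map_points[OF M N f u(1)] unfolding topspace_tangent[OF N] by auto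
    then show "tangent_map M N f u \<in> cdom ?d"
      using u by (simp add: cdom_tangent_chart[OF N d(1)] fst_tangent_map)
  qed
  have "smooth_vec_on (cind ?c) (cind ?d) (cmap ?c ` U) (local_rep ?c ?d (tangent_map M N f))"
    using local_smooth_tangent_map(2)[OF M N f c(1) d(1)] unfolding local_smooth_def
    by (rule smooth_vec_on_subset) (use Uc Ud in \<open>auto simp: local_dom_def\<close>)
  then show "\<exists>c\<in>atlas (tangent_bundle M). \<exists>d\<in>atlas (tangent_bundle N). \<exists>U. openin (mtop (tangent_bundle M)) U \<and>
      w \<in> U \<and> U \<subseteq> cdom c \<and> tangent_map M N f ` U \<subseteq> cdom d \<and>
      smooth_vec_on (cind c) (cind d) (cmap c ` U) (local_rep c d (tangent_map M N f))"
    using U Uc Ud w c d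
    by (intro bexI[of _ ?c] bexI[of _ ?d] exI[of _ U]) (auto simp: U_def atlas_tangent)
qed

section \<open>Disjoint unions\<close>

lemma is_chart_sum_chart:
  assumes s: "s \<in> S" and c: "is_chart (mtop (M s)) c"
  shows "is_chart (mtop (sum_mfd S M)) (sum_chart s c)"
proof -
  let ?T = "mtop (sum_mfd S M)" and ?D = "{s} \<times> cdom c"
  have T: "?T = sum_topology (\<lambda>s. mtop (M s)) S" by (simp add: sum_mfd_def)
  have slice: "openin ?T (Pair s ` V)" if "openin (mtop (M s)) V" for V
    using open_map_component_injection[OF s, of "\<lambda>s. mtop (M s)"] that unfolding T open_map_def by blast
  have D: "openin ?T ?D"
  proof -
    have "Pair s ` cdom c = ?D" by auto
    then show ?thesis using slice[OF chart_openin[OF c]] by simp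
  qed
  have tD: "topspace (subtopology ?T ?D) = ?D"
    using openin_subset[OF D] by auto
  \<comment> \<open>On the slice of \<open>s\<close>, forgetting the label is a homeomorphism; the
    sum chart is \<open>c\<close> after it.\<close>
  have h: "homeomorphic_map (subtopology ?T ?D) (subtopology (mtop (M s)) (cdom c)) snd"
  proof (rule bijective_open_imp_homeomorphic_map)
    show "continuous_map (subtopology ?T ?D) (subtopology (mtop (M s)) (cdom c)) snd"
      unfolding continuous_map_def tD chart_topspace[OF c]
    proof (intro conjI allI impI)
      fix V assume "openin (subtopology (mtop (M s)) (cdom c)) V"
      then have V: "openin (mtop (M s)) V" "V \<subseteq> cdom c"
        by (auto simp: openin_open_subtopology[OF chart_openin[OF c]])
      have "{w \<in> ?D. snd w \<in> V} = Pair s ` V" using V(2) by auto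
      then show "openin (subtopology ?T ?D) {w \<in> ?D. snd w \<in> V}"
        using slice[OF V(1)] by (auto simp: openin_open_subtopology[OF D])
    qed auto
    show "open_map (subtopology ?T ?D) (subtopology (mtop (M s)) (cdom c)) snd"
      unfolding open_map_def
    proof (intro allI impI)
      fix U assume "openin (subtopology ?T ?D) U"
      then have U: "openin ?T U" "U \<subseteq> ?D" by (auto simp: openin_open_subtopology[OF D])
      have "snd ` U = {x. (s, x) \<in> U}" using U(2) by force
      then have "openin (mtop (M s)) (snd ` U)"
        using U(1) s unfolding T openin_sum_topology by simp
      then show "openin (subtopology (mtop (M s)) (cdom c)) (snd ` U)"
        using U(2) by (auto simp: openin_open_subtopology[OF chart_openin[OF c]])
    qed
    show "snd ` topspace (subtopology ?T ?D) = topspace (subtopology (mtop (M s)) (cdom c))"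
      unfolding tD chart_topspace[OF c] by simp
    show "inj_on snd (topspace (subtopology ?T ?D))" unfolding tD by (auto simp: inj_on_def)
  qed
  have im: "(\<lambda>u. cmap c (snd u)) ` ?D = cmap c ` cdom c" by force
  have "homeomorphic_map (subtopology ?T ?D) (subtopology (powertop_real (cind c)) (cmap c ` cdom c))
      (\<lambda>u. cmap c (snd u))"
    using homeomorphic_map_compose[OF h chart_homeomorphic[OF c]] by (simp add: o_def)
  then show ?thesis
    using c D unfolding is_chart_def by (simp add: sum_chart_def im)
qed

text \<open>\<open>s2\<close> labels the summand that receives the slice of \<open>s\<close>. If it
  is not \<open>s'\<close>, the coordinate expression has empty domain and smoothness is vacuous, so
  \<open>f\<close> has to be smooth only when the labels match.\<close>

lemma local_smooth_sum_chart:
  assumes c: "is_chart T c" "is_chart T' (sum_chart s c)"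
    and F: "\<And>p. p \<in> cdom c \<Longrightarrow> F (s, p) = (s2, f p)" and f: "s2 = s' \<Longrightarrow> local_smooth c d f"
  shows "local_smooth (sum_chart s c) (sum_chart s' d) F"
proof (cases "s2 = s'")
  case False
  then have "local_dom (sum_chart s c) (sum_chart s' d) F = {}"
    using F by (auto simp: local_dom_def sum_chart_def)
  then show ?thesis by (simp add: local_smooth_def smooth_vec_on_def smooth_on_subset_def)
next
  case True
  have dom: "local_dom (sum_chart s c) (sum_chart s' d) F = local_dom c d f"
    using F True by (force simp: local_dom_def sum_chart_def)
  have "smooth_vec_on (cind c) (cind d) (local_dom c d f) (local_rep (sum_chart s c) (sum_chart s' d) F)"
  proof (rule smooth_vec_on_cong)
    show "smooth_vec_on (cind c) (cind d) (local_dom c d f) (local_rep c d f)"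
      using f[OF True] by (simp add: local_smooth_def)
    fix x assume "x \<in> local_dom c d f"
    then obtain p where p: "p \<in> cdom c" "x = cmap c p" by (auto simp: local_dom_def)
    have "x = cmap (sum_chart s c) (s, p)" "(s, p) \<in> cdom (sum_chart s c)"
      using p by (simp_all add: sum_chart_def)
    then show "local_rep c d f x = local_rep (sum_chart s c) (sum_chart s' d) F x"
      using local_rep_cmap[OF c(1) p(1)] local_rep_cmap[OF c(2), of "(s, p)" "sum_chart s' d" F] p F
      by (simp add: sum_chart_def)
  qed
  then show ?thesis unfolding local_smooth_def dom by (simp add: sum_chart_def)
qed

lemma points_sum_mfd: "points (sum_mfd S M) = Sigma S (\<lambda>s. points (M s))"
  by (auto simp: sum_mfd_def)

lemma atlas_sum_mfd: "atlas (sum_mfd S M) = (\<Union>s\<in>S. sum_chart s ` atlas (M s))"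
  by (simp add: sum_mfd_def)

lemma premfd_sum_mfd:
  assumes M: "\<And>s. s \<in> S \<Longrightarrow> premfd (M s)"
  shows "premfd (sum_mfd S M)"
  unfolding premfd_def
proof (intro conjI ballI)
  have ch: "is_chart (mtop (sum_mfd S M)) (sum_chart s c)" if "s \<in> S" "c \<in> atlas (M s)" for s c
    using is_chart_sum_chart[where M=M, OF that(1) premfd_chart[OF M[OF that(1)] that(2)]] .
  show "is_chart (mtop (sum_mfd S M)) c" if "c \<in> atlas (sum_mfd S M)" for c
    using that ch by (auto simp: atlas_sum_mfd)
  show "(\<Union>c\<in>atlas (sum_mfd S M). cdom c) = points (sum_mfd S M)"
  proof
    show "(\<Union>c\<in>atlas (sum_mfd S M). cdom c) \<subseteq> points (sum_mfd S M)"
      using premfd_cdom M by (fastforce simp: points_sum_mfd atlas_sum_mfd sum_chart_def)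
    show "points (sum_mfd S M) \<subseteq> (\<Union>c\<in>atlas (sum_mfd S M). cdom c)"
    proof
      fix u assume "u \<in> points (sum_mfd S M)"
      then obtain s p where u: "u = (s, p)" "s \<in> S" "p \<in> points (M s)" by (auto simp: points_sum_mfd)
      then obtain c where "c \<in> atlas (M s)" "p \<in> cdom c" using premfd_chart_at[OF M] by blast
      then show "u \<in> (\<Union>c\<in>atlas (sum_mfd S M). cdom c)"
        using u by (auto simp: atlas_sum_mfd sum_chart_def)
    qed
  qed
  fix c' d' assume "c' \<in> atlas (sum_mfd S M)" "d' \<in> atlas (sum_mfd S M)"
  then obtain s c t d where sc: "s \<in> S" "c \<in> atlas (M s)" "c' = sum_chart s c"
    and td: "t \<in> S" "d \<in> atlas (M t)" "d' = sum_chart t d"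
    unfolding atlas_sum_mfd by blast
  show "local_smooth c' d' (\<lambda>p. p)"
    unfolding sc(3) td(3)
    by (rule local_smooth_sum_chart[OF premfd_chart[OF M[OF sc(1)] sc(2)] ch[OF sc(1,2)], where f="\<lambda>p. p" and ?s2.0=s])
      (use M[OF sc(1)] sc td in \<open>auto simp: premfd_def\<close>)
qed

lemma smap_sum_mfd:
  assumes M: "\<And>s. s \<in> S \<Longrightarrow> premfd (M s)"
    and \<phi>: "\<And>s. s \<in> S \<Longrightarrow> \<phi> s \<in> S'" and f: "\<And>s. s \<in> S \<Longrightarrow> smap (M s) (N (\<phi> s)) (f s)"
    and F: "\<And>s p. s \<in> S \<Longrightarrow> p \<in> points (M s) \<Longrightarrow> F (s, p) = (\<phi> s, f s p)"
  shows "smap (sum_mfd S M) (sum_mfd S' N) F"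
  unfolding smap_def
proof (intro conjI ballI)
  show "continuous_map (mtop (sum_mfd S M)) (mtop (sum_mfd S' N)) F"
    unfolding continuous_map_def
  proof (intro conjI allI impI)
    show "F \<in> points (sum_mfd S M) \<rightarrow> points (sum_mfd S' N)"
      using F \<phi> smap_points[OF f] by (auto simp: points_sum_mfd)
    fix U assume "openin (mtop (sum_mfd S' N)) U"
    then have U: "openin (mtop (N t)) {y. (t, y) \<in> U}" if "t \<in> S'" for t
      using that by (simp add: sum_mfd_def openin_sum_topology)
    have "openin (mtop (M s)) {x. (s, x) \<in> {x \<in> points (sum_mfd S M). F x \<in> U}}" if s: "s \<in> S" for s
    proof -
      have "{x. (s, x) \<in> {x \<in> points (sum_mfd S M). F x \<in> U}} = {x \<in> points (M s). f s x \<in> {y. (\<phi> s, y) \<in> U}}"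
        using s F by (auto simp: points_sum_mfd)
      then show ?thesis
        using f[OF s] U[OF \<phi>[OF s]] by (simp only: smap_def) (blast intro: openin_continuous_map_preimage)
    qed
    moreover have "{x \<in> points (sum_mfd S M). F x \<in> U} \<subseteq> Sigma S (topspace \<circ> (\<lambda>s. mtop (M s)))"
      by (auto simp: points_sum_mfd)
    ultimately show "openin (mtop (sum_mfd S M)) {x \<in> points (sum_mfd S M). F x \<in> U}"
      unfolding sum_mfd_def[of S M] by (simp add: openin_sum_topology)
  qed
  fix c' d' assume "c' \<in> atlas (sum_mfd S M)" "d' \<in> atlas (sum_mfd S' N)"
  then obtain s c t d where sc: "s \<in> S" "c \<in> atlas (M s)" "c' = sum_chart s c"
    and td: "t \<in> S'" "d \<in> atlas (N t)" "d' = sum_chart t d"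
    unfolding atlas_sum_mfd by blast
  note C = premfd_chart[OF M[OF sc(1)] sc(2)]
  show "local_smooth c' d' F"
    unfolding sc(3) td(3)
  proof (rule local_smooth_sum_chart[OF C is_chart_sum_chart[where M=M, OF sc(1) C]])
    show "F (s, p) = (\<phi> s, f s p)" if "p \<in> cdom c" for p
      using F[OF sc(1)] premfd_cdom[OF M[OF sc(1)] sc(2) that] by blast
    show "local_smooth c d (f s)" if "\<phi> s = t"
      using f[OF sc(1)] sc(2) td(2) that by (auto simp: smap_def)
  qed
qed

section \<open>Products\<close>

lemma points_prod_mfd: "points (prod_mfd X M) = (\<Pi>\<^sub>E x\<in>X. points (M x))"
  by (simp add: prod_mfd_def)

lemma atlas_prod_mfd: "atlas (prod_mfd X M) = prod_chart X ` (\<Pi>\<^sub>E x\<in>X. atlas (M x))"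
  by (simp add: prod_mfd_def)

lemma prod_chart_sel [simp]:
  "cdom (prod_chart X c) = (\<Pi>\<^sub>E x\<in>X. cdom (c x))"
  "cind (prod_chart X c) = Sigma X (\<lambda>x. cind (c x))"
  by (simp_all add: prod_chart_def)

lemma cmap_prod_chart:
  "x \<in> X \<Longrightarrow> i \<in> cind (c x) \<Longrightarrow> cmap (prod_chart X c) m (x, i) = cmap (c x) (m x) i"
  by (simp add: prod_chart_def)

lemma cmap_prod_chart_ext: "cmap (prod_chart X c) m \<in> Sigma X (\<lambda>x. cind (c x)) \<rightarrow>\<^sub>E UNIV"
  by (simp add: prod_chart_def)

lemma cmap_prod_chart_component:
  assumes "is_chart T (c x)" "x \<in> X" "m x \<in> cdom (c x)"
  shows "(\<lambda>i\<in>cind (c x). cmap (prod_chart X c) m (x, i)) = cmap (c x) (m x)"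
proof (rule PiE_ext[OF _ chart_cmap_ext[OF assms(1,3)]])
  show "(\<lambda>i\<in>cind (c x). cmap (prod_chart X c) m (x, i)) \<in> cind (c x) \<rightarrow>\<^sub>E UNIV" by simp
qed (simp add: cmap_prod_chart assms)

text \<open>Finiteness of \<open>X\<close> makes the product of the open chart domains open and the
  joint index set finite. The inverse splits the coordinates into blocks and applies the inverse
  chart \<open>g x\<close> to each, so both directions are continuous componentwise.\<close>

lemma is_chart_prod_chart:
  assumes X: "finite X" and c: "\<And>x. x \<in> X \<Longrightarrow> is_chart (T x) (c x)"
  shows "is_chart (product_topology T X) (prod_chart X c)"
proof -
  let ?I = "Sigma X (\<lambda>x. cind (c x))" and ?D = "\<Pi>\<^sub>E x\<in>X. cdom (c x)" and ?m = "cmap (prod_chart X c)"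
  let ?\<pi> = "\<lambda>x z. \<lambda>i\<in>cind (c x). z (x, i)"
  have comp: "?\<pi> x (?m m) = cmap (c x) (m x)" if "m \<in> ?D" "x \<in> X" for m x
    by (rule cmap_prod_chart_component[where c=c and x=x, OF c]) (use that in auto)
  have "\<forall>x\<in>X. \<exists>g. homeomorphic_maps (subtopology (T x) (cdom (c x)))
      (subtopology (powertop_real (cind (c x))) (cmap (c x) ` cdom (c x))) (cmap (c x)) g"
    using chart_homeomorphic[OF c] by (simp add: homeomorphic_map_maps)
  then obtain g where g: "\<And>x. x \<in> X \<Longrightarrow> homeomorphic_maps (subtopology (T x) (cdom (c x)))
      (subtopology (powertop_real (cind (c x))) (cmap (c x) ` cdom (c x))) (cmap (c x)) (g x)"
    by metis
  have gc: "g x (cmap (c x) p) = p" if "x \<in> X" "p \<in> cdom (c x)" for x p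
    using g[OF that(1)] that(2) chart_topspace[OF c[OF that(1)]] unfolding homeomorphic_maps_def by blast
  have im: "?m ` ?D = {z \<in> ?I \<rightarrow>\<^sub>E UNIV. \<forall>x\<in>X. ?\<pi> x z \<in> cmap (c x) ` cdom (c x)}"
  proof
    show "?m ` ?D \<subseteq> {z \<in> ?I \<rightarrow>\<^sub>E UNIV. \<forall>x\<in>X. ?\<pi> x z \<in> cmap (c x) ` cdom (c x)}"
    proof (intro image_subsetI CollectI conjI ballI)
      fix m assume m: "m \<in> ?D"
      show "?m m \<in> ?I \<rightarrow>\<^sub>E UNIV" by (rule cmap_prod_chart_ext)
      show "?\<pi> x (?m m) \<in> cmap (c x) ` cdom (c x)" if "x \<in> X" for x
        unfolding comp[OF m that] using m that by auto
    qed
    show "{z \<in> ?I \<rightarrow>\<^sub>E UNIV. \<forall>x\<in>X. ?\<pi> x z \<in> cmap (c x) ` cdom (c x)} \<subseteq> ?m ` ?D"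
    proof
      fix z assume z: "z \<in> {z \<in> ?I \<rightarrow>\<^sub>E UNIV. \<forall>x\<in>X. ?\<pi> x z \<in> cmap (c x) ` cdom (c x)}"
      then have "\<forall>x\<in>X. \<exists>p\<in>cdom (c x). ?\<pi> x z = cmap (c x) p" by blast
      then obtain p where p: "\<And>x. x \<in> X \<Longrightarrow> p x \<in> cdom (c x)" "\<And>x. x \<in> X \<Longrightarrow> ?\<pi> x z = cmap (c x) (p x)"
        by metis
      have "?m (restrict p X) = z"
      proof (rule PiE_ext[OF cmap_prod_chart_ext])
        show "z \<in> ?I \<rightarrow>\<^sub>E UNIV" using z by blast
        fix k assume "k \<in> ?I"
        then obtain x i where k: "k = (x, i)" "x \<in> X" "i \<in> cind (c x)" by blast
        then show "?m (restrict p X) k = z k"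
          using fun_cong[OF p(2)[OF k(2)], of i] by (simp add: cmap_prod_chart)
      qed
      moreover have "restrict p X \<in> ?D" using p(1) by simp
      ultimately show "z \<in> ?m ` ?D" by blast
    qed
  qed
  have D: "openin (product_topology T X) ?D"
    unfolding openin_PiE_gen using X chart_openin[OF c] by simp
  have tD: "topspace (subtopology (product_topology T X) ?D) = ?D"
    using openin_subset[OF D] by (simp only: topspace_subtopology Int_absorb1)
  let ?Y = "subtopology (powertop_real ?I) (?m ` ?D)"
  have "?m ` ?D \<subseteq> topspace (powertop_real ?I)" unfolding im by auto
  then have tY: "topspace ?Y = ?m ` ?D" by (simp only: topspace_subtopology Int_absorb1)
  let ?g = "\<lambda>z. \<lambda>x\<in>X. g x (?\<pi> x z)"
  have gx: "g x (?\<pi> x (?m m)) = m x" if "m \<in> ?D" "x \<in> X" for m x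
    unfolding comp[OF that] by (rule gc[OF that(2) PiE_mem[OF that]])
  have gm: "?g (?m m) = m" if "m \<in> ?D" for m
  proof (rule PiE_ext[OF _ that])
    show "?g (?m m) x = m x" if "x \<in> X" for x
      unfolding restrict_apply'[OF that] by (rule gx[OF \<open>m \<in> ?D\<close> that])
    show "?g (?m m) \<in> ?D"
      unfolding restrict_PiE_iff
    proof
      show "g x (?\<pi> x (?m m)) \<in> cdom (c x)" if "x \<in> X" for x
        unfolding gx[OF \<open>m \<in> ?D\<close> that] by (rule PiE_mem[OF \<open>m \<in> ?D\<close> that])
    qed
  qed
  have "homeomorphic_maps (subtopology (product_topology T X) ?D) ?Y ?m ?g"
    unfolding homeomorphic_maps_def tD tY
  proof (intro conjI ballI)
    show "?g (?m m) = m" if "m \<in> ?D" for m by (rule gm[OF that])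
    show "?m (?g z) = z" if z: "z \<in> ?m ` ?D" for z
    proof -
      obtain m where m: "z = ?m m" "m \<in> ?D" using z by (rule imageE)
      show ?thesis unfolding m(1) gm[OF m(2)] ..
    qed
    show "continuous_map (subtopology (product_topology T X) ?D) ?Y ?m"
      unfolding continuous_map_in_subtopology continuous_map_componentwise tD
    proof (intro conjI ballI)
      show "?m ` ?D \<subseteq> extensional ?I" using cmap_prod_chart_ext[of X c] by (auto simp: PiE_iff)
      show "?m \<in> ?D \<rightarrow> ?m ` ?D" by blast
      fix k assume "k \<in> ?I"
      then obtain x i where k: "k = (x, i)" "x \<in> X" "i \<in> cind (c x)" by blast
      have "continuous_map (subtopology (product_topology T X) ?D) (subtopology (T x) (cdom (c x))) (\<lambda>m. m x)"
        unfolding continuous_map_in_subtopology tD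
        using k by (auto intro: continuous_map_from_subtopology continuous_map_product_projection)
      from continuous_map_compose[OF this]
      have "continuous_map (subtopology (product_topology T X) ?D) (powertop_real (cind (c x))) (\<lambda>m. cmap (c x) (m x))"
        using homeomorphic_imp_continuous_map[OF chart_homeomorphic[OF c[OF k(2)]]]
        by (simp add: continuous_map_in_subtopology o_def)
      then have "continuous_map (subtopology (product_topology T X) ?D) euclideanreal (\<lambda>m. cmap (c x) (m x) i)"
        using k(3) by (auto simp: continuous_map_componentwise)
      then show "continuous_map (subtopology (product_topology T X) ?D) euclideanreal (\<lambda>m. ?m m k)"
        using k by (simp add: cmap_prod_chart)
    qed
    show "continuous_map ?Y (subtopology (product_topology T X) ?D) ?g"
      unfolding continuous_map_in_subtopology continuous_map_componentwise tY
    proof (intro conjI ballI)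
      show "?g \<in> ?m ` ?D \<rightarrow> ?D"
      proof
        fix z assume "z \<in> ?m ` ?D"
        then obtain m where "m \<in> ?D" "z = ?m m" by blast
        then show "?g z \<in> ?D" using gm by simp
      qed
      fix x assume x: "x \<in> X"
      have "continuous_map ?Y (powertop_real (cind (c x))) (?\<pi> x)"
        using x by (auto simp: continuous_map_componentwise
            intro!: continuous_map_from_subtopology continuous_map_product_projection)
      moreover have "?\<pi> x \<in> topspace ?Y \<rightarrow> cmap (c x) ` cdom (c x)"
        unfolding tY
      proof
        fix z assume "z \<in> ?m ` ?D"
        then obtain m where m: "z = ?m m" "m \<in> ?D" by (rule imageE)
        show "?\<pi> x z \<in> cmap (c x) ` cdom (c x)"
          unfolding m(1) comp[OF m(2) x] by (rule imageI[OF PiE_mem[OF m(2) x]])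
      qed
      ultimately have "continuous_map ?Y (subtopology (powertop_real (cind (c x))) (cmap (c x) ` cdom (c x))) (?\<pi> x)"
        by (simp only: continuous_map_in_subtopology)
      moreover have "continuous_map (subtopology (powertop_real (cind (c x))) (cmap (c x) ` cdom (c x))) (T x) (g x)"
        using g[OF x] by (simp add: homeomorphic_maps_def continuous_map_in_subtopology)
      ultimately have "continuous_map ?Y (T x) (\<lambda>z. g x (?\<pi> x z))"
        using continuous_map_compose by (fastforce simp: o_def)
      then show "continuous_map ?Y (T x) (\<lambda>z. ?g z x)" using x by simp
    qed auto
  qed
  then have "homeomorphic_map (subtopology (product_topology T X) ?D) ?Y ?m"
    by (rule homeomorphic_maps_imp_map)
  moreover have "\<exists>K\<subseteq>?I. openin (subtopology (powertop_real ?I) (sector ?I K)) (?m ` ?D)"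
  proof -
    have "\<exists>K W. K \<subseteq> cind (c x) \<and> openin (powertop_real (cind (c x))) W \<and>
        cmap (c x) ` cdom (c x) = W \<inter> sector (cind (c x)) K" if x: "x \<in> X" for x
    proof -
      obtain K where "K \<subseteq> cind (c x)"
          "openin (subtopology (powertop_real (cind (c x))) (sector (cind (c x)) K)) (cmap (c x) ` cdom (c x))"
        using c[OF x] unfolding is_chart_def by (elim conjE exE)
      then show ?thesis unfolding openin_subtopology by blast
    qed
    then obtain K W where KW: "\<And>x. x \<in> X \<Longrightarrow> K x \<subseteq> cind (c x)"
        "\<And>x. x \<in> X \<Longrightarrow> openin (powertop_real (cind (c x))) (W x)"
        "\<And>x. x \<in> X \<Longrightarrow> cmap (c x) ` cdom (c x) = W x \<inter> sector (cind (c x)) (K x)"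
      by metis
    define V where "V = topspace (powertop_real ?I) \<inter> (\<Inter>x\<in>X. {z \<in> ?I \<rightarrow>\<^sub>E UNIV. ?\<pi> x z \<in> W x})"
    have Vx: "openin (powertop_real ?I) {z \<in> ?I \<rightarrow>\<^sub>E UNIV. ?\<pi> x z \<in> W x}" if "x \<in> X" for x
      by (rule openin_powertop_reindex[OF KW(2)[OF that]]) (use that in auto)
    have V: "openin (powertop_real ?I) V"
    proof (cases "X = {}")
      case False
      show ?thesis unfolding V_def by (intro openin_Int openin_topspace openin_INT2[OF X False] Vx)
    next
      case True
      then have "V = topspace (powertop_real ?I)" unfolding V_def by blast
      then show ?thesis using openin_topspace by (simp only:)
    qed
    \<comment> \<open>A product of sectors is again a sector, with the constrained indices collected
      in \<open>Sigma X K\<close>.\<close>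
    have sec: "(\<forall>x\<in>X. ?\<pi> x z \<in> sector (cind (c x)) (K x)) \<longleftrightarrow> z \<in> sector ?I (Sigma X K)"
      if "z \<in> ?I \<rightarrow>\<^sub>E UNIV" for z
      using that KW(1) by (auto simp: sector_def subset_iff)
    have sub: "z \<in> ?I \<rightarrow>\<^sub>E UNIV" if "z \<in> sector ?I (Sigma X K)" for z
      using that by (simp add: sector_def)
    have "z \<in> ?m ` ?D \<longleftrightarrow> z \<in> V \<inter> sector ?I (Sigma X K)" for z
    proof (cases "z \<in> ?I \<rightarrow>\<^sub>E UNIV")
      case True
      have "z \<in> ?m ` ?D \<longleftrightarrow> (\<forall>x\<in>X. ?\<pi> x z \<in> W x) \<and> (\<forall>x\<in>X. ?\<pi> x z \<in> sector (cind (c x)) (K x))"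
        unfolding im using True KW(3) by simp blast
      also have "\<dots> \<longleftrightarrow> z \<in> V \<inter> sector ?I (Sigma X K)"
        unfolding sec[OF True] V_def using True by simp
      finally show ?thesis .
    next
      case False
      then show ?thesis using sub unfolding im by blast
    qed
    then have "?m ` ?D = V \<inter> sector ?I (Sigma X K)" by (rule set_eqI)
    then have "openin (subtopology (powertop_real ?I) (sector ?I (Sigma X K))) (?m ` ?D)"
      using V unfolding openin_subtopology by blast
    then show ?thesis using KW(1) by (intro exI[of _ "Sigma X K"]) auto
  qed
  ultimately show ?thesis
    unfolding is_chart_def using X D chart_finite[OF c] by simp
qed

section \<open>Smooth maps into and out of products\<close>

lemma local_smooth_into_prod:
  assumes e: "is_chart T e"
    and F: "\<And>x. x \<in> X \<Longrightarrow> local_smooth e (d x) (\<lambda>p. F p x)"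
  shows "local_smooth e (prod_chart X d) F"
  unfolding local_smooth_def smooth_vec_on_def
proof (intro conjI ballI)
  let ?D = "local_dom e (prod_chart X d) F"
  show "local_rep e (prod_chart X d) F \<in> ?D \<rightarrow> (cind (prod_chart X d) \<rightarrow>\<^sub>E UNIV)"
    unfolding local_rep_def prod_chart_sel by (intro funcsetI cmap_prod_chart_ext)
  fix k assume "k \<in> cind (prod_chart X d)"
  then obtain x i where k: "k = (x, i)" "x \<in> X" "i \<in> cind (d x)" by auto
  have "smooth_vec_on (cind e) (cind (d x)) ?D (local_rep e (d x) (\<lambda>p. F p x))"
    using F[OF k(2)] unfolding local_smooth_def
    by (rule smooth_vec_on_subset) (use k(2) in \<open>auto simp: local_dom_def\<close>)
  then have "smooth_on_subset (cind e) ?D (\<lambda>y. local_rep e (d x) (\<lambda>p. F p x) y i)"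
    using k(3) by (simp add: smooth_vec_on_def)
  then show "smooth_on_subset (cind e) ?D (\<lambda>y. local_rep e (prod_chart X d) F y k)"
    using k by (simp add: local_rep_def cmap_prod_chart)
qed

text \<open>The chart \<open>d\<close> may differ from the factor \<open>c x\<close> of the product
  chart, so the expression is a selection of coordinates followed by the change from
  \<open>c x\<close> to \<open>d\<close>.\<close>

lemma local_smooth_prod_proj:
  assumes X: "finite X" and c: "\<And>x. x \<in> X \<Longrightarrow> is_chart (T x) (c x)" and x: "x \<in> X" "is_chart (T x) d"
    and cd: "local_smooth (c x) d (\<lambda>p. p)"
  shows "local_smooth (prod_chart X c) d (\<lambda>m. m x)"
proof -
  let ?c = "prod_chart X c"
  have C: "is_chart (product_topology T X) ?c" by (rule is_chart_prod_chart[OF X c])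
  let ?D = "local_dom ?c d (\<lambda>m. m x)" and ?\<pi> = "\<lambda>z. \<lambda>i\<in>cind (c x). z (x, i)"
  have comp: "?\<pi> (cmap ?c m) = cmap (c x) (m x)" if "m \<in> cdom ?c" for m
    by (rule cmap_prod_chart_component[where c=c and x=x, OF c[OF x(1)] x(1)]) (use that x in auto)
  have "smooth_vec_on (cind ?c) (cind d) ?D (\<lambda>z. local_rep (c x) d (\<lambda>p. p) (?\<pi> z))"
  proof (rule smooth_vec_on_compose[OF chart_finite[OF C] chart_finite[OF c[OF x(1)]] local_dom_ext[OF C]
        local_dom_ext[OF c[OF x(1)]] chart_finite[OF x(2)]])
    show "smooth_vec_on (cind ?c) (cind (c x)) ?D ?\<pi>"
      by (rule smooth_vec_on_coords[OF chart_finite[OF C] local_dom_ext[OF C]]) (use x in auto)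
    show "smooth_vec_on (cind (c x)) (cind d) (local_dom (c x) d (\<lambda>p. p)) (local_rep (c x) d (\<lambda>p. p))"
      using cd by (simp add: local_smooth_def)
    fix z assume "z \<in> ?D"
    then obtain m where m: "m \<in> cdom ?c" "m x \<in> cdom d" "z = cmap ?c m" by (auto simp: local_dom_def)
    show "?\<pi> z \<in> local_dom (c x) d (\<lambda>p. p)"
      unfolding m(3) comp[OF m(1)] local_dom_def using m x by auto
  qed
  then have "smooth_vec_on (cind ?c) (cind d) ?D (local_rep ?c d (\<lambda>m. m x))"
  proof (rule smooth_vec_on_cong)
    fix z assume "z \<in> ?D"
    then obtain m where m: "m \<in> cdom ?c" "m x \<in> cdom d" "z = cmap ?c m" by (auto simp: local_dom_def)
    have "m x \<in> cdom (c x)" using m(1) x(1) by auto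
    then show "local_rep (c x) d (\<lambda>p. p) (?\<pi> z) = local_rep ?c d (\<lambda>m. m x) z"
      unfolding m(3) comp[OF m(1)] by (simp add: local_rep_cmap[OF c[OF x(1)]] local_rep_cmap[OF C m(1)])
  qed
  then show ?thesis by (simp add: local_smooth_def)
qed

lemma premfd_prod_mfd:
  assumes X: "finite X" and M: "\<And>x. x \<in> X \<Longrightarrow> premfd (M x)"
  shows "premfd (prod_mfd X M)"
  unfolding premfd_def
proof (intro conjI ballI)
  have T: "mtop (prod_mfd X M) = product_topology (\<lambda>x. mtop (M x)) X" by (simp add: prod_mfd_def)
  have ch: "is_chart (mtop (prod_mfd X M)) (prod_chart X c)" if "c \<in> (\<Pi>\<^sub>E x\<in>X. atlas (M x))" for c
    unfolding T by (rule is_chart_prod_chart[OF X]) (use that premfd_chart[OF M] in auto)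
  show "is_chart (mtop (prod_mfd X M)) c" if "c \<in> atlas (prod_mfd X M)" for c
    using that ch unfolding atlas_prod_mfd by blast
  show "(\<Union>c\<in>atlas (prod_mfd X M). cdom c) = points (prod_mfd X M)"
  proof
    show "(\<Union>c\<in>atlas (prod_mfd X M). cdom c) \<subseteq> points (prod_mfd X M)"
      using chart_subset[OF ch] unfolding atlas_prod_mfd by blast
    show "points (prod_mfd X M) \<subseteq> (\<Union>c\<in>atlas (prod_mfd X M). cdom c)"
    proof
      fix m assume m: "m \<in> points (prod_mfd X M)"
      have "\<exists>c. c \<in> atlas (M x) \<and> m x \<in> cdom c" if "x \<in> X" for x
      proof -
        have "m x \<in> points (M x)" using m that unfolding points_prod_mfd by (rule PiE_mem)
        then show ?thesis using premfd_chart_at[OF M[OF that]] by blast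
      qed
      then obtain c where c: "\<And>x. x \<in> X \<Longrightarrow> c x \<in> atlas (M x)" "\<And>x. x \<in> X \<Longrightarrow> m x \<in> cdom (c x)" by metis
      have "prod_chart X (restrict c X) \<in> atlas (prod_mfd X M)" unfolding atlas_prod_mfd using c(1) by simp
      moreover have "m \<in> cdom (prod_chart X (restrict c X))"
        using c(2) m unfolding points_prod_mfd by (auto simp: PiE_iff)
      ultimately show "m \<in> (\<Union>c\<in>atlas (prod_mfd X M). cdom c)" by blast
    qed
  qed
  fix c' d' assume "c' \<in> atlas (prod_mfd X M)" "d' \<in> atlas (prod_mfd X M)"
  then obtain c d where c: "c \<in> (\<Pi>\<^sub>E x\<in>X. atlas (M x))" "c' = prod_chart X c"
    and d: "d \<in> (\<Pi>\<^sub>E x\<in>X. atlas (M x))" "d' = prod_chart X d"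
    unfolding atlas_prod_mfd by blast
  show "local_smooth c' d' (\<lambda>p. p)"
    unfolding c(2) d(2)
  proof (rule local_smooth_into_prod[OF ch[OF c(1)]])
    fix x assume x: "x \<in> X"
    have cx: "c y \<in> atlas (M y)" "d y \<in> atlas (M y)" if "y \<in> X" for y
      using c(1) d(1) that by (auto dest: PiE_mem)
    show "local_smooth (prod_chart X c) (d x) (\<lambda>p. p x)"
    proof (rule local_smooth_prod_proj[OF X _ x, where T="\<lambda>x. mtop (M x)"])
      show "is_chart (mtop (M y)) (c y)" if "y \<in> X" for y using premfd_chart[OF M cx(1)] that by blast
      show "is_chart (mtop (M x)) (d x)" using premfd_chart[OF M cx(2)] x by blast
      show "local_smooth (c x) (d x) (\<lambda>p. p)" using M[OF x] cx[OF x] by (simp add: premfd_def)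
    qed
  qed
qed

lemma smap_prod_proj:
  assumes X: "finite X" and M: "\<And>x. x \<in> X \<Longrightarrow> premfd (M x)" and x: "x \<in> X"
  shows "smap (prod_mfd X M) (M x) (\<lambda>m. m x)"
  unfolding smap_def
proof (intro conjI ballI)
  show "continuous_map (mtop (prod_mfd X M)) (mtop (M x)) (\<lambda>m. m x)"
    using continuous_map_product_projection[OF x, of "\<lambda>x. mtop (M x)"] by (simp add: prod_mfd_def)
  fix c' d assume "c' \<in> atlas (prod_mfd X M)" and d: "d \<in> atlas (M x)"
  then obtain c where c: "c \<in> (\<Pi>\<^sub>E x\<in>X. atlas (M x))" "c' = prod_chart X c"
    unfolding atlas_prod_mfd by blast
  have cx: "c y \<in> atlas (M y)" if "y \<in> X" for y using c(1) that by (rule PiE_mem)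
  show "local_smooth c' d (\<lambda>m. m x)"
    unfolding c(2)
  proof (rule local_smooth_prod_proj[OF X _ x, where T="\<lambda>x. mtop (M x)"])
    show "is_chart (mtop (M y)) (c y)" if "y \<in> X" for y using premfd_chart[OF M cx] that by blast
    show "is_chart (mtop (M x)) d" using premfd_chart[OF M[OF x] d] .
    show "local_smooth (c x) d (\<lambda>p. p)" using M[OF x] cx[OF x] d by (simp add: premfd_def)
  qed
qed

lemma smap_into_prod:
  assumes P: "premfd P" and F: "\<And>x. x \<in> X \<Longrightarrow> smap P (M x) (\<lambda>p. F p x)"
    and ext: "\<And>p. p \<in> points P \<Longrightarrow> F p \<in> extensional X"
  shows "smap P (prod_mfd X M) F"
  unfolding smap_def
proof (intro conjI ballI)
  show "continuous_map (mtop P) (mtop (prod_mfd X M)) F"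
    using F ext by (auto simp: prod_mfd_def continuous_map_componentwise smap_def)
  fix e d' assume e: "e \<in> atlas P" and "d' \<in> atlas (prod_mfd X M)"
  then obtain d where d: "d \<in> (\<Pi>\<^sub>E x\<in>X. atlas (M x))" "d' = prod_chart X d"
    unfolding atlas_prod_mfd by blast
  show "local_smooth e d' F"
    unfolding d(2)
  proof (rule local_smooth_into_prod[OF premfd_chart[OF P e]])
    show "local_smooth e (d x) (\<lambda>p. F p x)" if "x \<in> X" for x
      using F[OF that] e PiE_mem[OF d(1) that] by (simp add: smap_def)
  qed
qed

lemma bij_betw_inverse_map:
  assumes "bij_betw f (points M) (points N)"
  shows "y \<in> points N \<Longrightarrow> inverse_map M N f y \<in> points M"
    and "y \<in> points N \<Longrightarrow> f (inverse_map M N f y) = y"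
    and "x \<in> points M \<Longrightarrow> inverse_map M N f (f x) = x"
  using bij_betw_inv_into_left[OF assms] bij_betw_inv_into_right[OF assms]
    bij_betwE[OF bij_betw_inv_into[OF assms]] bij_betwE[OF assms]
  by (auto simp: inverse_map_def)

subsection \<open>The tangent bundle of a product\<close>

context
  fixes X :: "'x set" and M :: "'x \<Rightarrow> ('p, 'i) mfd"
  assumes X: "finite X" and M: "\<And>x. x \<in> X \<Longrightarrow> premfd (M x)"
begin

private abbreviation (input) "P \<equiv> prod_mfd X M"
private abbreviation (input) "TP \<equiv> prod_mfd X (\<lambda>x. tangent_bundle (M x))"
private abbreviation (input) "rpr \<equiv> (\<lambda>x. \<lambda>m\<in>points P. m x)"

private lemma preP: "premfd P" by (rule premfd_prod_mfd[OF X M])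

private lemma smap_rpr: "x \<in> X \<Longrightarrow> smap P (M x) (rpr x)"
  by (rule smap_cong[OF preP smap_prod_proj[OF X M]]) auto

private lemma can_T_apply:
  "w \<in> points (tangent_bundle P) \<Longrightarrow> x \<in> X \<Longrightarrow> can_T X M w x = tangent_map P (M x) (rpr x) w"
  by (simp add: can_T_def)

lemma can_T_points:
  assumes w: "w \<in> points (tangent_bundle P)"
  shows "can_T X M w \<in> points TP"
  unfolding points_prod_mfd
proof (rule PiE_I)
  show "can_T X M w x \<in> points (tangent_bundle (M x))" if "x \<in> X" for x
    unfolding can_T_apply[OF w that] by (rule tangent_map_points[OF preP M[OF that] smap_rpr[OF that] w])
  show "can_T X M w x = undefined" if "x \<notin> X" for x
    using w that by (simp add: can_T_def)
qed

lemma can_T_fst: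
  assumes w: "w \<in> points (tangent_bundle P)" and x: "x \<in> X"
  shows "fst (can_T X M w x) = fst w x"
  using tangent_points_fst[OF preP w] by (simp add: can_T_apply[OF w x] fst_tangent_map[OF w])

text \<open>In the chosen charts the projection selects the coordinates with first index
  \<open>x\<close>, and its derivative selects the same block of the vector.\<close>

lemma can_T_coord:
  assumes w: "w \<in> points (tangent_bundle P)" and x: "x \<in> X"
    and c: "c \<in> (\<Pi>\<^sub>E x\<in>X. atlas (M x))" "fst w \<in> cdom (prod_chart X c)"
  shows "snd (can_T X M w x) (c x) = (\<lambda>i\<in>cind (c x). snd w (prod_chart X c) (x, i))"
proof -
  have cA: "prod_chart X c \<in> atlas P" using c(1) by (auto simp: atlas_prod_mfd)
  have cx: "c x \<in> atlas (M x)" using c(1) x by (rule PiE_mem)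
  have fw: "fst w \<in> points P" using tangent_points_fst[OF preP w] .
  have wx: "rpr x (fst w) \<in> cdom (c x)" using c(2) x fw by auto
  have "snd (can_T X M w x) (c x) = local_deriv (prod_chart X c) (c x) (rpr x) (fst w) (snd w (prod_chart X c))"
    unfolding can_T_apply[OF w x]
    by (rule tangent_map_coord(2)[where f="rpr x" and d="c x", OF preP M[OF x] smap_rpr[OF x] w cA c(2) cx wx])
  also have "\<dots> = (\<lambda>i\<in>cind (c x). snd w (prod_chart X c) (x, i))"
  proof (rule local_deriv_coords[where f="rpr x" and d="c x" and p="fst w", OF preP M[OF x] smap_rpr[OF x] cA cx _ c(2) wx])
    show "(x, i) \<in> cind (prod_chart X c)" if "i \<in> cind (c x)" for i using x that by simp
    show "cmap (c x) (rpr x q) i = cmap (prod_chart X c) q (x, i)"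
      if "q \<in> cdom (prod_chart X c)" "i \<in> cind (c x)" for q i
      using that x premfd_cdom[OF preP cA that(1)] by (simp add: cmap_prod_chart)
  qed
  finally show ?thesis .
qed

private lemma charts_at:
  assumes "\<And>x. x \<in> X \<Longrightarrow> p x \<in> points (M x)"
  obtains c where "c \<in> (\<Pi>\<^sub>E x\<in>X. atlas (M x))" "\<And>x. x \<in> X \<Longrightarrow> p x \<in> cdom (c x)"
proof -
  have "\<exists>c. c \<in> atlas (M x) \<and> p x \<in> cdom c" if "x \<in> X" for x
    using premfd_chart_at[OF M[OF that] assms[OF that]] by blast
  then obtain c where "\<And>x. x \<in> X \<Longrightarrow> c x \<in> atlas (M x)" "\<And>x. x \<in> X \<Longrightarrow> p x \<in> cdom (c x)" by metis
  then show thesis using that[of "restrict c X"] by auto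
qed

text \<open>Together the blocks selected by the projections exhaust the coordinates of a product
  chart, and one chart determines a tangent vector.\<close>

lemma can_T_inj:
  assumes w: "w \<in> points (tangent_bundle P)" "w' \<in> points (tangent_bundle P)"
    and eq: "can_T X M w = can_T X M w'"
  shows "w = w'"
proof -
  have P: "fst w \<in> points P" "fst w' \<in> points P" using tangent_points_fst[OF preP] w by auto
  have f: "fst w = fst w'"
  proof (rule PiE_ext)
    show "fst w \<in> (\<Pi>\<^sub>E x\<in>X. points (M x))" "fst w' \<in> (\<Pi>\<^sub>E x\<in>X. points (M x))"
      using P by (simp_all add: points_prod_mfd)
    show "fst w x = fst w' x" if "x \<in> X" for x
      using can_T_fst[OF w(1) that] can_T_fst[OF w(2) that] eq by simp
  qed
  obtain c where c: "c \<in> (\<Pi>\<^sub>E x\<in>X. atlas (M x))" "\<And>x. x \<in> X \<Longrightarrow> fst w x \<in> cdom (c x)"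
    using charts_at[of "fst w"] P(1) unfolding points_prod_mfd by (metis PiE_mem)
  have cA: "prod_chart X c \<in> atlas P" using c(1) by (auto simp: atlas_prod_mfd)
  have wc: "fst w \<in> cdom (prod_chart X c)"
    using c(2) P(1) by (auto simp: points_prod_mfd PiE_iff)
  have sw: "snd w \<in> tangent_space P (fst w)" "snd w' \<in> tangent_space P (fst w')"
    using w by (auto simp: topspace_tangent[OF preP])
  show ?thesis
  proof (rule tangent_points_eqI[OF preP w f cA wc])
    show "snd w (prod_chart X c) = snd w' (prod_chart X c)"
    proof (rule PiE_ext)
      show "snd w (prod_chart X c) \<in> cind (prod_chart X c) \<rightarrow>\<^sub>E UNIV"
        by (rule tangent_space_coord[OF sw(1) cA wc])
      show "snd w' (prod_chart X c) \<in> cind (prod_chart X c) \<rightarrow>\<^sub>E UNIV"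
        by (rule tangent_space_coord[OF sw(2) cA]) (use wc f in simp)
      fix k assume "k \<in> cind (prod_chart X c)"
      then obtain x i where k: "k = (x, i)" "x \<in> X" "i \<in> cind (c x)" by auto
      have "(\<lambda>i\<in>cind (c x). snd w (prod_chart X c) (x, i)) = (\<lambda>i\<in>cind (c x). snd w' (prod_chart X c) (x, i))"
        using can_T_coord[OF w(1) k(2) c(1) wc] can_T_coord[OF w(2) k(2) c(1)] wc f eq by simp
      from fun_cong[OF this, of i] show "snd w (prod_chart X c) k = snd w' (prod_chart X c) k"
        using k by simp
    qed
  qed
qed

lemma can_T_surj:
  assumes y: "y \<in> points TP"
  obtains w where "w \<in> points (tangent_bundle P)" "can_T X M w = y"
proof -
  have yx: "y x \<in> points (tangent_bundle (M x))" if "x \<in> X" for x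
    using y that unfolding points_prod_mfd by (rule PiE_mem)
  obtain c where c: "c \<in> (\<Pi>\<^sub>E x\<in>X. atlas (M x))" "\<And>x. x \<in> X \<Longrightarrow> fst (y x) \<in> cdom (c x)"
    using charts_at[of "\<lambda>x. fst (y x)"] tangent_points_fst[OF M yx] by metis
  have cA: "prod_chart X c \<in> atlas P" using c(1) by (auto simp: atlas_prod_mfd)
  have cx: "c x \<in> atlas (M x)" if "x \<in> X" for x using c(1) that by (rule PiE_mem)
  define p where "p = (\<lambda>x\<in>X. fst (y x))"
  \<comment> \<open>The coordinate vectors of the \<open>y x\<close> in the charts
    \<open>c x\<close>, laid side by side, prescribe the vector in the product chart.\<close>
  define \<xi> where "\<xi> = (\<lambda>(x, i)\<in>cind (prod_chart X c). snd (y x) (c x) i)"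
  have pc: "p \<in> cdom (prod_chart X c)" using c(2) by (simp add: p_def)
  define w where "w = (p, push_coords (prod_chart X c) P (\<lambda>q. q) p \<xi>)"
  have "p \<in> points P" using premfd_cdom[OF preP cA pc] .
  then have w: "w \<in> points (tangent_bundle P)"
    using push_coords_tangent[OF preP preP smap_id[OF preP] cA pc]
    by (simp add: w_def topspace_tangent[OF preP])
  have sw: "snd w (prod_chart X c) = \<xi>"
    unfolding w_def snd_conv by (rule push_coords_id[OF preP cA pc]) (simp add: \<xi>_def)
  have wc: "fst w \<in> cdom (prod_chart X c)" using pc by (simp add: w_def)
  have "can_T X M w = y"
  proof (rule PiE_ext)
    show "can_T X M w \<in> (\<Pi>\<^sub>E x\<in>X. points (tangent_bundle (M x)))"
      "y \<in> (\<Pi>\<^sub>E x\<in>X. points (tangent_bundle (M x)))"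
      using can_T_points[OF w] y by (simp_all add: points_prod_mfd)
    fix x assume x: "x \<in> X"
    show "can_T X M w x = y x"
    proof (rule tangent_points_eqI[OF M[OF x] _ yx[OF x] _ cx[OF x]])
      show "can_T X M w x \<in> points (tangent_bundle (M x))"
        using can_T_points[OF w] x unfolding points_prod_mfd by (rule PiE_mem)
      show f: "fst (can_T X M w x) = fst (y x)" using can_T_fst[OF w x] x by (simp add: w_def p_def)
      show "fst (can_T X M w x) \<in> cdom (c x)" using f c(2)[OF x] by simp
      have "snd (y x) \<in> tangent_space (M x) (fst (y x))"
        using yx[OF x] by (auto simp: topspace_tangent[OF M[OF x]])
      from tangent_space_coord[OF this cx[OF x] c(2)[OF x]]
      have ye: "snd (y x) (c x) \<in> cind (c x) \<rightarrow>\<^sub>E UNIV" .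
      show "snd (can_T X M w x) (c x) = snd (y x) (c x)"
        unfolding can_T_coord[OF w x c(1) wc] sw
        by (rule PiE_ext[OF _ ye]) (use x in \<open>auto simp: \<xi>_def\<close>)
    qed
  qed
  with w show thesis by (rule that)
qed

lemma can_T_bij: "bij_betw (can_T X M) (points (tangent_bundle P)) (points TP)"
proof (rule bij_betw_imageI)
  show "inj_on (can_T X M) (points (tangent_bundle P))" by (rule inj_onI) (rule can_T_inj)
  show "can_T X M ` points (tangent_bundle P) = points TP"
  proof
    show "can_T X M ` points (tangent_bundle P) \<subseteq> points TP" using can_T_points by blast
    show "points TP \<subseteq> can_T X M ` points (tangent_bundle P)"
    proof
      fix y assume "y \<in> points TP"
      then obtain w where "w \<in> points (tangent_bundle P)" "can_T X M w = y" by (rule can_T_surj)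
      then show "y \<in> can_T X M ` points (tangent_bundle P)" by blast
    qed
  qed
qed

text \<open>In product charts the inverse of \<open>can_T\<close> only reindexes coordinates.\<close>
lemma smap_can_T_inverse: "smap TP (tangent_bundle P) (inverse_map (tangent_bundle P) TP (can_T X M))"
proof (rule smapI[OF premfd_prod_mfd[OF X premfd_tangent_bundle[OF M]] premfd_tangent_bundle[OF preP]])
  let ?inv = "inverse_map (tangent_bundle P) TP (can_T X M)"
  note inv = bij_betw_inverse_map[OF can_T_bij]
  have TPp: "premfd TP" by (rule premfd_prod_mfd[OF X premfd_tangent_bundle[OF M]])
  fix y assume y: "y \<in> points TP"
  have yx: "y x \<in> points (tangent_bundle (M x))" if "x \<in> X" for x
    using y that unfolding points_prod_mfd by (rule PiE_mem)
  obtain c where c: "c \<in> (\<Pi>\<^sub>E x\<in>X. atlas (M x))" "\<And>x. x \<in> X \<Longrightarrow> fst (y x) \<in> cdom (c x)"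
    using charts_at[of "\<lambda>x. fst (y x)"] tangent_points_fst[OF M yx] by metis
  have cx: "c x \<in> atlas (M x)" if "x \<in> X" for x using c(1) that by (rule PiE_mem)
  have cA: "prod_chart X c \<in> atlas P" using c(1) by (auto simp: atlas_prod_mfd)
  define E where "E = prod_chart X (\<lambda>x\<in>X. tangent_chart (M x) (c x))"
  define D where "D = tangent_chart P (prod_chart X c)"
  have EA: "E \<in> atlas TP"
    unfolding E_def atlas_prod_mfd by (intro imageI restrict_PiE_iff[THEN iffD2] ballI)
      (simp add: atlas_tangent cx)
  have DA: "D \<in> atlas (tangent_bundle P)" unfolding D_def atlas_tangent using cA by blast
  have Edom: "z \<in> cdom E \<longleftrightarrow> z \<in> extensional X \<and> (\<forall>x\<in>X. z x \<in> cdom (tangent_chart (M x) (c x)))" for z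
    by (auto simp: E_def PiE_iff)
  have yE: "y \<in> cdom E"
    unfolding Edom using y c(2) yx
    by (auto simp: points_prod_mfd PiE_iff cdom_tangent_chart[OF M cx] topspace_tangent[OF M])
  have Eind: "cind E = Sigma X (\<lambda>x. cind (c x) <+> cind (c x))"
    unfolding E_def prod_chart_sel by (rule Sigma_cong) auto
  have Dind: "cind D = Sigma X (\<lambda>x. cind (c x)) <+> Sigma X (\<lambda>x. cind (c x))"
    by (simp add: D_def)
  \<comment> \<open>\<open>D\<close> separates base and fibre first and then the factors,
    \<open>E\<close> does so in the opposite order. The entries are the same, with
    \<open>Inl (x, i)\<close> matched to \<open>(x, Inl i)\<close> and likewise for
    \<open>Inr\<close>.\<close>
  have invD: "?inv z \<in> cdom D" and invc: "cmap D (?inv z) =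
      (\<lambda>k\<in>cind D. cmap E z (case_sum (\<lambda>(x, i). (x, Inl i)) (\<lambda>(x, i). (x, Inr i)) k))" if z: "z \<in> cdom E" for z
  proof -
    have zT: "z \<in> points TP" using premfd_cdom[OF TPp EA z] .
    note w = inv(1)[OF zT] and wz = inv(2)[OF zT]
    have zx: "fst (z x) \<in> cdom (c x)" if "x \<in> X" for x
      using z that cdom_tangent_chart[OF M[OF that] cx[OF that]] unfolding Edom by blast
    have f: "fst (?inv z) x = fst (z x)" if "x \<in> X" for x
      using can_T_fst[OF w that] wz by simp
    have "fst (?inv z) \<in> points P" using tangent_points_fst[OF preP w] .
    then have fc: "fst (?inv z) \<in> cdom (prod_chart X c)"
      using f zx by (auto simp: points_prod_mfd PiE_iff)
    then show "?inv z \<in> cdom D"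
      using w unfolding D_def cdom_tangent_chart[OF preP cA] topspace_tangent[OF preP] by auto
    have s: "snd (z x) (c x) = (\<lambda>i\<in>cind (c x). snd (?inv z) (prod_chart X c) (x, i))" if "x \<in> X" for x
      using can_T_coord[OF w that c(1) fc] wz by simp
    have Ez: "cmap E z (x, k) = cmap (tangent_chart (M x) (c x)) (z x) k"
      if "x \<in> X" "k \<in> cind (c x) <+> cind (c x)" for x k
      unfolding E_def using that by (subst cmap_prod_chart) auto
    show "cmap D (?inv z) = (\<lambda>k\<in>cind D. cmap E z (case_sum (\<lambda>(x, i). (x, Inl i)) (\<lambda>(x, i). (x, Inr i)) k))"
    proof (rule PiE_ext)
      show "cmap D (?inv z) \<in> cind D \<rightarrow>\<^sub>E UNIV" by (simp add: D_def cmap_tangent_chart)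
      fix k assume "k \<in> cind D"
      then consider (l) x i where "k = Inl (x, i)" "x \<in> X" "i \<in> cind (c x)"
        | (r) x i where "k = Inr (x, i)" "x \<in> X" "i \<in> cind (c x)"
        unfolding Dind by blast
      then show "cmap D (?inv z) k =
          (\<lambda>k\<in>cind D. cmap E z (case_sum (\<lambda>(x, i). (x, Inl i)) (\<lambda>(x, i). (x, Inr i)) k)) k"
      proof cases
        case l
        then have "cmap E z (x, Inl i) = cmap (c x) (fst (z x)) i"
          by (simp add: Ez InlI cmap_tangent_chart)
        then show ?thesis using l by (simp add: Dind InlI D_def cmap_tangent_chart cmap_prod_chart f)
      next
        case r
        then have "cmap E z (x, Inr i) = snd (?inv z) (prod_chart X c) (x, i)"
          by (simp add: Ez InrI cmap_tangent_chart s)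
        then show ?thesis using r by (simp add: Dind InrI D_def cmap_tangent_chart)
      qed
    qed simp
  qed
  note EC = premfd_chart[OF TPp EA]
  have "smooth_vec_on (cind E) (cind D) (cmap E ` cdom E)
      (\<lambda>z. \<lambda>k\<in>cind D. z (case_sum (\<lambda>(x, i). (x, Inl i)) (\<lambda>(x, i). (x, Inr i)) k))"
    by (rule smooth_vec_on_coords[OF chart_finite[OF EC] chart_image_ext[OF EC]])
      (auto simp: Eind Dind)
  then have "smooth_vec_on (cind E) (cind D) (cmap E ` cdom E) (local_rep E D ?inv)"
  proof (rule smooth_vec_on_cong)
    fix u assume "u \<in> cmap E ` cdom E"
    then obtain z where z: "z \<in> cdom E" "u = cmap E z" by blast
    then show "(\<lambda>k\<in>cind D. u (case_sum (\<lambda>(x, i). (x, Inl i)) (\<lambda>(x, i). (x, Inr i)) k)) = local_rep E D ?inv u"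
      by (simp add: local_rep_cmap[OF EC] invc)
  qed
  then show "\<exists>c\<in>atlas TP. \<exists>d\<in>atlas (tangent_bundle P). \<exists>U. openin (mtop TP) U \<and> y \<in> U \<and> U \<subseteq> cdom c \<and>
      ?inv ` U \<subseteq> cdom d \<and> smooth_vec_on (cind c) (cind d) (cmap c ` U) (local_rep c d ?inv)"
    using EA DA yE invD chart_openin[OF EC] by blast
qed

end

section \<open>The category of hybrid phase spaces\<close>

text \<open>With \<open>prehyph\<close> and \<open>pressub\<close> this is the algebraic counterpart
  of \<open>premfd\<close>: well-formedness conditions that finite products inherit factor by
  factor.\<close>

definition precat :: "('o, 'm) cat \<Rightarrow> bool" where
  "precat C \<longleftrightarrow> (\<forall>f\<in>arr C. src C f \<in> obj C \<and> tgt C f \<in> obj C) \<and> (\<forall>s\<in>obj C. idt C s \<in> arr C) \<and>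
     (\<forall>f\<in>arr C. \<forall>g\<in>arr C. tgt C f = src C g \<longrightarrow> cmp C g f \<in> arr C)"

lemma precat_prod_cat:
  assumes "\<And>x. x \<in> X \<Longrightarrow> precat (C x)"
  shows "precat (prod_cat X C)"
  unfolding precat_def prod_cat_def cat.simps
proof (intro conjI ballI impI)
  fix f assume f: "f \<in> (\<Pi>\<^sub>E x\<in>X. arr (C x))"
  show "(\<lambda>x\<in>X. src (C x) (f x)) \<in> (\<Pi>\<^sub>E x\<in>X. obj (C x))" "(\<lambda>x\<in>X. tgt (C x) (f x)) \<in> (\<Pi>\<^sub>E x\<in>X. obj (C x))"
    using assms PiE_mem[OF f] by (simp_all add: precat_def)
  fix g assume g: "g \<in> (\<Pi>\<^sub>E x\<in>X. arr (C x))" and eq: "(\<lambda>x\<in>X. tgt (C x) (f x)) = (\<lambda>x\<in>X. src (C x) (g x))"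
  have "tgt (C x) (f x) = src (C x) (g x)" if "x \<in> X" for x
    using fun_cong[OF eq, of x] that by simp
  then show "(\<lambda>x\<in>X. cmp (C x) (g x) (f x)) \<in> (\<Pi>\<^sub>E x\<in>X. arr (C x))"
    using assms PiE_mem[OF f] PiE_mem[OF g] by (simp add: precat_def)
next
  fix s assume s: "s \<in> (\<Pi>\<^sub>E x\<in>X. obj (C x))"
  show "(\<lambda>x\<in>X. idt (C x) (s x)) \<in> (\<Pi>\<^sub>E x\<in>X. arr (C x))"
    using assms PiE_mem[OF s] by (simp add: precat_def)
qed

definition prehyph :: "('o, 'm, 'p, 'i) hyph \<Rightarrow> bool" where
  "prehyph a \<longleftrightarrow> precat (shape a) \<and> (\<forall>s\<in>obj (shape a). premfd (phase a s)) \<and>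
     (\<forall>\<gamma>\<in>arr (shape a). edge a \<gamma> \<subseteq>
        points (phase a (src (shape a) \<gamma>)) \<times> points (phase a (tgt (shape a) \<gamma>)))"

lemma hybrid_phase_space_prehyph: "hybrid_phase_space a \<Longrightarrow> prehyph a"
  by (simp add: hybrid_phase_space_def prehyph_def manifold_premfd category_def precat_def)

lemma shape_hyph_prod: "shape (hyph_prod X a) = prod_cat X (\<lambda>x. shape (a x))"
  by (simp add: hyph_prod_def)

lemma hyph_prod_sel:
  "phase (hyph_prod X a) s = prod_mfd X (\<lambda>x. phase (a x) (s x))"
  "obj (shape (hyph_prod X a)) = (\<Pi>\<^sub>E x\<in>X. obj (shape (a x)))"
  "arr (shape (hyph_prod X a)) = (\<Pi>\<^sub>E x\<in>X. arr (shape (a x)))"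
  "src (shape (hyph_prod X a)) f = (\<lambda>x\<in>X. src (shape (a x)) (f x))"
  "tgt (shape (hyph_prod X a)) f = (\<lambda>x\<in>X. tgt (shape (a x)) (f x))"
  "idt (shape (hyph_prod X a)) s = (\<lambda>x\<in>X. idt (shape (a x)) (s x))"
  "cmp (shape (hyph_prod X a)) g f = (\<lambda>x\<in>X. cmp (shape (a x)) (g x) (f x))"
  by (simp_all add: hyph_prod_def prod_cat_def)

lemma prehyph_prod:
  assumes X: "finite X" and a: "\<And>x. x \<in> X \<Longrightarrow> prehyph (a x)"
  shows "prehyph (hyph_prod X a)"
  unfolding prehyph_def
proof (intro conjI ballI)
  show "precat (shape (hyph_prod X a))"
    unfolding shape_hyph_prod by (rule precat_prod_cat) (use a in \<open>simp add: prehyph_def\<close>)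
  fix s assume s: "s \<in> obj (shape (hyph_prod X a))"
  show "premfd (phase (hyph_prod X a) s)"
    unfolding hyph_prod_sel
  proof (rule premfd_prod_mfd[OF X])
    show "premfd (phase (a x) (s x))" if "x \<in> X" for x
      using a[OF that] PiE_mem[OF s[unfolded hyph_prod_sel(2)] that] by (simp add: prehyph_def)
  qed
next
  fix \<gamma> assume \<gamma>: "\<gamma> \<in> arr (shape (hyph_prod X a))"
  show "edge (hyph_prod X a) \<gamma> \<subseteq> points (phase (hyph_prod X a) (src (shape (hyph_prod X a)) \<gamma>)) \<times>
      points (phase (hyph_prod X a) (tgt (shape (hyph_prod X a)) \<gamma>))"
  proof (rule subrelI)
    fix m m' assume "(m, m') \<in> edge (hyph_prod X a) \<gamma>"
    then have m: "m \<in> (\<Pi>\<^sub>E x\<in>X. points (phase (a x) (src (shape (a x)) (\<gamma> x))))"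
        "m' \<in> (\<Pi>\<^sub>E x\<in>X. points (phase (a x) (tgt (shape (a x)) (\<gamma> x))))"
      by (simp_all add: hyph_prod_def)
    have "(\<Pi>\<^sub>E x\<in>X. points (phase (a x) (src (shape (a x)) (\<gamma> x)))) = points (phase (hyph_prod X a) (src (shape (hyph_prod X a)) \<gamma>))"
      "(\<Pi>\<^sub>E x\<in>X. points (phase (a x) (tgt (shape (a x)) (\<gamma> x)))) = points (phase (hyph_prod X a) (tgt (shape (hyph_prod X a)) \<gamma>))"
      unfolding hyph_prod_sel points_prod_mfd by (auto intro!: PiE_cong)
    with m show "(m, m') \<in> points (phase (hyph_prod X a) (src (shape (hyph_prod X a)) \<gamma>)) \<times>
        points (phase (hyph_prod X a) (tgt (shape (hyph_prod X a)) \<gamma>))" by blast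
  qed
qed

section \<open>Morphisms of hybrid phase spaces\<close>

context
  fixes a :: "('o, 'm, 'p, 'i) hyph" and b :: "('r, 'n, 'q, 'j) hyph" and f
  assumes f: "f \<in> hyph_hom a b"
begin

lemma hyph_hom_functor: "is_functor (shape a) (shape b) (ofun f) (afun f)"
  using f by (simp add: hyph_hom_def)

lemma hyph_hom_ofun: "ofun f \<in> obj (shape a) \<rightarrow>\<^sub>E obj (shape b)"
  using hyph_hom_functor by (simp add: is_functor_def)

lemma hyph_hom_afun: "afun f \<in> arr (shape a) \<rightarrow>\<^sub>E arr (shape b)"
  using hyph_hom_functor by (simp add: is_functor_def)

lemma hyph_hom_obj: "s \<in> obj (shape a) \<Longrightarrow> ofun f s \<in> obj (shape b)"
  by (rule PiE_mem[OF hyph_hom_ofun])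

lemma hyph_hom_arr: "\<gamma> \<in> arr (shape a) \<Longrightarrow> afun f \<gamma> \<in> arr (shape b)"
  by (rule PiE_mem[OF hyph_hom_afun])

lemma hyph_hom_src: "\<gamma> \<in> arr (shape a) \<Longrightarrow> src (shape b) (afun f \<gamma>) = ofun f (src (shape a) \<gamma>)"
  and hyph_hom_tgt: "\<gamma> \<in> arr (shape a) \<Longrightarrow> tgt (shape b) (afun f \<gamma>) = ofun f (tgt (shape a) \<gamma>)"
  and hyph_hom_idt: "s \<in> obj (shape a) \<Longrightarrow> afun f (idt (shape a) s) = idt (shape b) (ofun f s)"
  and hyph_hom_cmp: "\<gamma> \<in> arr (shape a) \<Longrightarrow> \<gamma>' \<in> arr (shape a) \<Longrightarrow> tgt (shape a) \<gamma> = src (shape a) \<gamma>' \<Longrightarrow>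
    afun f (cmp (shape a) \<gamma>' \<gamma>) = cmp (shape b) (afun f \<gamma>') (afun f \<gamma>)"
  using hyph_hom_functor by (simp_all add: is_functor_def)

lemma hyph_hom_comp_at_PiE:
  "comp_at f \<in> (\<Pi>\<^sub>E s\<in>obj (shape a). smooth_maps (phase a s) (phase b (ofun f s)))"
  using f by (simp add: hyph_hom_def)

lemma hyph_hom_comp_at: "s \<in> obj (shape a) \<Longrightarrow> comp_at f s \<in> smooth_maps (phase a s) (phase b (ofun f s))"
  by (rule PiE_mem[OF hyph_hom_comp_at_PiE])

lemma hyph_hom_points:
  "s \<in> obj (shape a) \<Longrightarrow> p \<in> points (phase a s) \<Longrightarrow> comp_at f s p \<in> points (phase b (ofun f s))"
  using hyph_hom_comp_at by (auto simp: smooth_maps_iff intro: smap_points)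

lemma hyph_hom_edge:
  "\<gamma> \<in> arr (shape a) \<Longrightarrow> (p, q) \<in> edge a \<gamma> \<Longrightarrow>
    (comp_at f (src (shape a) \<gamma>) p, comp_at f (tgt (shape a) \<gamma>) q) \<in> edge b (afun f \<gamma>)"
  using f by (fastforce simp: hyph_hom_def)

text \<open>All fields of a morphism are extensional, including each \<open>comp_at f s\<close>, so
  agreement on objects, arrows and points forces equality of the records.\<close>

lemma hyph_hom_eqI:
  assumes g: "g \<in> hyph_hom a b"
    and "\<And>s. s \<in> obj (shape a) \<Longrightarrow> ofun f s = ofun g s"
    and "\<And>\<gamma>. \<gamma> \<in> arr (shape a) \<Longrightarrow> afun f \<gamma> = afun g \<gamma>"
    and "\<And>s p. s \<in> obj (shape a) \<Longrightarrow> p \<in> points (phase a s) \<Longrightarrow> comp_at f s p = comp_at g s p"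
  shows "f = g"
proof (rule hymor.equality)
  have g': "is_functor (shape a) (shape b) (ofun g) (afun g)"
    "comp_at g \<in> (\<Pi>\<^sub>E s\<in>obj (shape a). smooth_maps (phase a s) (phase b (ofun g s)))"
    using g by (simp_all add: hyph_hom_def)
  show "ofun f = ofun g"
    by (rule PiE_ext[OF hyph_hom_ofun]) (use g' assms in \<open>auto simp: is_functor_def\<close>)
  show "afun f = afun g"
    by (rule PiE_ext[OF hyph_hom_afun]) (use g' assms in \<open>auto simp: is_functor_def\<close>)
  have e: "comp_at f s = comp_at g s" if s: "s \<in> obj (shape a)" for s
  proof (rule extensionalityI)
    show "comp_at f s \<in> extensional (points (phase a s))"
      using hyph_hom_comp_at[OF s] by (simp add: smooth_maps_iff)
    show "comp_at g s \<in> extensional (points (phase a s))"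
      using PiE_mem[OF g'(2) s] by (simp add: smooth_maps_iff)
  qed (use assms s in blast)
  show "comp_at f = comp_at g"
  proof (rule extensionalityI)
    show "comp_at f \<in> extensional (obj (shape a))" using hyph_hom_comp_at_PiE by (simp add: PiE_iff)
    show "comp_at g \<in> extensional (obj (shape a))" using g'(2) by (simp add: PiE_iff)
  qed (rule e)
qed simp

end

lemma hyph_homI:
  assumes "is_functor (shape a) (shape b) (ofun f) (afun f)"
    and "comp_at f \<in> extensional (obj (shape a))"
    and "\<And>s. s \<in> obj (shape a) \<Longrightarrow> comp_at f s \<in> smooth_maps (phase a s) (phase b (ofun f s))"
    and "\<And>\<gamma> p q. \<gamma> \<in> arr (shape a) \<Longrightarrow> (p, q) \<in> edge a \<gamma> \<Longrightarrow>
      (comp_at f (src (shape a) \<gamma>) p, comp_at f (tgt (shape a) \<gamma>) q) \<in> edge b (afun f \<gamma>)"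
  shows "f \<in> hyph_hom a b"
  unfolding hyph_hom_def
proof (intro CollectI conjI ballI)
  show "comp_at f \<in> (\<Pi>\<^sub>E s\<in>obj (shape a). smooth_maps (phase a s) (phase b (ofun f s)))"
    using assms(2,3) by (simp add: PiE_iff)
  show "map_prod (comp_at f (src (shape a) \<gamma>)) (comp_at f (tgt (shape a) \<gamma>)) ` edge a \<gamma> \<subseteq> edge b (afun f \<gamma>)"
    if "\<gamma> \<in> arr (shape a)" for \<gamma>
    using assms(4)[OF that] by auto
qed (rule assms(1))

lemma prehyph_phase: "prehyph a \<Longrightarrow> s \<in> obj (shape a) \<Longrightarrow> premfd (phase a s)"
  by (simp add: prehyph_def)

lemma prehyph_arr:
  assumes "prehyph a" "\<gamma> \<in> arr (shape a)"
  shows "src (shape a) \<gamma> \<in> obj (shape a)" "tgt (shape a) \<gamma> \<in> obj (shape a)"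
  using assms by (simp_all add: prehyph_def precat_def)

lemma prehyph_idt: "prehyph a \<Longrightarrow> s \<in> obj (shape a) \<Longrightarrow> idt (shape a) s \<in> arr (shape a)"
  by (simp add: prehyph_def precat_def)

lemma prehyph_cmp:
  "prehyph a \<Longrightarrow> \<gamma> \<in> arr (shape a) \<Longrightarrow> \<gamma>' \<in> arr (shape a) \<Longrightarrow> tgt (shape a) \<gamma> = src (shape a) \<gamma>' \<Longrightarrow>
    cmp (shape a) \<gamma>' \<gamma> \<in> arr (shape a)"
  by (simp add: prehyph_def precat_def)

lemma prehyph_edge:
  assumes "prehyph a" "\<gamma> \<in> arr (shape a)" "(p, q) \<in> edge a \<gamma>"
  shows "p \<in> points (phase a (src (shape a) \<gamma>))" "q \<in> points (phase a (tgt (shape a) \<gamma>))"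
  using assms unfolding prehyph_def by blast+

lemma hyph_comp_sel:
  "s \<in> obj (shape a) \<Longrightarrow> ofun (hyph_comp a g f) s = ofun g (ofun f s)"
  "\<gamma> \<in> arr (shape a) \<Longrightarrow> afun (hyph_comp a g f) \<gamma> = afun g (afun f \<gamma>)"
  "s \<in> obj (shape a) \<Longrightarrow> p \<in> points (phase a s) \<Longrightarrow>
    comp_at (hyph_comp a g f) s p = comp_at g (ofun f s) (comp_at f s p)"
  by (simp_all add: hyph_comp_def compose_def)

lemma hyph_comp_in:
  assumes a: "prehyph a" and b: "prehyph b" and c: "prehyph c"
    and f: "f \<in> hyph_hom a b" and g: "g \<in> hyph_hom b c"
  shows "hyph_comp a g f \<in> hyph_hom a c"
proof (rule hyph_homI)
  show "is_functor (shape a) (shape c) (ofun (hyph_comp a g f)) (afun (hyph_comp a g f))"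
    unfolding is_functor_def
  proof (intro conjI ballI impI)
    show "ofun (hyph_comp a g f) \<in> obj (shape a) \<rightarrow>\<^sub>E obj (shape c)"
      using hyph_hom_obj[OF f] hyph_hom_obj[OF g] by (simp add: hyph_comp_def compose_def)
    show "afun (hyph_comp a g f) \<in> arr (shape a) \<rightarrow>\<^sub>E arr (shape c)"
      using hyph_hom_arr[OF f] hyph_hom_arr[OF g] by (simp add: hyph_comp_def compose_def)
  qed (use a in \<open>simp_all add: hyph_comp_sel prehyph_arr prehyph_idt prehyph_cmp hyph_hom_obj[OF f] hyph_hom_arr[OF f]
        hyph_hom_src[OF f] hyph_hom_src[OF g] hyph_hom_tgt[OF f] hyph_hom_tgt[OF g] hyph_hom_idt[OF f] hyph_hom_idt[OF g]
        hyph_hom_cmp[OF f] hyph_hom_cmp[OF g]\<close>)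
  show "comp_at (hyph_comp a g f) \<in> extensional (obj (shape a))" by (simp add: hyph_comp_def)
  show "comp_at (hyph_comp a g f) s \<in> smooth_maps (phase a s) (phase c (ofun (hyph_comp a g f) s))"
    if s: "s \<in> obj (shape a)" for s
  proof -
    note t = hyph_hom_obj[OF f s]
    have "smap (phase a s) (phase c (ofun g (ofun f s))) (\<lambda>p. comp_at g (ofun f s) (comp_at f s p))"
      using hyph_hom_comp_at[OF f s] hyph_hom_comp_at[OF g t] s t
      by (intro smap_compose[OF prehyph_phase[OF a s] prehyph_phase[OF b t] prehyph_phase[OF c hyph_hom_obj[OF g t]]])
        (simp_all add: smooth_maps_iff)
    from smap_restrict[OF prehyph_phase[OF a s] this] show ?thesis
      using s by (simp add: hyph_comp_def compose_def)
  qed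
  fix \<gamma> p q assume \<gamma>: "\<gamma> \<in> arr (shape a)" and pq: "(p, q) \<in> edge a \<gamma>"
  show "(comp_at (hyph_comp a g f) (src (shape a) \<gamma>) p, comp_at (hyph_comp a g f) (tgt (shape a) \<gamma>) q)
        \<in> edge c (afun (hyph_comp a g f) \<gamma>)"
    using hyph_hom_edge[OF g hyph_hom_arr[OF f \<gamma>] hyph_hom_edge[OF f \<gamma> pq]] prehyph_edge[OF a \<gamma> pq]
    by (simp add: hyph_comp_sel prehyph_arr[OF a \<gamma>] \<gamma> hyph_hom_src[OF f \<gamma>] hyph_hom_tgt[OF f \<gamma>])
qed

text \<open>The first argument of \<open>hyph_comp\<close> is the domain, so regrouping puts
  \<open>b\<close> into the inner composite, which is cut off outside \<open>b\<close>; since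
  \<open>f\<close> maps into \<open>b\<close>, nothing is lost.\<close>

lemma hyph_comp_assoc:
  assumes f: "f \<in> hyph_hom a b"
  shows "hyph_comp a h (hyph_comp a g f) = hyph_comp a (hyph_comp b h g) f"
proof (rule hymor.equality)
  show "ofun (hyph_comp a h (hyph_comp a g f)) = ofun (hyph_comp a (hyph_comp b h g) f)"
    using hyph_hom_obj[OF f] by (simp add: hyph_comp_def compose_def cong: restrict_cong)
  show "afun (hyph_comp a h (hyph_comp a g f)) = afun (hyph_comp a (hyph_comp b h g) f)"
    using hyph_hom_arr[OF f] by (simp add: hyph_comp_def compose_def cong: restrict_cong)
  show "comp_at (hyph_comp a h (hyph_comp a g f)) = comp_at (hyph_comp a (hyph_comp b h g) f)"
    using hyph_hom_obj[OF f] hyph_hom_points[OF f] by (simp add: hyph_comp_def compose_def cong: restrict_cong)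
qed simp

subsection \<open>Products\<close>

lemma hyph_pr_sel:
  "s \<in> obj (shape (hyph_prod X a)) \<Longrightarrow> ofun (hyph_pr X a x) s = s x"
  "\<gamma> \<in> arr (shape (hyph_prod X a)) \<Longrightarrow> afun (hyph_pr X a x) \<gamma> = \<gamma> x"
  "s \<in> obj (shape (hyph_prod X a)) \<Longrightarrow> m \<in> points (phase (hyph_prod X a) s) \<Longrightarrow> comp_at (hyph_pr X a x) s m = m x"
  by (simp_all add: hyph_pr_def)

text \<open>The mediating morphism for the universal property of \<open>hyph_prod\<close>.\<close>

definition hyph_pair :: "'x set \<Rightarrow> ('r, 'n, 'q, 'j) hyph \<Rightarrow> ('x \<Rightarrow> ('r, 'n, 'q, 'o, 'm, 'p) hymor) \<Rightarrow>
    ('r, 'n, 'q, 'x \<Rightarrow> 'o, 'x \<Rightarrow> 'm, 'x \<Rightarrow> 'p) hymor" where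
  "hyph_pair X b f = \<lparr>ofun = (\<lambda>s\<in>obj (shape b). \<lambda>x\<in>X. ofun (f x) s),
     afun = (\<lambda>\<gamma>\<in>arr (shape b). \<lambda>x\<in>X. afun (f x) \<gamma>),
     comp_at = (\<lambda>s\<in>obj (shape b). \<lambda>p\<in>points (phase b s). \<lambda>x\<in>X. comp_at (f x) s p)\<rparr>"

context
  fixes X :: "'x set" and a :: "'x \<Rightarrow> ('o, 'm, 'p, 'i) hyph"
  assumes X: "finite X" and a: "\<And>x. x \<in> X \<Longrightarrow> prehyph (a x)"
begin

lemma hyph_pr_in:
  assumes x: "x \<in> X"
  shows "hyph_pr X a x \<in> hyph_hom (hyph_prod X a) (a x)"
proof (rule hyph_homI)
  let ?P = "hyph_prod X a"
  note P = prehyph_prod[OF X a]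
  show "is_functor (shape ?P) (shape (a x)) (ofun (hyph_pr X a x)) (afun (hyph_pr X a x))"
    unfolding is_functor_def
  proof (intro conjI ballI impI)
    show "ofun (hyph_pr X a x) \<in> obj (shape ?P) \<rightarrow>\<^sub>E obj (shape (a x))"
      "afun (hyph_pr X a x) \<in> arr (shape ?P) \<rightarrow>\<^sub>E arr (shape (a x))"
      using x by (auto simp: hyph_pr_def hyph_prod_sel)
    fix \<gamma> assume \<gamma>: "\<gamma> \<in> arr (shape ?P)"
    show "src (shape (a x)) (afun (hyph_pr X a x) \<gamma>) = ofun (hyph_pr X a x) (src (shape ?P) \<gamma>)"
      "tgt (shape (a x)) (afun (hyph_pr X a x) \<gamma>) = ofun (hyph_pr X a x) (tgt (shape ?P) \<gamma>)"
      using prehyph_arr[OF P \<gamma>] x by (simp_all add: hyph_pr_sel \<gamma>) (simp_all add: hyph_prod_sel)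
    fix \<gamma>' assume \<gamma>': "\<gamma>' \<in> arr (shape ?P)" and eq: "tgt (shape ?P) \<gamma> = src (shape ?P) \<gamma>'"
    show "afun (hyph_pr X a x) (cmp (shape ?P) \<gamma>' \<gamma>) = cmp (shape (a x)) (afun (hyph_pr X a x) \<gamma>') (afun (hyph_pr X a x) \<gamma>)"
      using prehyph_cmp[OF P \<gamma> \<gamma>' eq] x by (simp add: hyph_pr_sel \<gamma> \<gamma>') (simp add: hyph_prod_sel)
  next
    fix s assume s: "s \<in> obj (shape ?P)"
    show "afun (hyph_pr X a x) (idt (shape ?P) s) = idt (shape (a x)) (ofun (hyph_pr X a x) s)"
      using prehyph_idt[OF P s] x by (simp add: hyph_pr_sel s) (simp add: hyph_prod_sel)
  qed
  show "comp_at (hyph_pr X a x) \<in> extensional (obj (shape ?P))" by (simp add: hyph_pr_def)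
  fix s assume s: "s \<in> obj (shape ?P)"
  have "smap (phase ?P s) (phase (a x) (s x)) (\<lambda>m. m x)"
    unfolding hyph_prod_sel
  proof (rule smap_prod_proj[where M="\<lambda>x. phase (a x) (s x)", OF X _ x])
    show "premfd (phase (a y) (s y))" if "y \<in> X" for y
      using prehyph_phase[OF a[OF that] PiE_mem[OF s[unfolded hyph_prod_sel(2)] that]] .
  qed
  from smap_restrict[OF prehyph_phase[OF P s] this]
  show "comp_at (hyph_pr X a x) s \<in> smooth_maps (phase ?P s) (phase (a x) (ofun (hyph_pr X a x) s))"
    using s by (simp add: hyph_pr_def)
next
  let ?P = "hyph_prod X a"
  note P = prehyph_prod[OF X a]
  fix \<gamma> p q assume \<gamma>: "\<gamma> \<in> arr (shape ?P)" and pq: "(p, q) \<in> edge ?P \<gamma>"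
  show "(comp_at (hyph_pr X a x) (src (shape ?P) \<gamma>) p, comp_at (hyph_pr X a x) (tgt (shape ?P) \<gamma>) q)
      \<in> edge (a x) (afun (hyph_pr X a x) \<gamma>)"
    using prehyph_arr[OF P \<gamma>] prehyph_edge[OF P \<gamma> pq] pq x
    by (simp add: hyph_pr_sel \<gamma>) (simp add: hyph_prod_def)
qed

context
  fixes b :: "('r, 'n, 'q, 'j) hyph"
  assumes b: "prehyph b"
begin

lemma hyph_pair_in:
  assumes f: "\<And>x. x \<in> X \<Longrightarrow> f x \<in> hyph_hom b (a x)"
  shows "hyph_pair X b f \<in> hyph_hom b (hyph_prod X a)"
proof (rule hyph_homI)
  let ?P = "hyph_prod X a"
  show "is_functor (shape b) (shape ?P) (ofun (hyph_pair X b f)) (afun (hyph_pair X b f))"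
    unfolding is_functor_def
  proof (intro conjI ballI impI)
    show "ofun (hyph_pair X b f) \<in> obj (shape b) \<rightarrow>\<^sub>E obj (shape ?P)"
      using hyph_hom_obj[OF f] by (simp add: hyph_pair_def hyph_prod_sel)
    show "afun (hyph_pair X b f) \<in> arr (shape b) \<rightarrow>\<^sub>E arr (shape ?P)"
      using hyph_hom_arr[OF f] by (simp add: hyph_pair_def hyph_prod_sel)
  qed (use b in \<open>simp_all add: hyph_pair_def prehyph_arr prehyph_idt prehyph_cmp hyph_prod_sel
      hyph_hom_src[OF f] hyph_hom_tgt[OF f] hyph_hom_idt[OF f] hyph_hom_cmp[OF f] cong: restrict_cong\<close>)
  show "comp_at (hyph_pair X b f) \<in> extensional (obj (shape b))" by (simp add: hyph_pair_def)
  show "comp_at (hyph_pair X b f) s \<in> smooth_maps (phase b s) (phase ?P (ofun (hyph_pair X b f) s))"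
    if s: "s \<in> obj (shape b)" for s
  proof -
    let ?N = "prod_mfd X (\<lambda>x. phase (a x) (ofun (hyph_pair X b f) s x))"
    have "smap (phase b s) ?N (\<lambda>p. \<lambda>x\<in>X. comp_at (f x) s p)"
    proof (rule smap_into_prod[OF prehyph_phase[OF b s]])
      show "smap (phase b s) (phase (a x) (ofun (hyph_pair X b f) s x)) (\<lambda>p. (\<lambda>x\<in>X. comp_at (f x) s p) x)"
        if "x \<in> X" for x
        using hyph_hom_comp_at[OF f[OF that] s] that s by (simp add: smooth_maps_iff hyph_pair_def)
    qed simp
    from smap_restrict[OF prehyph_phase[OF b s] this] show ?thesis
      using s by (simp add: hyph_pair_def hyph_prod_sel)
  qed
  fix \<gamma> p q assume \<gamma>: "\<gamma> \<in> arr (shape b)" and pq: "(p, q) \<in> edge b \<gamma>"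
  have "comp_at (f x) (src (shape b) \<gamma>) p \<in> points (phase (a x) (src (shape (a x)) (afun (f x) \<gamma>)))"
    "comp_at (f x) (tgt (shape b) \<gamma>) q \<in> points (phase (a x) (tgt (shape (a x)) (afun (f x) \<gamma>)))"
    if "x \<in> X" for x
    using hyph_hom_points[OF f[OF that]] prehyph_arr[OF b \<gamma>] prehyph_edge[OF b \<gamma> pq]
      hyph_hom_src[OF f[OF that] \<gamma>] hyph_hom_tgt[OF f[OF that] \<gamma>] by simp_all
  then show "(comp_at (hyph_pair X b f) (src (shape b) \<gamma>) p, comp_at (hyph_pair X b f) (tgt (shape b) \<gamma>) q)
      \<in> edge ?P (afun (hyph_pair X b f) \<gamma>)"
    using prehyph_arr[OF b \<gamma>] prehyph_edge[OF b \<gamma> pq] \<gamma> hyph_hom_edge[OF f \<gamma> pq]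
    by (simp add: hyph_pair_def hyph_prod_def)
qed

text \<open>Objects, arrows and points of the product are extensional families indexed by
  \<open>X\<close>. The object part is settled before the points, since it places
  \<open>comp_at f s p\<close> and \<open>comp_at g s p\<close> in the same product.\<close>

lemma hyph_prod_unique:
  assumes f: "f \<in> hyph_hom b (hyph_prod X a)" and g: "g \<in> hyph_hom b (hyph_prod X a)"
    and eq: "\<And>x. x \<in> X \<Longrightarrow> hyph_comp b (hyph_pr X a x) f = hyph_comp b (hyph_pr X a x) g"
  shows "f = g"
proof (rule hyph_hom_eqI[OF f g])
  show o: "ofun f s = ofun g s" if s: "s \<in> obj (shape b)" for s
  proof (rule PiE_ext)
    show "ofun f s \<in> (\<Pi>\<^sub>E x\<in>X. obj (shape (a x)))" "ofun g s \<in> (\<Pi>\<^sub>E x\<in>X. obj (shape (a x)))"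
      using hyph_hom_obj[OF f s] hyph_hom_obj[OF g s] by (simp_all add: hyph_prod_sel)
    show "ofun f s x = ofun g s x" if "x \<in> X" for x
      using arg_cong[OF eq[OF that], of "\<lambda>h. ofun h s"] s
      by (simp add: hyph_comp_sel hyph_pr_sel hyph_hom_obj[OF f] hyph_hom_obj[OF g])
  qed
  show "afun f \<gamma> = afun g \<gamma>" if \<gamma>: "\<gamma> \<in> arr (shape b)" for \<gamma>
  proof (rule PiE_ext)
    show "afun f \<gamma> \<in> (\<Pi>\<^sub>E x\<in>X. arr (shape (a x)))" "afun g \<gamma> \<in> (\<Pi>\<^sub>E x\<in>X. arr (shape (a x)))"
      using hyph_hom_arr[OF f \<gamma>] hyph_hom_arr[OF g \<gamma>] by (simp_all add: hyph_prod_sel)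
    show "afun f \<gamma> x = afun g \<gamma> x" if "x \<in> X" for x
      using arg_cong[OF eq[OF that], of "\<lambda>h. afun h \<gamma>"] \<gamma>
      by (simp add: hyph_comp_sel hyph_pr_sel hyph_hom_arr[OF f] hyph_hom_arr[OF g])
  qed
  show "comp_at f s p = comp_at g s p" if s: "s \<in> obj (shape b)" and p: "p \<in> points (phase b s)" for s p
  proof (rule PiE_ext)
    show "comp_at f s p \<in> (\<Pi>\<^sub>E x\<in>X. points (phase (a x) (ofun f s x)))"
      using hyph_hom_points[OF f s p] by (simp add: hyph_prod_sel points_prod_mfd)
    show "comp_at g s p \<in> (\<Pi>\<^sub>E x\<in>X. points (phase (a x) (ofun f s x)))"
      using hyph_hom_points[OF g s p] o[OF s] by (simp add: hyph_prod_sel points_prod_mfd)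
    show "comp_at f s p x = comp_at g s p x" if "x \<in> X" for x
      using arg_cong[OF eq[OF that], of "\<lambda>h. comp_at h s p"] s p
      by (simp add: hyph_comp_sel hyph_pr_sel hyph_hom_obj[OF f] hyph_hom_obj[OF g]
          hyph_hom_points[OF f] hyph_hom_points[OF g])
  qed
qed

lemma hyph_pr_pair:
  assumes f: "\<And>x. x \<in> X \<Longrightarrow> f x \<in> hyph_hom b (a x)" and x: "x \<in> X"
  shows "hyph_comp b (hyph_pr X a x) (hyph_pair X b f) = f x"
proof (rule hyph_hom_eqI[OF hyph_comp_in[OF b prehyph_prod[OF X a] a[OF x] hyph_pair_in[OF f] hyph_pr_in[OF x]] f[OF x]])
  note P = hyph_pair_in[where f=f, OF f]
  show "ofun (hyph_comp b (hyph_pr X a x) (hyph_pair X b f)) s = ofun (f x) s" if "s \<in> obj (shape b)" for s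
    using that x by (simp add: hyph_comp_sel hyph_pr_sel hyph_hom_obj[OF P]) (simp add: hyph_pair_def)
  show "afun (hyph_comp b (hyph_pr X a x) (hyph_pair X b f)) \<gamma> = afun (f x) \<gamma>" if "\<gamma> \<in> arr (shape b)" for \<gamma>
    using that x by (simp add: hyph_comp_sel hyph_pr_sel hyph_hom_arr[OF P]) (simp add: hyph_pair_def)
  show "comp_at (hyph_comp b (hyph_pr X a x) (hyph_pair X b f)) s p = comp_at (f x) s p"
    if "s \<in> obj (shape b)" "p \<in> points (phase b s)" for s p
    using that x by (simp add: hyph_comp_sel hyph_pr_sel hyph_hom_obj[OF P] hyph_hom_points[OF P])
      (simp add: hyph_pair_def)
qed

end

end

text \<open>Rewrites a product of morphisms as a pairing, so that the universal property also covers
  the projection of \<open>ss_prod\<close>.\<close>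

lemma hyph_prod_map_eq:
  assumes f: "\<And>x. x \<in> X \<Longrightarrow> f x \<in> hyph_hom (a x) (b x)"
  shows "hyph_prod_map X a f
    = hyph_pair X (hyph_prod X a) (\<lambda>x. hyph_comp (hyph_prod X a) (f x) (hyph_pr X a x))"
  unfolding hyph_prod_map_def hyph_pair_def
  by (simp add: hyph_comp_sel hyph_pr_sel cong: restrict_cong)

section \<open>Underlying manifolds\<close>

lemma points_UU: "points (UU a) = Sigma (obj (shape a)) (\<lambda>s. points (phase a s))"
  by (simp add: UU_def points_sum_mfd)

lemma premfd_UU: "prehyph a \<Longrightarrow> premfd (UU a)"
  unfolding UU_def by (rule premfd_sum_mfd) (rule prehyph_phase)

lemma UUmap_apply: "u \<in> points (UU a) \<Longrightarrow> UUmap a f u = (ofun f (fst u), comp_at f (fst u) (snd u))"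
  by (simp add: UUmap_def)

lemma UUmap_ext: "UUmap a f \<in> extensional (points (UU a))"
  by (simp add: UUmap_def)

lemma smap_UUmap:
  assumes "prehyph a" "f \<in> hyph_hom a b"
  shows "smap (UU a) (UU b) (UUmap a f)"
  unfolding UU_def
proof (rule smap_sum_mfd[where \<phi>="ofun f" and f="comp_at f"])
  show "premfd (phase a s)" if "s \<in> obj (shape a)" for s by (rule prehyph_phase[OF assms(1) that])
  show "ofun f s \<in> obj (shape b)" if "s \<in> obj (shape a)" for s by (rule hyph_hom_obj[OF assms(2) that])
  show "smap (phase a s) (phase b (ofun f s)) (comp_at f s)" if "s \<in> obj (shape a)" for s
    using hyph_hom_comp_at[OF assms(2) that] by (simp add: smooth_maps_iff)
  show "UUmap a f (s, p) = (ofun f s, comp_at f s p)" if "s \<in> obj (shape a)" "p \<in> points (phase a s)" for s p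
    using that by (simp add: UUmap_apply points_UU)
qed

lemma UUmap_points: "prehyph a \<Longrightarrow> f \<in> hyph_hom a b \<Longrightarrow> u \<in> points (UU a) \<Longrightarrow> UUmap a f u \<in> points (UU b)"
  by (rule smap_points[OF smap_UUmap])

lemma UUmap_comp:
  assumes "f \<in> hyph_hom a b" "u \<in> points (UU a)"
  shows "UUmap a (hyph_comp a g f) u = UUmap b g (UUmap a f u)"
  using assms(2) hyph_hom_obj[OF assms(1)] hyph_hom_points[OF assms(1)]
  by (auto simp: UUmap_def points_UU hyph_comp_sel)

lemma UUmap_id: "u \<in> points (UU a) \<Longrightarrow> UUmap a (hyph_id a) u = u"
  by (auto simp: UUmap_def points_UU hyph_id_def)

text \<open>The set-theoretic inverse is smooth because it is \<open>UUmap\<close> of the inverse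
  morphism; functoriality of \<open>UUmap\<close> identifies the two.\<close>

lemma hyph_iso_UUmap:
  assumes a: "prehyph a" and b: "prehyph b" and i: "hyph_iso a b i"
  shows "bij_betw (UUmap a i) (points (UU a)) (points (UU b))"
    and "smap (UU b) (UU a) (inverse_map (UU a) (UU b) (UUmap a i))"
proof -
  obtain j where j: "j \<in> hyph_hom b a" "hyph_comp a j i = hyph_id a" "hyph_comp b i j = hyph_id b"
    and i': "i \<in> hyph_hom a b"
    using i by (auto simp: hyph_iso_def)
  have 1: "UUmap b j (UUmap a i u) = u" if "u \<in> points (UU a)" for u
    using UUmap_comp[OF i' that, of j] UUmap_id[OF that] j(2) by simp
  have 2: "UUmap a i (UUmap b j u) = u" if "u \<in> points (UU b)" for u
    using UUmap_comp[OF j(1) that, of i] UUmap_id[OF that] j(3) by simp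
  show bij: "bij_betw (UUmap a i) (points (UU a)) (points (UU b))"
    by (rule bij_betwI[where g="UUmap b j"])
      (use 1 2 UUmap_points[OF a i'] UUmap_points[OF b j(1)] in auto)
  show "smap (UU b) (UU a) (inverse_map (UU a) (UU b) (UUmap a i))"
  proof (rule smap_cong[OF premfd_UU[OF b] smap_UUmap[OF b j(1)]])
    fix u assume u: "u \<in> points (UU b)"
    show "UUmap b j u = inverse_map (UU a) (UU b) (UUmap a i) u"
      using bij_betw_inverse_map(3)[OF bij UUmap_points[OF b j(1) u]] 2[OF u] by simp
  qed
qed

section \<open>The underlying manifold of a product of hybrid phase spaces\<close>

context
  fixes X :: "'x set" and a :: "'x \<Rightarrow> ('o, 'm, 'p, 'i) hyph"
  assumes X: "finite X" and a: "\<And>x. x \<in> X \<Longrightarrow> prehyph (a x)"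
begin

private abbreviation (input) "UUP \<equiv> UU (hyph_prod X a)"
private abbreviation (input) "PUU \<equiv> prod_mfd X (\<lambda>x. UU (a x))"

private lemma preUUP: "premfd UUP" by (rule premfd_UU[OF prehyph_prod[OF X a]])
private lemma prePUU: "premfd PUU" by (rule premfd_prod_mfd[OF X premfd_UU[OF a]])

lemma can_U_apply:
  assumes "u \<in> points UUP" "x \<in> X"
  shows "can_U X a u x = UUmap (hyph_prod X a) (hyph_pr X a x) u"
  using assms by (simp add: can_U_def)

lemma can_U_pair:
  assumes "u \<in> points UUP" "x \<in> X"
  shows "can_U X a u x = (fst u x, snd u x)"
  unfolding can_U_apply[OF assms] UUmap_apply[OF assms(1)]
  using assms(1) by (auto simp: hyph_pr_sel points_UU)

lemma smap_can_U: "smap UUP PUU (can_U X a)"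
proof (rule smap_into_prod[OF preUUP])
  show "smap UUP (UU (a x)) (\<lambda>u. can_U X a u x)" if "x \<in> X" for x
    by (rule smap_cong[OF preUUP smap_UUmap[OF prehyph_prod[OF X a] hyph_pr_in[OF X a that]]])
      (use that in \<open>simp_all add: can_U_apply\<close>)
  show "can_U X a u \<in> extensional X" if "u \<in> points UUP" for u using that by (simp add: can_U_def)
qed

text \<open>The inverse of \<open>can_U\<close> made explicit: a family of labelled points is
  unzipped into its labels and its points.\<close>

private lemma can_U_inv_points:
  assumes y: "y \<in> points PUU"
  shows "(\<lambda>x\<in>X. fst (y x), \<lambda>x\<in>X. snd (y x)) \<in> points UUP"
    and "can_U X a (\<lambda>x\<in>X. fst (y x), \<lambda>x\<in>X. snd (y x)) = y"
proof -
  have yx: "fst (y x) \<in> obj (shape (a x))" "snd (y x) \<in> points (phase (a x) (fst (y x)))" if "x \<in> X" for x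
    using PiE_mem[OF y[unfolded points_prod_mfd] that] by (cases "y x"; simp add: points_UU)+
  show in_E: "(\<lambda>x\<in>X. fst (y x), \<lambda>x\<in>X. snd (y x)) \<in> points UUP"
    using yx by (simp add: points_UU hyph_prod_sel points_prod_mfd)
  show "can_U X a (\<lambda>x\<in>X. fst (y x), \<lambda>x\<in>X. snd (y x)) = y"
  proof (rule PiE_ext)
    show "can_U X a (\<lambda>x\<in>X. fst (y x), \<lambda>x\<in>X. snd (y x)) \<in> (\<Pi>\<^sub>E x\<in>X. points (UU (a x)))"
      using smap_points[OF smap_can_U in_E] unfolding points_prod_mfd .
    show "y \<in> (\<Pi>\<^sub>E x\<in>X. points (UU (a x)))" using y unfolding points_prod_mfd .
    show "can_U X a (\<lambda>x\<in>X. fst (y x), \<lambda>x\<in>X. snd (y x)) x = y x" if "x \<in> X" for x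
      using can_U_pair[OF in_E that] that by simp
  qed
qed

private lemma can_U_inj:
  assumes u: "u \<in> points UUP" "u' \<in> points UUP" and eq: "can_U X a u = can_U X a u'"
  shows "u = u'"
proof -
  have c: "fst u x = fst u' x \<and> snd u x = snd u' x" if "x \<in> X" for x
    using can_U_pair[OF u(1) that] can_U_pair[OF u(2) that] eq by simp
  have m: "fst u \<in> extensional X" "snd u \<in> extensional X" "fst u' \<in> extensional X" "snd u' \<in> extensional X"
    using u by (auto simp: points_UU hyph_prod_sel points_prod_mfd PiE_iff)
  have "fst u = fst u'" "snd u = snd u'"
    using c extensionalityI[OF m(1,3)] extensionalityI[OF m(2,4)] by blast+
  then show ?thesis by (rule prod_eqI)
qed

lemma can_U_bij: "bij_betw (can_U X a) (points UUP) (points PUU)"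
proof (rule bij_betw_imageI)
  show "inj_on (can_U X a) (points UUP)" by (rule inj_onI) (rule can_U_inj)
  show "can_U X a ` points UUP = points PUU"
  proof
    show "can_U X a ` points UUP \<subseteq> points PUU" using smap_points[OF smap_can_U] by blast
    show "points PUU \<subseteq> can_U X a ` points UUP"
    proof
      fix y assume y: "y \<in> points PUU"
      show "y \<in> can_U X a ` points UUP"
        using imageI[OF can_U_inv_points(1)[OF y], of "can_U X a"] by (simp only: can_U_inv_points(2)[OF y])
    qed
  qed
qed

text \<open>A disjoint union separates its summands, so around \<open>y\<close> the labels are
  constantly \<open>s\<close>. There the product of the sum charts and the sum chart of the product
  chart have the same coordinates, and the inverse is expressed by the identity.\<close>

lemma smap_can_U_inverse: "smap PUU UUP (inverse_map UUP PUU (can_U X a))"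
proof (rule smapI[OF prePUU preUUP])
  let ?inv = "inverse_map UUP PUU (can_U X a)"
  have inv: "?inv y = (\<lambda>x\<in>X. fst (y x), \<lambda>x\<in>X. snd (y x))" if "y \<in> points PUU" for y
    using bij_betw_inverse_map(3)[OF can_U_bij can_U_inv_points(1)[OF that]] can_U_inv_points(2)[OF that] by simp
  fix y assume y: "y \<in> points PUU"
  define s where "s = (\<lambda>x\<in>X. fst (y x))"
  have sO: "s \<in> (\<Pi>\<^sub>E x\<in>X. obj (shape (a x)))" and
    yx: "\<And>x. x \<in> X \<Longrightarrow> snd (y x) \<in> points (phase (a x) (s x))"
  proof -
    have yU: "y x \<in> points (UU (a x))" if "x \<in> X" for x
      using PiE_mem[OF y[unfolded points_prod_mfd] that] .
    show "s \<in> (\<Pi>\<^sub>E x\<in>X. obj (shape (a x)))"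
      unfolding s_def restrict_PiE_iff
    proof
      show "fst (y x) \<in> obj (shape (a x))" if "x \<in> X" for x
        using yU[OF that] by (cases "y x") (simp add: points_UU)
    qed
    show "snd (y x) \<in> points (phase (a x) (s x))" if "x \<in> X" for x
      using yU[OF that] that by (cases "y x") (simp add: points_UU s_def)
  qed
  have "\<exists>c. c \<in> atlas (phase (a x) (s x)) \<and> snd (y x) \<in> cdom c" if "x \<in> X" for x
    using premfd_chart_at[OF prehyph_phase[OF a[OF that] PiE_mem[OF sO that]] yx[OF that]] by blast
  then obtain c where c: "\<And>x. x \<in> X \<Longrightarrow> c x \<in> atlas (phase (a x) (s x))"
      "\<And>x. x \<in> X \<Longrightarrow> snd (y x) \<in> cdom (c x)" by metis
  define C where "C = prod_chart X (\<lambda>x\<in>X. sum_chart (s x) (c x))"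
  define D where "D = sum_chart s (prod_chart X (\<lambda>x\<in>X. c x))"
  have CA: "C \<in> atlas PUU"
    unfolding C_def atlas_prod_mfd UU_def atlas_sum_mfd
    by (intro imageI restrict_PiE_iff[THEN iffD2] ballI UN_I[OF PiE_mem[OF sO]] c(1))
  have "prod_chart X (\<lambda>x\<in>X. c x) \<in> atlas (phase (hyph_prod X a) s)"
    unfolding hyph_prod_sel atlas_prod_mfd using c(1) by auto
  then have DA: "D \<in> atlas UUP"
    using sO unfolding D_def UU_def atlas_sum_mfd hyph_prod_sel by blast
  have Cdom: "z \<in> cdom C \<longleftrightarrow> z \<in> extensional X \<and> (\<forall>x\<in>X. fst (z x) = s x \<and> snd (z x) \<in> cdom (c x))" for z
    by (auto simp: C_def PiE_iff sum_chart_def mem_Times_iff)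
  have yC: "y \<in> cdom C" using y c(2) by (simp add: Cdom points_prod_mfd PiE_iff s_def)
  have ind: "cind C = cind D"
    unfolding C_def D_def sum_chart_def prod_chart_sel chart.simps by (rule Sigma_cong) auto
  note CC = premfd_chart[OF prePUU CA]
  have invD: "?inv z \<in> cdom D" and invc: "cmap D (?inv z) = cmap C z" if z: "z \<in> cdom C" for z
  proof -
    have fz: "(\<lambda>x\<in>X. fst (z x)) = s"
      using z by (auto simp: Cdom s_def intro!: restrict_ext)
    have i: "?inv z = (s, \<lambda>x\<in>X. snd (z x))"
      using inv[OF premfd_cdom[OF prePUU CA z]] fz by simp
    show "?inv z \<in> cdom D" using z unfolding i D_def by (simp add: sum_chart_def Cdom)
    show "cmap D (?inv z) = cmap C z"
    proof (rule PiE_ext)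
      show "cmap C z \<in> cind D \<rightarrow>\<^sub>E UNIV" unfolding ind[symmetric] by (rule chart_cmap_ext[OF CC z])
      show "cmap D (?inv z) \<in> cind D \<rightarrow>\<^sub>E UNIV"
        unfolding i D_def by (simp add: sum_chart_def prod_chart_def)
      fix k assume "k \<in> cind D"
      then obtain x j where k: "k = (x, j)" "x \<in> X" "j \<in> cind (c x)" by (auto simp: D_def sum_chart_def)
      then show "cmap D (?inv z) k = cmap C z k"
        unfolding i C_def D_def by (simp add: sum_chart_def cmap_prod_chart)
    qed
  qed
  have "smooth_vec_on (cind C) (cind D) (cmap C ` cdom C) (\<lambda>z. \<lambda>k\<in>cind D. z k)"
    by (rule smooth_vec_on_coords[OF chart_finite[OF CC] chart_image_ext[OF CC]]) (simp add: ind)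
  then have "smooth_vec_on (cind C) (cind D) (cmap C ` cdom C) (local_rep C D ?inv)"
  proof (rule smooth_vec_on_cong)
    fix u assume "u \<in> cmap C ` cdom C"
    then obtain z where z: "z \<in> cdom C" "u = cmap C z" by blast
    show "(\<lambda>k\<in>cind D. u k) = local_rep C D ?inv u"
      unfolding z(2) local_rep_cmap[OF CC z(1)] invc[OF z(1)] ind[symmetric]
      by (rule PiE_restrict[OF chart_cmap_ext[OF CC z(1)]])
  qed
  then show "\<exists>c\<in>atlas PUU. \<exists>d\<in>atlas UUP. \<exists>U. openin (mtop PUU) U \<and> y \<in> U \<and> U \<subseteq> cdom c \<and>
      ?inv ` U \<subseteq> cdom d \<and> smooth_vec_on (cind c) (cind d) (cmap c ` U) (local_rep c d ?inv)"
    using CA DA yC invD chart_openin[OF CC] by blast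
qed

text \<open>The projection to \<open>x\<close> is the \<open>x\<close>-th component of
  \<open>can_U\<close>, so by functoriality its tangent map is the \<open>x\<close>-th component of
  \<open>can_T\<close> after the tangent map of \<open>can_U\<close>. Both of these are injective:
  \<open>can_T\<close> by comparing coordinates, the other because the smooth inverse of
  \<open>can_U\<close> provides a left inverse.\<close>

lemma tangent_UU_prod_eqI:
  assumes w: "w \<in> points (tangent_bundle UUP)" "w' \<in> points (tangent_bundle UUP)"
    and eq: "\<And>x. x \<in> X \<Longrightarrow> tangent_map UUP (UU (a x)) (UUmap (hyph_prod X a) (hyph_pr X a x)) w =
      tangent_map UUP (UU (a x)) (UUmap (hyph_prod X a) (hyph_pr X a x)) w'"
  shows "w = w'"
proof -
  let ?T = "tangent_map UUP PUU (can_U X a)"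
  have M: "premfd (UU (a x))" if "x \<in> X" for x by (rule premfd_UU[OF a[OF that]])
  have T: "?T w \<in> points (tangent_bundle PUU)" if "w \<in> points (tangent_bundle UUP)" for w
    by (rule tangent_map_points[OF preUUP prePUU smap_can_U that])
  have c: "can_T X (\<lambda>x. UU (a x)) (?T w) x = tangent_map UUP (UU (a x)) (UUmap (hyph_prod X a) (hyph_pr X a x)) w"
    if w: "w \<in> points (tangent_bundle UUP)" and x: "x \<in> X" for w x
  proof -
    have s: "smap PUU (UU (a x)) (\<lambda>m\<in>points PUU. m x)"
      by (rule smap_cong[OF prePUU smap_prod_proj[OF X M x]]) auto
    have "tangent_map UUP (UU (a x)) (UUmap (hyph_prod X a) (hyph_pr X a x)) w
        = tangent_map PUU (UU (a x)) (\<lambda>m\<in>points PUU. m x) (?T w)"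
      by (rule tangent_map_compose[OF preUUP prePUU M[OF x] smap_can_U s _ w])
        (use smap_points[OF smap_can_U] x in \<open>simp add: can_U_apply\<close>)
    then show ?thesis using T[OF w] x by (simp add: can_T_def)
  qed
  have cT: "can_T X (\<lambda>x. UU (a x)) (?T w) = can_T X (\<lambda>x. UU (a x)) (?T w')"
  proof (rule PiE_ext)
    show "can_T X (\<lambda>x. UU (a x)) (?T w) \<in> (\<Pi>\<^sub>E x\<in>X. points (tangent_bundle (UU (a x))))"
      "can_T X (\<lambda>x. UU (a x)) (?T w') \<in> (\<Pi>\<^sub>E x\<in>X. points (tangent_bundle (UU (a x))))"
      using can_T_points[where M="\<lambda>x. UU (a x)", OF X M T[OF w(1)]] can_T_points[where M="\<lambda>x. UU (a x)", OF X M T[OF w(2)]] by (simp_all add: points_prod_mfd)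
  qed (use c[OF w(1)] c[OF w(2)] eq in simp)
  have e: "?T w = ?T w'" by (rule can_T_inj[where M="\<lambda>x. UU (a x)", OF X M T[OF w(1)] T[OF w(2)] cT])
  let ?S = "tangent_map PUU UUP (inverse_map UUP PUU (can_U X a))"
  have "?S (?T w) = w" if w: "w \<in> points (tangent_bundle UUP)" for w
  proof -
    have "tangent_map UUP UUP (\<lambda>u. u) w = ?S (?T w)"
      by (rule tangent_map_compose[OF preUUP prePUU preUUP smap_can_U smap_can_U_inverse _ w])
        (simp add: bij_betw_inverse_map(3)[OF can_U_bij])
    then show ?thesis using tangent_map_id[OF preUUP _ w, of "\<lambda>u. u"] by simp
  qed
  then show ?thesis using e w by metis
qed

end

section \<open>Hybrid surjective submersions and control\<close>

definition pressub :: "('o, 'm, 'p, 'i, 'r, 'n, 'q, 'j) ssub \<Rightarrow> bool" where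
  "pressub a \<longleftrightarrow> prehyph (tot a) \<and> prehyph (st a) \<and> prj a \<in> hyph_hom (tot a) (st a)"

lemma hybrid_ssub_pressub: "hybrid_ssub a \<Longrightarrow> pressub a"
  by (simp add: hybrid_ssub_def pressub_def hybrid_phase_space_prehyph)

lemma pressubD:
  assumes "pressub a"
  shows "prehyph (tot a)" "prehyph (st a)" "prj a \<in> hyph_hom (tot a) (st a)"
    "premfd (UU (tot a))" "premfd (UU (st a))"
  using assms by (simp_all add: pressub_def premfd_UU)

lemma ss_homD:
  assumes "f \<in> ss_hom a b"
  shows "mtot f \<in> hyph_hom (tot a) (tot b)" "mst f \<in> hyph_hom (st a) (st b)"
    "hyph_comp (tot a) (prj b) (mtot f) = hyph_comp (tot a) (mst f) (prj a)"
  using assms by (simp_all add: ss_hom_def)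

text \<open>Since \<open>V\<close> maps into the tangent bundle, \<open>tangent_proj\<close> may be
  replaced by \<open>fst\<close>, and equality of extensional maps by equality at each
  point.\<close>

lemma Crl_iff:
  assumes a: "pressub a"
  shows "V \<in> Crl a \<longleftrightarrow> smap (UU (tot a)) (tangent_bundle (UU (st a))) V \<and> V \<in> extensional (points (UU (tot a))) \<and>
    (\<forall>u\<in>points (UU (tot a)). fst (V u) = UUmap (tot a) (prj a) u)"
proof -
  have "UUmap (tot a) (prj a) = compose (points (UU (tot a))) (tangent_proj (UU (st a))) V \<longleftrightarrow>
      (\<forall>u\<in>points (UU (tot a)). fst (V u) = UUmap (tot a) (prj a) u)"
    if V: "smap (UU (tot a)) (tangent_bundle (UU (st a))) V"
  proof -
    have "compose (points (UU (tot a))) (tangent_proj (UU (st a))) V u = fst (V u)" if "u \<in> points (UU (tot a))" for u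
      using smap_points[OF V that] that by (simp add: compose_def tangent_proj_def)
    moreover have "compose (points (UU (tot a))) (tangent_proj (UU (st a))) V \<in> extensional (points (UU (tot a)))"
      by (rule compose_extensional)
    ultimately show ?thesis
      using extensionalityI[OF UUmap_ext] by metis
  qed
  then show ?thesis by (auto simp: Crl_def smooth_maps_iff)
qed

lemma compose_eq_iff: "compose S g h = compose S g' h' \<longleftrightarrow> (\<forall>u\<in>S. g (h u) = g' (h' u))"
  by (auto simp: compose_def fun_eq_iff)

lemma Crl_rel_iff:
  "(V, W) \<in> Crl_rel a b f \<longleftrightarrow> V \<in> Crl a \<and> W \<in> Crl b \<and>
    (\<forall>u\<in>points (UU (tot a)). tangent_map (UU (st a)) (UU (st b)) (UUmap (st a) (mst f)) (V u) =
      W (UUmap (tot a) (mtot f) u))"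
  by (simp add: Crl_rel_def compose_eq_iff)

subsection \<open>Interconnections\<close>

context
  fixes a :: "('o, 'm, 'p, 'i, 'r, 'n, 'q, 'j) ssub" and b :: "('o1, 'm1, 'p1, 'i1, 'r1, 'n1, 'q1, 'j1) ssub" and i
  assumes a: "pressub a" and b: "pressub b" and i: "interconnection a b i"
begin

private abbreviation (input) "iU \<equiv> UUmap (st a) (mst i)"
private abbreviation (input) "jU \<equiv> inverse_map (UU (st a)) (UU (st b)) iU"

private lemma hom: "i \<in> ss_hom a b"
  using i by (simp add: interconnection_def)

private lemma smap_f: "smap (UU (st a)) (UU (st b)) iU"
  by (rule smap_UUmap[OF pressubD(2)[OF a] ss_homD(2)[OF hom]])

private lemma iso: "bij_betw iU (points (UU (st a))) (points (UU (st b)))" "smap (UU (st b)) (UU (st a)) jU"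
  using hyph_iso_UUmap[OF pressubD(2)[OF a] pressubD(2)[OF b]] i by (simp_all add: interconnection_def)

text \<open>The inverse of an interconnection on states is smooth, so functoriality supplies a left
  inverse of its tangent map.\<close>

lemma interconnection_tangent_inj:
  assumes w: "w \<in> points (tangent_bundle (UU (st a)))" "w' \<in> points (tangent_bundle (UU (st a)))"
    and eq: "tangent_map (UU (st a)) (UU (st b)) iU w = tangent_map (UU (st a)) (UU (st b)) iU w'"
  shows "w = w'"
proof -
  have "tangent_map (UU (st b)) (UU (st a)) jU (tangent_map (UU (st a)) (UU (st b)) iU w) = w"
    if w: "w \<in> points (tangent_bundle (UU (st a)))" for w
  proof -
    have "tangent_map (UU (st a)) (UU (st a)) (\<lambda>u. u) w
        = tangent_map (UU (st b)) (UU (st a)) jU (tangent_map (UU (st a)) (UU (st b)) iU w)"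
      by (rule tangent_map_compose[OF pressubD(5)[OF a] pressubD(5)[OF b] pressubD(5)[OF a] smap_f iso(2) _ w])
        (simp add: bij_betw_inverse_map(3)[OF iso(1)])
    then show ?thesis using tangent_map_id[OF pressubD(5)[OF a] _ w, of "\<lambda>u. u"] by simp
  qed
  then show ?thesis using w eq by metis
qed

context
  fixes W assumes W: "W \<in> Crl b"
begin

private lemma W': "smap (UU (tot b)) (tangent_bundle (UU (st b))) W"
  and W_fst: "\<And>u. u \<in> points (UU (tot b)) \<Longrightarrow> fst (W u) = UUmap (tot b) (prj b) u"
  using W by (simp_all add: Crl_iff[OF b])

private lemma Crl_int_apply:
  "u \<in> points (UU (tot a)) \<Longrightarrow>
    Crl_int a b i W u = tangent_map (UU (st b)) (UU (st a)) jU (W (UUmap (tot a) (mtot i) u))"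
  using W by (simp add: Crl_int_def compose_def)

private lemma i_tot: "u \<in> points (UU (tot a)) \<Longrightarrow> UUmap (tot a) (mtot i) u \<in> points (UU (tot b))"
  by (rule UUmap_points[OF pressubD(1)[OF a] ss_homD(1)[OF hom]])

lemma Crl_int_in: "Crl_int a b i W \<in> Crl a"
  unfolding Crl_iff[OF a]
proof (intro conjI ballI)
  have "smap (UU (tot a)) (tangent_bundle (UU (st a)))
      (\<lambda>u. tangent_map (UU (st b)) (UU (st a)) jU (W (UUmap (tot a) (mtot i) u)))"
    using pressubD[OF a] pressubD[OF b]
    by (intro smap_compose[OF _ _ _ smap_compose[OF _ _ _ smap_UUmap W'] smap_tangent_map[OF _ _ iso(2)]]
        premfd_tangent_bundle ss_homD(1)[OF hom]) auto
  then show "smap (UU (tot a)) (tangent_bundle (UU (st a))) (Crl_int a b i W)"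
    by (rule smap_cong[OF pressubD(4)[OF a]]) (simp add: Crl_int_apply)
  show "Crl_int a b i W \<in> extensional (points (UU (tot a)))"
    using W by (simp add: Crl_int_def compose_def)
  fix u assume u: "u \<in> points (UU (tot a))"
  \<comment> \<open>The morphism square turns \<open>p_b \<circ> i_tot\<close> into
    \<open>i_st \<circ> p_a\<close>, and the inverse of \<open>i_st\<close> leaves
    \<open>p_a\<close>.\<close>
  have "fst (Crl_int a b i W u) = jU (UUmap (tot b) (prj b) (UUmap (tot a) (mtot i) u))"
    by (simp add: Crl_int_apply[OF u] fst_tangent_map[OF smap_points[OF W' i_tot[OF u]]] W_fst[OF i_tot[OF u]])
  also have "UUmap (tot b) (prj b) (UUmap (tot a) (mtot i) u) = iU (UUmap (tot a) (prj a) u)"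
    unfolding UUmap_comp[OF ss_homD(1)[OF hom] u, symmetric] UUmap_comp[OF pressubD(3)[OF a] u, symmetric]
      ss_homD(3)[OF hom] ..
  also have "jU (iU (UUmap (tot a) (prj a) u)) = UUmap (tot a) (prj a) u"
    by (rule bij_betw_inverse_map(3)[OF iso(1) UUmap_points[OF pressubD(1,3)[OF a] u]])
  finally show "fst (Crl_int a b i W u) = UUmap (tot a) (prj a) u" .
qed

text \<open>The tangent maps of \<open>jU\<close> and \<open>iU\<close> cancel, so the pulled-back
  system is \<open>i\<close>-related to \<open>W\<close>. As the tangent map of \<open>iU\<close> is
  injective, this pins the pullback down, and later arguments never unfold the inverse in
  \<open>Crl_int\<close>.\<close>

lemma tangent_Crl_int:
  assumes u: "u \<in> points (UU (tot a))"
  shows "tangent_map (UU (st a)) (UU (st b)) iU (Crl_int a b i W u) = W (UUmap (tot a) (mtot i) u)"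
proof -
  let ?w = "W (UUmap (tot a) (mtot i) u)"
  have w: "?w \<in> points (tangent_bundle (UU (st b)))" by (rule smap_points[OF W' i_tot[OF u]])
  have "tangent_map (UU (st b)) (UU (st b)) (\<lambda>u. u) ?w
      = tangent_map (UU (st a)) (UU (st b)) iU (tangent_map (UU (st b)) (UU (st a)) jU ?w)"
    by (rule tangent_map_compose[OF pressubD(5)[OF b] pressubD(5)[OF a] pressubD(5)[OF b] iso(2) smap_f _ w])
      (simp add: bij_betw_inverse_map(2)[OF iso(1)])
  then show ?thesis
    using tangent_map_id[OF pressubD(5)[OF b] _ w, of "\<lambda>u. u"] by (simp add: Crl_int_apply[OF u])
qed

end

end

subsection \<open>Products\<close>

lemma ss_prod_sel:
  "tot (ss_prod X a) = hyph_prod X (\<lambda>x. tot (a x))"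
  "st (ss_prod X a) = hyph_prod X (\<lambda>x. st (a x))"
  "prj (ss_prod X a) = hyph_prod_map X (\<lambda>x. tot (a x)) (\<lambda>x. prj (a x))"
  by (simp_all add: ss_prod_def)

context
  fixes X :: "'x set" and a :: "'x \<Rightarrow> ('o, 'm, 'p, 'i, 'r, 'n, 'q, 'j) ssub"
  assumes X: "finite X" and a: "\<And>x. x \<in> X \<Longrightarrow> pressub (a x)"
begin

private abbreviation (input) "A \<equiv> \<lambda>x. tot (a x)"
private abbreviation (input) "B \<equiv> \<lambda>x. st (a x)"
private abbreviation (input) "M \<equiv> \<lambda>x. UU (st (a x))"
private abbreviation (input) "prA \<equiv> \<lambda>x. UUmap (hyph_prod X A) (hyph_pr X A x)"
private abbreviation (input) "prB \<equiv> \<lambda>x. UUmap (hyph_prod X B) (hyph_pr X B x)"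

private lemma A: "x \<in> X \<Longrightarrow> prehyph (A x)" and B: "x \<in> X \<Longrightarrow> prehyph (B x)"
  and prj: "x \<in> X \<Longrightarrow> prj (a x) \<in> hyph_hom (A x) (B x)"
  using a pressubD by blast+

private lemma PA: "prehyph (hyph_prod X A)" by (rule prehyph_prod[OF X A])
private lemma PB: "prehyph (hyph_prod X B)" by (rule prehyph_prod[OF X B])

private lemma pr_in:
  assumes "x \<in> X"
  shows "hyph_pr X A x \<in> hyph_hom (hyph_prod X A) (A x)" "hyph_pr X B x \<in> hyph_hom (hyph_prod X B) (B x)"
  by (rule hyph_pr_in[where a=A, OF X A assms] hyph_pr_in[where a=B, OF X B assms], assumption)+

private lemma prj_pr_in: "x \<in> X \<Longrightarrow> hyph_comp (hyph_prod X A) (prj (a x)) (hyph_pr X A x) \<in> hyph_hom (hyph_prod X A) (B x)"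
  by (rule hyph_comp_in[OF PA A B pr_in(1) prj])

private lemma ss_prod_prj:
  "prj (ss_prod X a) = hyph_pair X (hyph_prod X A) (\<lambda>x. hyph_comp (hyph_prod X A) (prj (a x)) (hyph_pr X A x))"
  unfolding ss_prod_sel by (rule hyph_prod_map_eq[where b=B]) (rule prj)

lemma pressub_ss_prod: "pressub (ss_prod X a)"
  unfolding pressub_def ss_prod_prj unfolding ss_prod_sel
  by (intro conjI PA PB hyph_pair_in[where a=B, OF X B PA prj_pr_in])

text \<open>Makes the two projections a morphism of submersions; base points of product control
  systems are compared through it.\<close>

lemma hyph_pr_prj:
  "x \<in> X \<Longrightarrow> hyph_comp (hyph_prod X A) (hyph_pr X B x) (prj (ss_prod X a))
    = hyph_comp (hyph_prod X A) (prj (a x)) (hyph_pr X A x)"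
  unfolding ss_prod_prj
  by (rule hyph_pr_pair[where a=B and f="\<lambda>x. hyph_comp (hyph_prod X A) (prj (a x)) (hyph_pr X A x)",
        OF X B PA prj_pr_in])

context
  fixes v assumes v: "v \<in> (\<Pi>\<^sub>E x\<in>X. Crl (a x))"
begin

private abbreviation (input) "PM \<equiv> prod_mfd X M"
private abbreviation (input) "PTM \<equiv> prod_mfd X (\<lambda>x. tangent_bundle (M x))"
private abbreviation (input) "EA \<equiv> UU (hyph_prod X A)"
private abbreviation (input) "EB \<equiv> UU (hyph_prod X B)"
private abbreviation (input) "asm_T \<equiv> inverse_map (tangent_bundle PM) PTM (can_T X M)"
private abbreviation (input) "jinv \<equiv> inverse_map EB PM (can_U X B)"
private abbreviation (input) "vU \<equiv> \<lambda>u. \<lambda>x\<in>X. v x (can_U X A u x)"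

private lemma vx:
  assumes "x \<in> X"
  shows "smap (UU (A x)) (tangent_bundle (M x)) (v x)"
    "\<And>u. u \<in> points (UU (A x)) \<Longrightarrow> fst (v x u) = UUmap (A x) (prj (a x)) u"
  using PiE_mem[OF v assms] by (simp_all add: Crl_iff[OF a[OF assms]])

private lemma preM: "x \<in> X \<Longrightarrow> premfd (M x)" by (rule premfd_UU[OF B])
private lemma prePM: "premfd PM" by (rule premfd_prod_mfd[OF X preM])
private lemma preEA: "premfd EA" by (rule premfd_UU[OF PA])
private lemma preEB: "premfd EB" by (rule premfd_UU[OF PB])

private lemma pr_points: "u \<in> points EA \<Longrightarrow> x \<in> X \<Longrightarrow> prA x u \<in> points (UU (A x))"
  by (rule UUmap_points[OF PA pr_in(1)])

private lemma w_apply: "u \<in> points EA \<Longrightarrow> x \<in> X \<Longrightarrow> vU u x = v x (prA x u)"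
  using can_U_apply[where a=A, OF X A] by simp

private lemma smap_w: "smap EA PTM vU"
proof (rule smap_into_prod[OF preEA])
  show "smap EA (tangent_bundle (M x)) (\<lambda>u. vU u x)" if x: "x \<in> X" for x
    by (rule smap_cong[OF preEA smap_compose[OF preEA premfd_UU[OF A[OF x]] premfd_tangent_bundle[OF preM[OF x]]
            smap_UUmap[OF PA pr_in(1)[OF x]] vx(1)[OF x]]])
      (rule w_apply[OF _ x, symmetric])
qed simp

private lemma smap_asm_T: "smap PTM (tangent_bundle PM) asm_T"
  by (rule smap_can_T_inverse[where M=M, OF X preM])

private lemma smap_jinv: "smap PM EB jinv"
  by (rule smap_can_U_inverse[where a=B, OF X B])

private lemma Crl_prod_apply:
  "u \<in> points EA \<Longrightarrow> Crl_prod X a v u = tangent_map PM EB jinv (asm_T (vU u))"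
  using v by (simp add: Crl_prod_def Let_def)

private lemma asm_points: "u \<in> points EA \<Longrightarrow> asm_T (vU u) \<in> points (tangent_bundle PM)"
  by (rule smap_points[OF smap_asm_T smap_points[OF smap_w]])

text \<open>On \<open>PM\<close> the composite of \<open>prB x\<close> with the inverse of
  \<open>can_U\<close> is the plain projection, whose tangent map is the \<open>x\<close>-th
  component of \<open>can_T\<close>; this in turn cancels \<open>asm_T\<close>. The main argument
  uses \<open>Crl_prod\<close> only through this equation and \<open>Crl_prod_in\<close>.\<close>

lemma tangent_Crl_prod:
  assumes u: "u \<in> points EA" and x: "x \<in> X"
  shows "tangent_map EB (M x) (prB x) (Crl_prod X a v u) = v x (prA x u)"
proof -
  have sr: "smap PM (M x) (\<lambda>m\<in>points PM. m x)"
    by (rule smap_cong[OF prePM smap_prod_proj[where M=M, OF X preM x]]) auto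
  have "(\<lambda>m\<in>points PM. m x) m = prB x (jinv m)" if m: "m \<in> points PM" for m
    using can_U_apply[where a=B, OF X B smap_points[OF smap_jinv m] x]
      bij_betw_inverse_map(2)[OF can_U_bij[where a=B, OF X B] m] m by simp
  then have "tangent_map EB (M x) (prB x) (tangent_map PM EB jinv (asm_T (vU u)))
      = tangent_map PM (M x) (\<lambda>m\<in>points PM. m x) (asm_T (vU u))"
    by (intro tangent_map_compose[OF prePM preEB preM[OF x] smap_jinv smap_UUmap[OF PB pr_in(2)[OF x]] _
          asm_points[OF u], symmetric])
  also have "\<dots> = can_T X M (asm_T (vU u)) x"
    using asm_points[OF u] x by (simp add: can_T_def)
  also have "can_T X M (asm_T (vU u)) = vU u"
    by (rule bij_betw_inverse_map(2)[OF can_T_bij[where M=M, OF X preM] smap_points[OF smap_w u]])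
  finally show ?thesis by (simp only: Crl_prod_apply[OF u] w_apply[OF u x])
qed

lemma Crl_prod_in: "Crl_prod X a v \<in> Crl (ss_prod X a)"
  unfolding Crl_iff[OF pressub_ss_prod]
proof (intro conjI ballI)
  have prePTM: "premfd PTM" by (rule premfd_prod_mfd[OF X premfd_tangent_bundle[OF preM]])
  have "smap EA (tangent_bundle EB) (\<lambda>u. tangent_map PM EB jinv (asm_T (vU u)))"
    by (rule smap_compose[OF preEA premfd_tangent_bundle[OF prePM] premfd_tangent_bundle[OF preEB]
          smap_compose[OF preEA prePTM premfd_tangent_bundle[OF prePM] smap_w smap_asm_T]
          smap_tangent_map[OF prePM preEB smap_jinv]])
  then have sm: "smap EA (tangent_bundle EB) (Crl_prod X a v)"
    by (rule smap_cong[OF preEA]) (simp only: Crl_prod_apply)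
  then show "smap (UU (tot (ss_prod X a))) (tangent_bundle (UU (st (ss_prod X a)))) (Crl_prod X a v)"
    by (simp add: ss_prod_sel)
  show "Crl_prod X a v \<in> extensional (points (UU (tot (ss_prod X a))))"
    using v by (simp add: Crl_prod_def Let_def ss_prod_sel)
  fix u assume "u \<in> points (UU (tot (ss_prod X a)))"
  then have u: "u \<in> points EA" by (simp add: ss_prod_sel)
  have prj_hom: "prj (ss_prod X a) \<in> hyph_hom (hyph_prod X A) (hyph_prod X B)"
    using pressubD(3)[OF pressub_ss_prod] by (simp add: ss_prod_sel)
  let ?l = "fst (Crl_prod X a v u)" and ?r = "UUmap (hyph_prod X A) (prj (ss_prod X a)) u"
  have TC: "Crl_prod X a v u \<in> points (tangent_bundle EB)" by (rule smap_points[OF sm u])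
  have l: "?l \<in> points EB" by (rule tangent_points_fst[OF preEB TC])
  have r: "?r \<in> points EB" by (rule UUmap_points[OF PA prj_hom u])
  \<comment> \<open>Points of \<open>EB\<close> coincide once all \<open>prB x\<close> agree, by
    injectivity of \<open>can_U\<close>. The base point is therefore checked factor by factor, from
    \<open>tangent_Crl_prod\<close> and the section property of \<open>v x\<close>.\<close>
  have "prB x ?l = prB x ?r" if x: "x \<in> X" for x
  proof -
    have "prB x ?l = fst (v x (prA x u))"
      using fst_tangent_map[OF TC, of "M x" "prB x"] tangent_Crl_prod[OF u x] by simp
    also have "\<dots> = UUmap (A x) (prj (a x)) (prA x u)" by (rule vx(2)[OF x pr_points[OF u x]])
    also have "\<dots> = UUmap (hyph_prod X A) (hyph_comp (hyph_prod X A) (prj (a x)) (hyph_pr X A x)) u"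
      by (rule UUmap_comp[OF pr_in(1)[OF x] u, symmetric])
    also have "\<dots> = prB x ?r"
      unfolding hyph_pr_prj[OF x, symmetric] by (rule UUmap_comp[OF prj_hom u])
    finally show ?thesis .
  qed
  then have "can_U X B ?l = can_U X B ?r"
    using l r by (simp add: can_U_def cong: restrict_cong)
  then have "?l = ?r"
    using bij_betw_imp_inj_on[OF can_U_bij[where a=B, OF X B]] l r by (auto simp: inj_on_def)
  then show "?l = UUmap (tot (ss_prod X a)) (prj (ss_prod X a)) u" by (simp only: ss_prod_sel(1))
qed

end

end

subsection \<open>The morphism of products induced by a morphism of families\<close>

context
  fixes X :: "'x set" and HX :: "'x \<Rightarrow> ('o, 'm, 'p, 'i, 'r, 'n, 'q, 'j) ssub"
    and Y :: "'y set" and HY :: "'y \<Rightarrow> ('o1, 'm1, 'p1, 'i1, 'r1, 'n1, 'q1, 'j1) ssub" and \<phi> \<Phi>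
  assumes X: "finite X" and HX: "\<And>x. x \<in> X \<Longrightarrow> pressub (HX x)"
    and Y: "finite Y" and HY: "\<And>y. y \<in> Y \<Longrightarrow> pressub (HY y)"
    and \<phi>: "\<And>x. x \<in> X \<Longrightarrow> \<phi> x \<in> Y" and \<Phi>: "\<And>x. x \<in> X \<Longrightarrow> \<Phi> x \<in> ss_hom (HY (\<phi> x)) (HX x)"
begin

private abbreviation (input) "PX \<equiv> ss_prod X HX"
private abbreviation (input) "PY \<equiv> ss_prod Y HY"
private abbreviation (input) "tX \<equiv> \<lambda>x. hyph_pr X (\<lambda>x. tot (HX x)) x"
private abbreviation (input) "sX \<equiv> \<lambda>x. hyph_pr X (\<lambda>x. st (HX x)) x"
private abbreviation (input) "tY \<equiv> \<lambda>x. hyph_pr Y (\<lambda>y. tot (HY y)) (\<phi> x)"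
private abbreviation (input) "sY \<equiv> \<lambda>x. hyph_pr Y (\<lambda>y. st (HY y)) (\<phi> x)"

private lemma tots:
  "x \<in> X \<Longrightarrow> prehyph (tot (HX x))" "x \<in> X \<Longrightarrow> prehyph (st (HX x))"
  "y \<in> Y \<Longrightarrow> prehyph (tot (HY y))" "y \<in> Y \<Longrightarrow> prehyph (st (HY y))"
  using pressubD(1,2)[OF HX] pressubD(1,2)[OF HY] by blast+

private lemma pre: "prehyph (tot PX)" "prehyph (st PX)" "prehyph (tot PY)" "prehyph (st PY)"
  "prj PX \<in> hyph_hom (tot PX) (st PX)" "prj PY \<in> hyph_hom (tot PY) (st PY)"
  using pressubD[OF pressub_ss_prod[of X HX, OF X HX]] pressubD[OF pressub_ss_prod[of Y HY, OF Y HY]] by blast+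

private lemma prs:
  assumes "x \<in> X"
  shows "tX x \<in> hyph_hom (tot PX) (tot (HX x))" "sX x \<in> hyph_hom (st PX) (st (HX x))"
    "tY x \<in> hyph_hom (tot PY) (tot (HY (\<phi> x)))" "sY x \<in> hyph_hom (st PY) (st (HY (\<phi> x)))"
  unfolding ss_prod_sel
  using hyph_pr_in[of X "\<lambda>x. tot (HX x)" x] hyph_pr_in[of X "\<lambda>x. st (HX x)" x]
    hyph_pr_in[of Y "\<lambda>y. tot (HY y)" "\<phi> x"] hyph_pr_in[of Y "\<lambda>y. st (HY y)" "\<phi> x"]
    X Y tots assms \<phi> by simp_all

private lemma legs:
  assumes x: "x \<in> X"
  shows "hyph_comp (tot PY) (mtot (\<Phi> x)) (tY x) \<in> hyph_hom (tot PY) (tot (HX x))"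
    "hyph_comp (st PY) (mst (\<Phi> x)) (sY x) \<in> hyph_hom (st PY) (st (HX x))"
  by (rule hyph_comp_in[OF pre(3) tots(3)[OF \<phi>[OF x]] tots(1)[OF x] prs(3)[OF x] ss_homD(1)[OF \<Phi>[OF x]]]
      hyph_comp_in[OF pre(4) tots(4)[OF \<phi>[OF x]] tots(2)[OF x] prs(4)[OF x] ss_homD(2)[OF \<Phi>[OF x]]])+

private definition "Pt = hyph_pair X (tot PY) (\<lambda>x. hyph_comp (tot PY) (mtot (\<Phi> x)) (tY x))"
private definition "Ps = hyph_pair X (st PY) (\<lambda>x. hyph_comp (st PY) (mst (\<Phi> x)) (sY x))"

private lemma P_in: "Pt \<in> hyph_hom (tot PY) (tot PX)" "Ps \<in> hyph_hom (st PY) (st PX)"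
  unfolding Pt_def Ps_def
  using hyph_pair_in[of X "\<lambda>x. tot (HX x)" "tot PY" "\<lambda>x. hyph_comp (tot PY) (mtot (\<Phi> x)) (tY x)"]
    hyph_pair_in[of X "\<lambda>x. st (HX x)" "st PY" "\<lambda>x. hyph_comp (st PY) (mst (\<Phi> x)) (sY x)"]
    X tots pre legs by (simp_all add: ss_prod_sel(1,2)[of X])

private lemma pr_P:
  assumes x: "x \<in> X"
  shows "hyph_comp (tot PY) (tX x) Pt = hyph_comp (tot PY) (mtot (\<Phi> x)) (tY x)"
    "hyph_comp (st PY) (sX x) Ps = hyph_comp (st PY) (mst (\<Phi> x)) (sY x)"
  unfolding Pt_def Ps_def
  using hyph_pr_pair[of X "\<lambda>x. tot (HX x)" "tot PY" "\<lambda>x. hyph_comp (tot PY) (mtot (\<Phi> x)) (tY x)"]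
    hyph_pr_pair[of X "\<lambda>x. st (HX x)" "st PY" "\<lambda>x. hyph_comp (st PY) (mst (\<Phi> x)) (sY x)"]
    X tots pre legs x by simp_all

private lemma prj_PX: "x \<in> X \<Longrightarrow> hyph_comp (tot PX) (sX x) (prj PX) = hyph_comp (tot PX) (prj (HX x)) (tX x)"
  unfolding ss_prod_sel(1) by (rule hyph_pr_prj[OF X HX])

private lemma prj_PY: "x \<in> X \<Longrightarrow> hyph_comp (tot PY) (sY x) (prj PY) = hyph_comp (tot PY) (prj (HY (\<phi> x))) (tY x)"
  unfolding ss_prod_sel(1) by (rule hyph_pr_prj[OF Y HY \<phi>])

text \<open>Both composites end in a product of state spaces, so they are compared after each
  projection, where the claim is the commuting square of \<open>\<Phi> x\<close> pasted to the
  squares of the projections.\<close>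

private lemma P_prj: "hyph_comp (tot PY) (prj PX) Pt = hyph_comp (tot PY) Ps (prj PY)"
proof (rule hyph_prod_unique[where a="\<lambda>x. st (HX x)", OF X tots(2) pre(3)])
  show "hyph_comp (tot PY) (prj PX) Pt \<in> hyph_hom (tot PY) (hyph_prod X (\<lambda>x. st (HX x)))"
    unfolding ss_prod_sel(2)[symmetric] by (rule hyph_comp_in[OF pre(3,1,2) P_in(1) pre(5)])
  show "hyph_comp (tot PY) Ps (prj PY) \<in> hyph_hom (tot PY) (hyph_prod X (\<lambda>x. st (HX x)))"
    unfolding ss_prod_sel(2)[symmetric] by (rule hyph_comp_in[OF pre(3,4,2,6) P_in(2)])
  fix x assume x: "x \<in> X"
  have "hyph_comp (tot PY) (sX x) (hyph_comp (tot PY) (prj PX) Pt)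
      = hyph_comp (tot PY) (hyph_comp (tot PX) (prj (HX x)) (tX x)) Pt"
    unfolding hyph_comp_assoc[OF P_in(1)] prj_PX[OF x] ..
  also have "\<dots> = hyph_comp (tot PY) (prj (HX x)) (hyph_comp (tot PY) (mtot (\<Phi> x)) (tY x))"
    unfolding hyph_comp_assoc[OF P_in(1), symmetric] pr_P(1)[OF x] ..
  also have "\<dots> = hyph_comp (tot PY) (hyph_comp (tot (HY (\<phi> x))) (mst (\<Phi> x)) (prj (HY (\<phi> x)))) (tY x)"
    unfolding hyph_comp_assoc[OF prs(3)[OF x]] ss_homD(3)[OF \<Phi>[OF x]] ..
  also have "\<dots> = hyph_comp (tot PY) (mst (\<Phi> x)) (hyph_comp (tot PY) (sY x) (prj PY))"
    unfolding prj_PY[OF x] hyph_comp_assoc[OF prs(3)[OF x]] ..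
  also have "\<dots> = hyph_comp (tot PY) (hyph_comp (st PY) (sX x) Ps) (prj PY)"
    unfolding hyph_comp_assoc[OF pre(6)] pr_P(2)[OF x] ..
  also have "\<dots> = hyph_comp (tot PY) (sX x) (hyph_comp (tot PY) Ps (prj PY))"
    unfolding hyph_comp_assoc[OF pre(6)] ..
  finally show "hyph_comp (tot PY) (sX x) (hyph_comp (tot PY) (prj PX) Pt)
      = hyph_comp (tot PY) (sX x) (hyph_comp (tot PY) Ps (prj PY))" .
qed

text \<open>\<open>Pi_mor\<close> is a definite description, so nothing is known of it before
  existence and uniqueness. Both follow separately for the total and state parts from the universal
  property of \<open>hyph_prod\<close>; existence also needs \<open>P_prj\<close>.\<close>

lemma Pi_mor_props:
  "Pi_mor X HX Y HY \<phi> \<Phi> \<in> ss_hom PY PX \<and>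
    (\<forall>x\<in>X. ss_comp PY (ss_pr X HX x) (Pi_mor X HX Y HY \<phi> \<Phi>) = ss_comp PY (\<Phi> x) (ss_pr Y HY (\<phi> x)))"
  unfolding Pi_mor_def
proof (rule theI)
  show "\<lparr>mtot = Pt, mst = Ps\<rparr> \<in> ss_hom PY PX \<and> (\<forall>x\<in>X. ss_comp PY (ss_pr X HX x) \<lparr>mtot = Pt, mst = Ps\<rparr> =
      ss_comp PY (\<Phi> x) (ss_pr Y HY (\<phi> x)))"
    using P_in P_prj pr_P by (simp add: ss_hom_def ss_comp_def ss_pr_def)
  fix Q assume Q: "Q \<in> ss_hom PY PX \<and> (\<forall>x\<in>X. ss_comp PY (ss_pr X HX x) Q = ss_comp PY (\<Phi> x) (ss_pr Y HY (\<phi> x)))"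
  have c: "hyph_comp (tot PY) (tX x) (mtot Q) = hyph_comp (tot PY) (tX x) Pt"
    "hyph_comp (st PY) (sX x) (mst Q) = hyph_comp (st PY) (sX x) Ps" if "x \<in> X" for x
    using Q that pr_P[OF that] by (simp_all add: ss_comp_def ss_pr_def)
  have "mtot Q = Pt"
    by (rule hyph_prod_unique[where a="\<lambda>x. tot (HX x)", OF X tots(1) pre(3)])
      (use ss_homD(1)[OF conjunct1[OF Q]] P_in(1) c in \<open>simp_all add: ss_prod_sel(1)[of X]\<close>)
  moreover have "mst Q = Ps"
    by (rule hyph_prod_unique[where a="\<lambda>x. st (HX x)", OF X tots(2) pre(4)])
      (use ss_homD(2)[OF conjunct1[OF Q]] P_in(2) c in \<open>simp_all add: ss_prod_sel(2)[of X]\<close>)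
  ultimately show "Q = \<lparr>mtot = Pt, mst = Ps\<rparr>" by (intro ssmor.equality) simp_all
qed

end

section \<open>Relatedness of product systems and of their pullbacks\<close>

lemma UUmap_ss_comp:
  assumes "f \<in> ss_hom a b"
  shows "u \<in> points (UU (tot a)) \<Longrightarrow> UUmap (tot a) (mtot (ss_comp a g f)) u = UUmap (tot b) (mtot g) (UUmap (tot a) (mtot f) u)"
    and "u' \<in> points (UU (st a)) \<Longrightarrow> UUmap (st a) (mst (ss_comp a g f)) u' = UUmap (st b) (mst g) (UUmap (st a) (mst f) u')"
  using UUmap_comp[OF ss_homD(1)[OF assms]] UUmap_comp[OF ss_homD(2)[OF assms]] by (simp_all add: ss_comp_def)

lemma tangent_ss_comp:
  assumes a: "pressub a" and b: "pressub b" and c: "pressub c" and f: "f \<in> ss_hom a b" and g: "g \<in> ss_hom b c"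
    and w: "w \<in> points (tangent_bundle (UU (st a)))"
  shows "tangent_map (UU (st a)) (UU (st c)) (UUmap (st a) (mst (ss_comp a g f))) w =
    tangent_map (UU (st b)) (UU (st c)) (UUmap (st b) (mst g))
      (tangent_map (UU (st a)) (UU (st b)) (UUmap (st a) (mst f)) w)"
  by (rule tangent_map_compose[OF pressubD(5)[OF a] pressubD(5)[OF b] pressubD(5)[OF c]
        smap_UUmap[OF pressubD(2)[OF a] ss_homD(2)[OF f]] smap_UUmap[OF pressubD(2)[OF b] ss_homD(2)[OF g]]
        UUmap_ss_comp(2)[OF f] w])

lemma ss_pr_in:
  assumes X: "finite X" and a: "\<And>x. x \<in> X \<Longrightarrow> pressub (a x)" and x: "x \<in> X"
  shows "ss_pr X a x \<in> ss_hom (ss_prod X a) (a x)"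
  using hyph_pr_in[of X "\<lambda>x. tot (a x)" x] hyph_pr_in[of X "\<lambda>x. st (a x)" x] X pressubD(1,2)[OF a] x
    hyph_pr_prj[of X a x] a
  by (simp add: ss_hom_def ss_pr_def ss_prod_sel(1,2))

lemma Crl_points:
  assumes "pressub a" "V \<in> Crl a" "u \<in> points (UU (tot a))"
  shows "V u \<in> points (tangent_bundle (UU (st a)))"
  using assms(2) by (intro smap_points[OF _ assms(3)]) (simp add: Crl_iff[OF assms(1)])

lemma Crl_rel_prod:
  assumes X: "finite X" and HX: "\<And>x. x \<in> X \<Longrightarrow> pressub (HX x)"
    and Y: "finite Y" and HY: "\<And>y. y \<in> Y \<Longrightarrow> pressub (HY y)"
    and \<phi>: "\<And>x. x \<in> X \<Longrightarrow> \<phi> x \<in> Y" and \<Phi>: "\<And>x. x \<in> X \<Longrightarrow> \<Phi> x \<in> ss_hom (HY (\<phi> x)) (HX x)"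
    and wv: "(w, v) \<in> Crl_family_rel X HX Y HY \<phi> \<Phi>"
  shows "(Crl_prod Y HY w, Crl_prod X HX v) \<in> Crl_rel (ss_prod Y HY) (ss_prod X HX) (Pi_mor X HX Y HY \<phi> \<Phi>)"
  unfolding Crl_rel_iff
proof (intro conjI ballI)
  let ?PX = "ss_prod X HX" and ?PY = "ss_prod Y HY" and ?\<Pi> = "Pi_mor X HX Y HY \<phi> \<Phi>"
  have w: "w \<in> (\<Pi>\<^sub>E y\<in>Y. Crl (HY y))" and v: "v \<in> (\<Pi>\<^sub>E x\<in>X. Crl (HX x))"
    and rel: "\<And>x. x \<in> X \<Longrightarrow> (w (\<phi> x), v x) \<in> Crl_rel (HY (\<phi> x)) (HX x) (\<Phi> x)"
    using wv by (simp_all add: Crl_family_rel_def)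
  have PX: "pressub ?PX" and PY: "pressub ?PY"
    by (rule pressub_ss_prod[OF X HX] pressub_ss_prod[OF Y HY], assumption)+
  show cw: "Crl_prod Y HY w \<in> Crl ?PY" by (rule Crl_prod_in[OF Y HY w])
  show cv: "Crl_prod X HX v \<in> Crl ?PX" by (rule Crl_prod_in[OF X HX v])
  have "?\<Pi> \<in> ss_hom ?PY ?PX \<and>
      (\<forall>x\<in>X. ss_comp ?PY (ss_pr X HX x) ?\<Pi> = ss_comp ?PY (\<Phi> x) (ss_pr Y HY (\<phi> x)))"
    by (rule Pi_mor_props[OF X _ Y]) (erule HX HY \<phi> \<Phi>)+
  then have \<Pi>: "?\<Pi> \<in> ss_hom ?PY ?PX"
    and pr\<Pi>: "\<And>x. x \<in> X \<Longrightarrow> ss_comp ?PY (ss_pr X HX x) ?\<Pi> = ss_comp ?PY (\<Phi> x) (ss_pr Y HY (\<phi> x))"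
    by simp_all
  fix u assume u: "u \<in> points (UU (tot ?PY))"
  let ?\<Pi>u = "UUmap (tot ?PY) (mtot ?\<Pi>) u"
  have \<Pi>u: "?\<Pi>u \<in> points (UU (tot ?PX))" by (rule UUmap_points[OF pressubD(1)[OF PY] ss_homD(1)[OF \<Pi>] u])
  have Cu: "Crl_prod Y HY w u \<in> points (tangent_bundle (UU (st ?PY)))" by (rule Crl_points[OF PY cw u])
  show "tangent_map (UU (st ?PY)) (UU (st ?PX)) (UUmap (st ?PY) (mst ?\<Pi>)) (Crl_prod Y HY w u)
      = Crl_prod X HX v ?\<Pi>u"
  proof (rule tangent_UU_prod_eqI[where a="\<lambda>x. st (HX x)", OF X pressubD(2)[OF HX], folded ss_prod_sel(2)])
    show "tangent_map (UU (st ?PY)) (UU (st ?PX)) (UUmap (st ?PY) (mst ?\<Pi>)) (Crl_prod Y HY w u)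
        \<in> points (tangent_bundle (UU (st ?PX)))"
      by (rule tangent_map_points[OF pressubD(5)[OF PY] pressubD(5)[OF PX]
            smap_UUmap[OF pressubD(2)[OF PY] ss_homD(2)[OF \<Pi>]] Cu])
    show "Crl_prod X HX v ?\<Pi>u \<in> points (tangent_bundle (UU (st ?PX)))" by (rule Crl_points[OF PX cv \<Pi>u])
    fix x assume x: "x \<in> X"
    note y = \<phi>[OF x]
    let ?prX = "ss_pr X HX x" and ?prY = "ss_pr Y HY (\<phi> x)"
    have prX: "?prX \<in> ss_hom ?PX (HX x)" and prY: "?prY \<in> ss_hom ?PY (HY (\<phi> x))"
      by (rule ss_pr_in[OF X HX x] ss_pr_in[OF Y HY y], assumption)+
    have "tangent_map (UU (st ?PX)) (UU (st (HX x))) (UUmap (st ?PX) (mst ?prX))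
        (tangent_map (UU (st ?PY)) (UU (st ?PX)) (UUmap (st ?PY) (mst ?\<Pi>)) (Crl_prod Y HY w u))
      = tangent_map (UU (st (HY (\<phi> x)))) (UU (st (HX x))) (UUmap (st (HY (\<phi> x))) (mst (\<Phi> x)))
        (tangent_map (UU (st ?PY)) (UU (st (HY (\<phi> x)))) (UUmap (st ?PY) (mst ?prY)) (Crl_prod Y HY w u))"
      unfolding tangent_ss_comp[OF PY PX HX[OF x] \<Pi> prX Cu, symmetric]
        tangent_ss_comp[OF PY HY[OF y] HX[OF x] prY \<Phi>[OF x] Cu, symmetric] pr\<Pi>[OF x] ..
    also have "tangent_map (UU (st ?PY)) (UU (st (HY (\<phi> x)))) (UUmap (st ?PY) (mst ?prY)) (Crl_prod Y HY w u)
        = w (\<phi> x) (UUmap (tot ?PY) (mtot ?prY) u)"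
      using tangent_Crl_prod[OF Y HY w u[unfolded ss_prod_sel(1)] y] by (simp add: ss_pr_def ss_prod_sel(1,2))
    also have "tangent_map (UU (st (HY (\<phi> x)))) (UU (st (HX x))) (UUmap (st (HY (\<phi> x))) (mst (\<Phi> x))) \<dots>
        = v x (UUmap (tot (HY (\<phi> x))) (mtot (\<Phi> x)) (UUmap (tot ?PY) (mtot ?prY) u))"
      using rel[OF x] UUmap_points[OF pressubD(1)[OF PY] ss_homD(1)[OF prY] u] by (simp add: Crl_rel_iff)
    \<comment> \<open>\<open>pr\<Pi>\<close> was used on states at the start of the chain; here its
      total component moves the argument of \<open>v x\<close> back through
      \<open>?\<Pi>\<close>.\<close>
    also have "\<dots> = v x (UUmap (tot ?PX) (mtot ?prX) ?\<Pi>u)"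
      unfolding UUmap_ss_comp(1)[OF prY u, symmetric] UUmap_ss_comp(1)[OF \<Pi> u, symmetric] pr\<Pi>[OF x] ..
    also have "\<dots> = tangent_map (UU (st ?PX)) (UU (st (HX x))) (UUmap (st ?PX) (mst ?prX)) (Crl_prod X HX v ?\<Pi>u)"
      using tangent_Crl_prod[OF X HX v \<Pi>u[unfolded ss_prod_sel(1)[of X]] x] by (simp add: ss_pr_def ss_prod_sel(1,2)[of X])
    finally show "tangent_map (UU (st ?PX)) (UU (st (HX x))) (UUmap (st ?PX) (hyph_pr X (\<lambda>x. st (HX x)) x))
        (tangent_map (UU (st ?PY)) (UU (st ?PX)) (UUmap (st ?PY) (mst ?\<Pi>)) (Crl_prod Y HY w u))
      = tangent_map (UU (st ?PX)) (UU (st (HX x))) (UUmap (st ?PX) (hyph_pr X (\<lambda>x. st (HX x)) x))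
        (Crl_prod X HX v ?\<Pi>u)"
      by (simp add: ss_pr_def)
  qed
qed

theorem theorem4p4p4:
  fixes X :: "'x set" and Y :: "'y set"
    and HX :: "'x \<Rightarrow> ('o, 'm, 'p, 'i, 'r, 'n, 'q, 'j) ssub"
    and HY :: "'y \<Rightarrow> ('o1, 'm1, 'p1, 'i1, 'r1, 'n1, 'q1, 'j1) ssub"
    and a :: "('o2, 'm2, 'p2, 'i2, 'r2, 'n2, 'q2, 'j2) ssub"
    and b :: "('o3, 'm3, 'p3, 'i3, 'r3, 'n3, 'q3, 'j3) ssub"
  assumes "network X HX a ia"
    and "network Y HY b ib"
    and "network_mor X HX a ia Y HY b ib \<phi> \<Phi> z"
  shows "set_square
    (\<Pi>\<^sub>E y\<in>Y. Crl (HY y)) (\<Pi>\<^sub>E x\<in>X. Crl (HX x))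
    (Crl b) (Crl a)
    (Crl_family_rel X HX Y HY \<phi> \<Phi>)
    (Crl_rel b a z)
    (compose (\<Pi>\<^sub>E y\<in>Y. Crl (HY y)) (Crl_int b (ss_prod Y HY) ib) (Crl_prod Y HY))
    (compose (\<Pi>\<^sub>E x\<in>X. Crl (HX x)) (Crl_int a (ss_prod X HX) ia) (Crl_prod X HX))"
proof -
  let ?PX = "ss_prod X HX" and ?PY = "ss_prod Y HY" and ?\<Pi> = "Pi_mor X HX Y HY \<phi> \<Phi>"
  have X: "finite X" and HX: "\<And>x. x \<in> X \<Longrightarrow> pressub (HX x)" and a: "pressub a" and ia: "interconnection a ?PX ia"
    using assms(1) by (simp_all add: network_def hybrid_ssub_pressub)
  have Y: "finite Y" and HY: "\<And>y. y \<in> Y \<Longrightarrow> pressub (HY y)" and b: "pressub b" and ib: "interconnection b ?PY ib"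
    using assms(2) by (simp_all add: network_def hybrid_ssub_pressub)
  have \<phi>: "\<And>x. x \<in> X \<Longrightarrow> \<phi> x \<in> Y" and \<Phi>: "\<And>x. x \<in> X \<Longrightarrow> \<Phi> x \<in> ss_hom (HY (\<phi> x)) (HX x)"
    and z: "z \<in> ss_hom b a" and comm: "ss_comp b ia z = ss_comp b ?\<Pi> ib"
    using assms(3) by (auto simp: network_mor_def)
  have PX: "pressub ?PX" and PY: "pressub ?PY"
    by (rule pressub_ss_prod[OF X HX] pressub_ss_prod[OF Y HY], assumption)+
  have ia': "ia \<in> ss_hom a ?PX" and ib': "ib \<in> ss_hom b ?PY"
    using ia ib by (simp_all add: interconnection_def)
  have \<Pi>: "?\<Pi> \<in> ss_hom ?PY ?PX"
    by (rule conjunct1[OF Pi_mor_props[OF X _ Y]]) (erule HX HY \<phi> \<Phi>)+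
  have main: "(Crl_int b ?PY ib (Crl_prod Y HY w), Crl_int a ?PX ia (Crl_prod X HX v)) \<in> Crl_rel b a z"
    if wv: "(w, v) \<in> Crl_family_rel X HX Y HY \<phi> \<Phi>" for w v
  proof -
    let ?W = "Crl_int b ?PY ib (Crl_prod Y HY w)" and ?V = "Crl_int a ?PX ia (Crl_prod X HX v)"
    have w: "w \<in> (\<Pi>\<^sub>E y\<in>Y. Crl (HY y))" and v: "v \<in> (\<Pi>\<^sub>E x\<in>X. Crl (HX x))"
      using wv by (simp_all add: Crl_family_rel_def)
    have cw: "Crl_prod Y HY w \<in> Crl ?PY" by (rule Crl_prod_in[OF Y HY w])
    have cv: "Crl_prod X HX v \<in> Crl ?PX" by (rule Crl_prod_in[OF X HX v])
    have W: "?W \<in> Crl b" by (rule Crl_int_in[OF b PY ib cw])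
    have V: "?V \<in> Crl a" by (rule Crl_int_in[OF a PX ia cv])
    have prel: "(Crl_prod Y HY w, Crl_prod X HX v) \<in> Crl_rel ?PY ?PX ?\<Pi>"
      by (rule Crl_rel_prod[OF X _ Y _ _ _ wv]) (erule HX HY \<phi> \<Phi>)+
    have "tangent_map (UU (st b)) (UU (st a)) (UUmap (st b) (mst z)) (?W u) = ?V (UUmap (tot b) (mtot z) u)"
      if u: "u \<in> points (UU (tot b))" for u
    proof (rule interconnection_tangent_inj[OF a PX ia])
      have Wu: "?W u \<in> points (tangent_bundle (UU (st b)))" by (rule Crl_points[OF b W u])
      have zu: "UUmap (tot b) (mtot z) u \<in> points (UU (tot a))"
        by (rule UUmap_points[OF pressubD(1)[OF b] ss_homD(1)[OF z] u])
      have iu: "UUmap (tot b) (mtot ib) u \<in> points (UU (tot ?PY))"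
        by (rule UUmap_points[OF pressubD(1)[OF b] ss_homD(1)[OF ib'] u])
      show "tangent_map (UU (st b)) (UU (st a)) (UUmap (st b) (mst z)) (?W u) \<in> points (tangent_bundle (UU (st a)))"
        by (rule tangent_map_points[OF pressubD(5)[OF b] pressubD(5)[OF a]
              smap_UUmap[OF pressubD(2)[OF b] ss_homD(2)[OF z]] Wu])
      show "?V (UUmap (tot b) (mtot z) u) \<in> points (tangent_bundle (UU (st a)))"
        by (rule Crl_points[OF a V zu])
      have "tangent_map (UU (st a)) (UU (st ?PX)) (UUmap (st a) (mst ia))
          (tangent_map (UU (st b)) (UU (st a)) (UUmap (st b) (mst z)) (?W u))
        = tangent_map (UU (st ?PY)) (UU (st ?PX)) (UUmap (st ?PY) (mst ?\<Pi>))
          (tangent_map (UU (st b)) (UU (st ?PY)) (UUmap (st b) (mst ib)) (?W u))"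
        unfolding tangent_ss_comp[OF b a PX z ia' Wu, symmetric] tangent_ss_comp[OF b PY PX ib' \<Pi> Wu, symmetric] comm ..
      \<comment> \<open>Relatedness of the pullback along \<open>ib\<close> exposes
        \<open>Crl_prod Y HY w\<close>, and \<open>prel\<close> carries it across
        \<open>?\<Pi>\<close>.\<close>
      also have "\<dots> = Crl_prod X HX v (UUmap (tot ?PY) (mtot ?\<Pi>) (UUmap (tot b) (mtot ib) u))"
        unfolding tangent_Crl_int[OF b PY ib cw u] using prel iu by (simp add: Crl_rel_iff)
      \<comment> \<open>The equation \<open>comm\<close> has served on states in the first equality;
        its total component now replaces \<open>?\<Pi>\<close> after \<open>ib\<close> by
        \<open>ia\<close> after \<open>z\<close>.\<close>
      also have "\<dots> = Crl_prod X HX v (UUmap (tot a) (mtot ia) (UUmap (tot b) (mtot z) u))"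
        unfolding UUmap_ss_comp(1)[OF ib' u, symmetric] UUmap_ss_comp(1)[OF z u, symmetric] comm ..
      also have "\<dots> = tangent_map (UU (st a)) (UU (st ?PX)) (UUmap (st a) (mst ia)) (?V (UUmap (tot b) (mtot z) u))"
        by (rule tangent_Crl_int[OF a PX ia cv zu, symmetric])
      finally show "tangent_map (UU (st a)) (UU (st ?PX)) (UUmap (st a) (mst ia))
          (tangent_map (UU (st b)) (UU (st a)) (UUmap (st b) (mst z)) (?W u))
        = tangent_map (UU (st a)) (UU (st ?PX)) (UUmap (st a) (mst ia)) (?V (UUmap (tot b) (mtot z) u))" .
    qed
    then show ?thesis using W V by (simp add: Crl_rel_iff)
  qed
  show ?thesis
    unfolding set_square_def
  proof (intro conjI)
    show "Crl_family_rel X HX Y HY \<phi> \<Phi> \<subseteq> (\<Pi>\<^sub>E y\<in>Y. Crl (HY y)) \<times> (\<Pi>\<^sub>E x\<in>X. Crl (HX x))"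
      by (auto simp: Crl_family_rel_def)
    show "Crl_rel b a z \<subseteq> Crl b \<times> Crl a" by (auto simp: Crl_rel_def)
    show "compose (\<Pi>\<^sub>E y\<in>Y. Crl (HY y)) (Crl_int b ?PY ib) (Crl_prod Y HY) \<in> (\<Pi>\<^sub>E y\<in>Y. Crl (HY y)) \<rightarrow>\<^sub>E Crl b"
      unfolding compose_def restrict_PiE_iff by (intro ballI Crl_int_in[OF b PY ib Crl_prod_in[OF Y HY]])
    show "compose (\<Pi>\<^sub>E x\<in>X. Crl (HX x)) (Crl_int a ?PX ia) (Crl_prod X HX) \<in> (\<Pi>\<^sub>E x\<in>X. Crl (HX x)) \<rightarrow>\<^sub>E Crl a"
      unfolding compose_def restrict_PiE_iff by (intro ballI Crl_int_in[OF a PX ia Crl_prod_in[OF X HX]])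
    show "map_prod (compose (\<Pi>\<^sub>E y\<in>Y. Crl (HY y)) (Crl_int b ?PY ib) (Crl_prod Y HY))
        (compose (\<Pi>\<^sub>E x\<in>X. Crl (HX x)) (Crl_int a ?PX ia) (Crl_prod X HX)) ` Crl_family_rel X HX Y HY \<phi> \<Phi>
        \<subseteq> Crl_rel b a z"
    proof (rule image_subsetI)
      fix r assume r: "r \<in> Crl_family_rel X HX Y HY \<phi> \<Phi>"
      obtain w v where wv: "r = (w, v)" by (cases r)
      have "w \<in> (\<Pi>\<^sub>E y\<in>Y. Crl (HY y))" "v \<in> (\<Pi>\<^sub>E x\<in>X. Crl (HX x))"
        using r wv by (simp_all add: Crl_family_rel_def)
      then show "map_prod (compose (\<Pi>\<^sub>E y\<in>Y. Crl (HY y)) (Crl_int b ?PY ib) (Crl_prod Y HY))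
          (compose (\<Pi>\<^sub>E x\<in>X. Crl (HX x)) (Crl_int a ?PX ia) (Crl_prod X HX)) r \<in> Crl_rel b a z"
        using main[of w v] r wv by (simp add: compose_eq)
    qed
  qed
qed

end
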